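(* Let $F$, $\omega$, $U$, $\gamma(t)$, the Melnikov functions $M_i$, the differential $\tilde d$, Françoise pairs and Godbillon-Vey pairs be as in the context, and let $k$ be a positive integer. Consider forms $$\Omega=R\,d\epsilon+(dF+\epsilon\omega)\,G,\qquad G=\sum_{i\ge 0}\epsilon^iG_i,\quad R=\sum_{i\ge 0}\epsilon^iR_{i+1},\quad G_0\equiv 1,$$ where the other $G_i$ and the $R_i$ are unknown functions, and the equation $$\Omega\wedge\tilde d\,\Omega=0 \mod \epsilon^{k+1}.\qquad ( * )$$ (i) The Melnikov functions $M_i$, $i=1,\ldots,k$, are identically equal to zero if and only if one can solve the equation $( * )$. (ii) For each choice of the Françoise sequence $(g_i,r_i)$, $i=1,\ldots,k$, the Godbillon-Vey sequence $(G_i,R_i)$, $i=1,\ldots,k$, can be chosen verifying the equations $$G_i=(-1)^i g_i,\qquad R_i=(-1)^{i+1}\,i\,r_i.\qquad ( ** )$$ (iii) If $\Omega$ verifies $( * )$, then: (a) there exists a function $N=1+\sum_{i=1}^k\epsilon^i n_i$ such that $$\Omega=N\,\tilde d F_\epsilon \mod \epsilon^{k+1}.$$ Then the function $F_\epsilon$ is of the form $$F_\epsilon=F+\sum_{i=1}^k(-1)^{i+1}\epsilon^i r_i,$$ and $$\tilde d F_\epsilon=\tilde R\,d\epsilon+\tilde G\,(dF+\epsilon\omega).$$ (b) Let $\tilde G$ and $\tilde R$ be given by the last formula in (a), and let now $(G_i,R_i)$, $i=1,\ldots,k$, denote their coefficients, i.e. $\tilde G=\sum_{i\ge0}\epsilon^iG_i$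 with $G_0\equiv1$ and $\tilde R=\sum_{i\ge0}\epsilon^iR_{i+1}$. Then the functions $(g_i,r_i)$, $i=1,\ldots,k$, given by $( ** )$ are Françoise pairs.
   Context: Setting. Let $\gamma_0\subset\mathbb{C}^2$ be a regular curve (cycle), $\Sigma$ a transversal to $\gamma_0$, and $F$ a holomorphic function defined on a tubular neighborhood $U\subset\mathbb{C}^2$ of $\gamma_0$, formed by regular curves (cycles) $\gamma(t)\subset F^{-1}(t)$, $t\in F(\Sigma)$, with $\gamma_0=\gamma(t_0)$. Let $\omega$ be a holomorphic one-form on $U$. Consider the holomorphic deformation $dF+\epsilon\omega=0$ of the integrable foliation $dF=0$ in $U$. Its displacement function $\Delta(t)$ is the holonomy of the deformation along $\gamma(t)$ minus the identity. It is expanded as $\Delta(t)=\sum_{i\ge1}\epsilon^iM_i(t)$, and the functions $M_i$ are called the Melnikov functions. Functions. The functions $g_i$, $r_i$, $G_i$, $R_i$ and $n_i$ are functions of $(x,y)$, holomorphic and univalued in the tubular neighborhood $U$ of the cycle. Françoise pairs. Put $g_0=1$. A pair $(g_i,r_i)$ verifying $$g_{i-1}\,\omega=g_i\,dF+dr_i$$ is called an $i$-th Françoise pair associated to the deformation, and the sequence of such pairs is called a Françoise sequence. Godbillon-Vey pairs. The pairs $(G_i,R_i)$ of coefficients of a form $\Omega$ (of the shape given in the claim) verifying $( * )$ are called Godbillon-Vey pairs associated to the deformation, and the sequence of such pairs is called a Godbillon-Vey sequence associated to the deformation. Notation. $\tilde d=d_\epsilon+d$ denotes the total differential with respect to all variables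 $x,y,\epsilon$, where $d$ is the differential in $x,y$. Define weights of monomials by $w(x)=w(y)=w(dx)=w(dy)=0$ and $w(\epsilon)=w(d\epsilon)=1$. Equation $( * )$ is equivalent to $\Omega\wedge\tilde d\,\Omega$ consisting only of terms of weight $>k+1$; since every term of this three-form contains $d\epsilon$, this says that its coefficient is divisible by $\epsilon^{k+1}$.
   Formalization: "mod ε^{k+1}" is taken as modulo weight ≥ k+1: in ( * ) the coefficient need only be divisible by ε^k, and in (iii) dε-coefficients are compared only below ε^k; the last formula in (a) holds only modulo ε^{k+1}. F_ε is determined up to an additive constant. *)

theory Defs
  imports "HOL-Analysis.Analysis" "HOL-Computational_Algebra.Formal_Power_Series"
begin

section \<open>Holomorphic functions and one-forms in two variables\<close>

type_synonym pt = "complex \<times> complex"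

definition holo2 :: "(pt \<Rightarrow> complex) \<Rightarrow> pt set \<Rightarrow> bool" where
  "holo2 f U \<longleftrightarrow> (\<forall>p\<in>U. \<exists>a b. (f has_derivative (\<lambda>(h, l). a * h + b * l)) (at p))"

definition Dx :: "(pt \<Rightarrow> complex) \<Rightarrow> pt \<Rightarrow> complex" where
  "Dx f p = deriv (\<lambda>z. f (z, snd p)) (fst p)"

definition Dy :: "(pt \<Rightarrow> complex) \<Rightarrow> pt \<Rightarrow> complex" where
  "Dy f p = deriv (\<lambda>z. f (fst p, z)) (snd p)"

text \<open>A one-form \<open>P dx + Q dy\<close> is given by its pair of coefficients \<open>p \<mapsto> (P p, Q p)\<close>.\<close>

type_synonym oneform = "pt \<Rightarrow> complex \<times> complex"

definition holo_form :: "oneform \<Rightarrow> pt set \<Rightarrow> bool" where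
  "holo_form \<omega> U \<longleftrightarrow> holo2 (\<lambda>p. fst (\<omega> p)) U \<and> holo2 (\<lambda>p. snd (\<omega> p)) U"

definition dform :: "(pt \<Rightarrow> complex) \<Rightarrow> oneform" where
  "dform f p = (Dx f p, Dy f p)"

definition pairing :: "oneform \<Rightarrow> pt \<Rightarrow> pt \<Rightarrow> complex" where
  "pairing \<omega> p v = fst (\<omega> p) * fst v + snd (\<omega> p) * snd v"


section \<open>The tubular neighbourhood and the Melnikov functions\<close>

definition C1_on :: "(pt \<Rightarrow> pt) \<Rightarrow> pt set \<Rightarrow> bool" where
  "C1_on f S \<longleftrightarrow>
     (\<exists>f' :: pt \<Rightarrow> pt \<Rightarrow>\<^sub>L pt.
        (\<forall>q\<in>S. (f has_derivative blinfun_apply (f' q)) (at q)) \<and> continuous_on S f')"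

definition annulus :: "complex set" where
  "annulus = {z. 1/2 < norm z \<and> norm z < 2}"

text \<open>
  A tubular neighbourhood of a circle in \<open>\<complex>\<^sup>2\<close> is a copy of
  \<open>S\<^sup>1 \<times> D\<^sup>3\<close>. Here it is adapted to \<open>F\<close>: a (real) diffeomorphism \<open>\<Phi>\<close> from
  annulus \<open>\<times> F(\<Sigma>)\<close> to \<open>U\<close>, with \<open>F(\<Sigma>)\<close> an open topological disc, sends each annulus onto
  a fibre of \<open>F\<close>; its core circle is the cycle \<open>\<gamma>(t)\<close>, parametrised by \<open>[0,1]\<close> from the
  point of the transversal \<open>\<Sigma>\<close> over \<open>t\<close>, and \<open>\<Sigma>\<close> is a holomorphic section of \<open>F\<close>. As
  \<open>F \<circ> \<Phi>\<close> is the second projection, \<open>dF\<close> has no zeros in \<open>U\<close> and every \<open>\<gamma>(t)\<close> is a regular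
  simple closed curve. The radii \<open>1/2\<close> and \<open>2\<close> are immaterial, because \<open>\<Phi>\<close> is not required to
  be holomorphic.\<close>

definition tubular_cycles ::
  "pt set \<Rightarrow> (pt \<Rightarrow> complex) \<Rightarrow> pt set \<Rightarrow> (complex \<Rightarrow> real \<Rightarrow> pt) \<Rightarrow> bool" where
  "tubular_cycles U F \<Sigma> \<gamma> \<longleftrightarrow>
     open U \<and> holo2 F U \<and> open (F ` \<Sigma>) \<and> simply_connected (F ` \<Sigma>) \<and>
     (\<exists>\<Phi> \<Psi>.
        C1_on \<Phi> (annulus \<times> F ` \<Sigma>) \<and> C1_on \<Psi> U \<and>
        (\<forall>q \<in> annulus \<times> F ` \<Sigma>. \<Phi> q \<in> U \<and> \<Psi> (\<Phi> q) = q \<and> F (\<Phi> q) = snd q) \<and>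
        (\<forall>p\<in>U. \<Psi> p \<in> annulus \<times> F ` \<Sigma> \<and> \<Phi> (\<Psi> p) = p) \<and>
        (\<forall>t \<in> F ` \<Sigma>. \<forall>s\<in>{0..1}. \<gamma> t s = \<Phi> (cis (2 * pi * s), t)) \<and>
        \<Sigma> = (\<lambda>t. \<Phi> (1, t)) ` (F ` \<Sigma>) \<and>
        (\<lambda>t. fst (\<Phi> (1, t))) holomorphic_on (F ` \<Sigma>) \<and>
        (\<lambda>t. snd (\<Phi> (1, t))) holomorphic_on (F ` \<Sigma>))"

text \<open>
  The holonomy of \<open>dF + \<epsilon>\<omega> = 0\<close> along \<open>\<gamma>(t)\<close>, in the coordinate \<open>F\<close> on \<open>\<Sigma>\<close>: the cycle
  \<open>\<gamma>(t)\<close> is deformed to paths \<open>c \<epsilon>\<close> that lie in leaves of the deformed foliation, start at the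
  same point of \<open>\<Sigma>\<close> and end on \<open>\<Sigma>\<close> at the point over \<open>t + \<Delta> t \<epsilon>\<close>. The family is \<open>C\<^sup>1\<close> along
  the paths, continuously in \<open>\<epsilon>\<close>; continuity determines the germ of \<open>\<Delta> t\<close> at \<open>\<epsilon> = 0\<close>.\<close>

definition displacement_function ::
  "pt set \<Rightarrow> (pt \<Rightarrow> complex) \<Rightarrow> oneform \<Rightarrow> pt set \<Rightarrow> (complex \<Rightarrow> real \<Rightarrow> pt) \<Rightarrow>
   (complex \<Rightarrow> complex \<Rightarrow> complex) \<Rightarrow> bool" where
  "displacement_function U F \<omega> \<Sigma> \<gamma> \<Delta> \<longleftrightarrow>
     (\<forall>t \<in> F ` \<Sigma>. \<exists>\<delta>>0. \<exists>c c' :: complex \<Rightarrow> real \<Rightarrow> pt.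
        continuous_on (ball 0 \<delta> \<times> {0..1}) (\<lambda>(\<epsilon>, s). c \<epsilon> s) \<and>
        continuous_on (ball 0 \<delta> \<times> {0..1}) (\<lambda>(\<epsilon>, s). c' \<epsilon> s) \<and>
        (\<forall>s\<in>{0..1}. c 0 s = \<gamma> t s) \<and>
        (\<forall>\<epsilon> \<in> ball 0 \<delta>.
           (\<forall>s\<in>{0..1}. c \<epsilon> s \<in> U \<and>
              (c \<epsilon> has_vector_derivative c' \<epsilon> s) (at s within {0..1}) \<and>
              pairing (dform F) (c \<epsilon> s) (c' \<epsilon> s) + \<epsilon> * pairing \<omega> (c \<epsilon> s) (c' \<epsilon> s) = 0) \<and>
           c \<epsilon> 0 = \<gamma> t 0 \<and> c \<epsilon> 1 \<in> \<Sigma> \<and> F (c \<epsilon> 1) = t + \<Delta> t \<epsilon>))"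

text \<open>\<open>M\<^sub>0\<close> is not used.\<close>

definition melnikov_functions ::
  "pt set \<Rightarrow> (pt \<Rightarrow> complex) \<Rightarrow> oneform \<Rightarrow> pt set \<Rightarrow> (complex \<Rightarrow> real \<Rightarrow> pt) \<Rightarrow>
   (nat \<Rightarrow> complex \<Rightarrow> complex) \<Rightarrow> bool" where
  "melnikov_functions U F \<omega> \<Sigma> \<gamma> M \<longleftrightarrow>
     (\<exists>\<Delta>. displacement_function U F \<omega> \<Sigma> \<gamma> \<Delta> \<and>
        (\<forall>t \<in> F ` \<Sigma>. eventually (\<lambda>\<epsilon>. (\<lambda>i. \<epsilon> ^ Suc i * M (Suc i) t) sums \<Delta> t \<epsilon>) (nhds 0)))"


section \<open>Differential forms in \<open>x, y, \<epsilon>\<close>\<close>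

text \<open>Functions are formal power series in \<open>\<epsilon>\<close> whose coefficients are functions of \<open>(x, y)\<close>.\<close>

type_synonym series = "pt \<Rightarrow> complex fps"

definition eps_series :: "(nat \<Rightarrow> pt \<Rightarrow> complex) \<Rightarrow> series" where
  "eps_series a p = Abs_fps (\<lambda>i. a i p)"

definition holo_series :: "series \<Rightarrow> pt set \<Rightarrow> bool" where
  "holo_series f U \<longleftrightarrow> (\<forall>i. holo2 (\<lambda>p. fps_nth (f p) i) U)"

definition sDx :: "series \<Rightarrow> series" where
  "sDx f p = Abs_fps (\<lambda>i. Dx (\<lambda>q. fps_nth (f q) i) p)"

definition sDy :: "series \<Rightarrow> series" where
  "sDy f p = Abs_fps (\<lambda>i. Dy (\<lambda>q. fps_nth (f q) i) p)"

definition sDe :: "series \<Rightarrow> series" where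
  "sDe f p = fps_deriv (f p)"

text \<open>
  \<open>Form1 a b c\<close> is \<open>a dx + b dy + c d\<epsilon>\<close>, and \<open>Form2 a b c\<close> is
  \<open>a dx \<and> dy + b dx \<and> d\<epsilon> + c dy \<and> d\<epsilon>\<close>. A three-form is given by its coefficient of
  \<open>dx \<and> dy \<and> d\<epsilon>\<close>.\<close>

datatype form1 = Form1 (cx: series) (cy: series) (ce: series)
datatype form2 = Form2 (cxy: series) (cxe: series) (cye: series)

definition add1 :: "form1 \<Rightarrow> form1 \<Rightarrow> form1" where
  "add1 \<alpha> \<beta> = Form1 (\<lambda>p. cx \<alpha> p + cx \<beta> p) (\<lambda>p. cy \<alpha> p + cy \<beta> p) (\<lambda>p. ce \<alpha> p + ce \<beta> p)"

definition scale1 :: "series \<Rightarrow> form1 \<Rightarrow> form1" where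
  "scale1 f \<alpha> = Form1 (\<lambda>p. f p * cx \<alpha> p) (\<lambda>p. f p * cy \<alpha> p) (\<lambda>p. f p * ce \<alpha> p)"

definition deps :: form1 where
  "deps = Form1 (\<lambda>p. 0) (\<lambda>p. 0) (\<lambda>p. 1)"

definition lift_form :: "oneform \<Rightarrow> form1" where
  "lift_form \<omega> = Form1 (\<lambda>p. fps_const (fst (\<omega> p))) (\<lambda>p. fps_const (snd (\<omega> p))) (\<lambda>p. 0)"

definition dt0 :: "series \<Rightarrow> form1" where
  "dt0 f = Form1 (sDx f) (sDy f) (sDe f)"

definition dt1 :: "form1 \<Rightarrow> form2" where
  "dt1 \<alpha> = Form2 (\<lambda>p. sDx (cy \<alpha>) p - sDy (cx \<alpha>) p)
                 (\<lambda>p. sDx (ce \<alpha>) p - sDe (cx \<alpha>) p)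
                 (\<lambda>p. sDy (ce \<alpha>) p - sDe (cy \<alpha>) p)"

definition wedge12 :: "form1 \<Rightarrow> form2 \<Rightarrow> series" where
  "wedge12 \<alpha> \<beta> p = cx \<alpha> p * cye \<beta> p - cy \<alpha> p * cxe \<beta> p + ce \<alpha> p * cxy \<beta> p"

text \<open>
  Reduction modulo \<open>\<epsilon>\<^sup>m\<close> discards the terms of weight at least \<open>m\<close>, where \<open>x, y, dx, dy\<close> have
  weight \<open>0\<close> and both \<open>\<epsilon>\<close> and \<open>d\<epsilon>\<close> have weight \<open>1\<close>. Thus \<open>\<epsilon>\<^sup>i dx\<close> and \<open>\<epsilon>\<^sup>i dy\<close> have weight
  \<open>i\<close>, whereas \<open>\<epsilon>\<^sup>i d\<epsilon>\<close> and \<open>\<epsilon>\<^sup>i dx \<and> dy \<and> d\<epsilon>\<close> have weight \<open>i + 1\<close>. Demanding the further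
  coefficient of \<open>\<epsilon>\<^sup>m\<^sup>-\<^sup>1 dx \<and> dy \<and> d\<epsilon>\<close> of \<open>\<Omega> \<and> d\<Omega>\<close> to vanish for \<open>m = k + 1\<close> would
  force \<open>M\<^bsub>k+1\<^esub> = 0\<close> in addition to \<open>M\<^sub>1 = \<dots> = M\<^sub>k = 0\<close>.\<close>

definition fun_eq_mod :: "nat \<Rightarrow> pt set \<Rightarrow> series \<Rightarrow> series \<Rightarrow> bool" where
  "fun_eq_mod m U f g \<longleftrightarrow> (\<forall>p\<in>U. \<forall>i. i < m \<longrightarrow> fps_nth (f p) i = fps_nth (g p) i)"

definition form1_eq_mod :: "nat \<Rightarrow> pt set \<Rightarrow> form1 \<Rightarrow> form1 \<Rightarrow> bool" where
  "form1_eq_mod m U \<alpha> \<beta> \<longleftrightarrow>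
     (\<forall>p\<in>U. \<forall>i.
        (i < m \<longrightarrow> fps_nth (cx \<alpha> p) i = fps_nth (cx \<beta> p) i \<and>
                   fps_nth (cy \<alpha> p) i = fps_nth (cy \<beta> p) i) \<and>
        (i + 1 < m \<longrightarrow> fps_nth (ce \<alpha> p) i = fps_nth (ce \<beta> p) i))"

definition form3_zero_mod :: "nat \<Rightarrow> pt set \<Rightarrow> series \<Rightarrow> bool" where
  "form3_zero_mod m U f \<longleftrightarrow> (\<forall>p\<in>U. \<forall>i. i + 1 < m \<longrightarrow> fps_nth (f p) i = 0)"


section \<open>Godbillon-Vey and Francoise sequences\<close>

text \<open>The indices of \<open>R\<close> start at \<open>1\<close>; \<open>R 0\<close> is not used.\<close>

definition gv_form ::
  "(pt \<Rightarrow> complex) \<Rightarrow> oneform \<Rightarrow> (nat \<Rightarrow> pt \<Rightarrow> complex) \<Rightarrow> (nat \<Rightarrow> pt \<Rightarrow> complex) \<Rightarrow> form1" where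
  "gv_form F \<omega> G R =
     add1 (scale1 (eps_series (\<lambda>i. R (i + 1))) deps)
          (scale1 (eps_series G)
             (add1 (lift_form (dform F)) (scale1 (\<lambda>p. fps_X) (lift_form \<omega>))))"

definition gv_coeffs ::
  "pt set \<Rightarrow> (nat \<Rightarrow> pt \<Rightarrow> complex) \<Rightarrow> (nat \<Rightarrow> pt \<Rightarrow> complex) \<Rightarrow> bool" where
  "gv_coeffs U G R \<longleftrightarrow>
     (\<forall>p\<in>U. G 0 p = 1) \<and> (\<forall>i\<ge>1. holo2 (G i) U \<and> holo2 (R i) U)"

definition gv_sequence ::
  "pt set \<Rightarrow> (pt \<Rightarrow> complex) \<Rightarrow> oneform \<Rightarrow> nat \<Rightarrow>
   (nat \<Rightarrow> pt \<Rightarrow> complex) \<Rightarrow> (nat \<Rightarrow> pt \<Rightarrow> complex) \<Rightarrow> bool" where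
  "gv_sequence U F \<omega> k G R \<longleftrightarrow>
     gv_coeffs U G R \<and>
     form3_zero_mod (k + 1) U (wedge12 (gv_form F \<omega> G R) (dt1 (gv_form F \<omega> G R)))"

definition francoise_sequence ::
  "pt set \<Rightarrow> (pt \<Rightarrow> complex) \<Rightarrow> oneform \<Rightarrow> nat \<Rightarrow>
   (nat \<Rightarrow> pt \<Rightarrow> complex) \<Rightarrow> (nat \<Rightarrow> pt \<Rightarrow> complex) \<Rightarrow> bool" where
  "francoise_sequence U F \<omega> k g r \<longleftrightarrow>
     (\<forall>p\<in>U. g 0 p = 1) \<and>
     (\<forall>i\<in>{1..k}. holo2 (g i) U \<and> holo2 (r i) U \<and>
        (\<forall>p\<in>U. g (i - 1) p * fst (\<omega> p) = g i p * Dx F p + Dx (r i) p \<and>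
               g (i - 1) p * snd (\<omega> p) = g i p * Dy F p + Dy (r i) p))"

definition gv_francoise_relation ::
  "pt set \<Rightarrow> nat \<Rightarrow> (nat \<Rightarrow> pt \<Rightarrow> complex) \<Rightarrow> (nat \<Rightarrow> pt \<Rightarrow> complex) \<Rightarrow>
   (nat \<Rightarrow> pt \<Rightarrow> complex) \<Rightarrow> (nat \<Rightarrow> pt \<Rightarrow> complex) \<Rightarrow> bool" where
  "gv_francoise_relation U k g r G R \<longleftrightarrow>
     (\<forall>i\<in>{1..k}. \<forall>p\<in>U. G i p = (-1) ^ i * g i p \<and>
                        R i p = (-1) ^ (i + 1) * of_nat i * r i p)"

definition N_series :: "nat \<Rightarrow> (nat \<Rightarrow> pt \<Rightarrow> complex) \<Rightarrow> series" where
  "N_series k n p = 1 + (\<Sum>i=1..k. fps_X ^ i * fps_const (n i p))"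

definition F_series :: "(pt \<Rightarrow> complex) \<Rightarrow> nat \<Rightarrow> (nat \<Rightarrow> pt \<Rightarrow> complex) \<Rightarrow> series" where
  "F_series F k r p =
     fps_const (F p) + (\<Sum>i=1..k. (-1) ^ (i + 1) * fps_X ^ i * fps_const (r i p))"

definition factorization_mod ::
  "pt set \<Rightarrow> nat \<Rightarrow> form1 \<Rightarrow> (nat \<Rightarrow> pt \<Rightarrow> complex) \<Rightarrow> series \<Rightarrow> bool" where
  "factorization_mod U k \<Omega> n Fe \<longleftrightarrow>
     (\<forall>i\<in>{1..k}. holo2 (n i) U) \<and> holo_series Fe U \<and>
     form1_eq_mod (k + 1) U \<Omega> (scale1 (N_series k n) (dt0 Fe))"

end

theory Submission
  imports Defs "HOL-Complex_Analysis.Cauchy_Integral_Formula"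
begin

text \<open>
  Put \<open>\<alpha> = dF + \<epsilon>\<omega>\<close>. Three descriptions of ``the deformation is integrable to order \<open>k\<close>'' are compared:
  by the Melnikov functions, by Francoise sequences and by Godbillon-Vey forms.

  \<^emph>\<open>Francoise sequences are potentials.\<close> Suppose \<open>H = F + \<epsilon> H\<^sub>1 + \<epsilon>\<^sup>2 H\<^sub>2 + \<dots>\<close> and
  \<open>u = 1 + \<epsilon> u\<^sub>1 + \<dots>\<close> satisfy \<open>dH = u \<alpha>\<close> to order \<open>k\<close>. The coefficient of \<open>\<epsilon>\<^sup>i\<close> says
  \<open>dH\<^sub>i = u\<^sub>i dF + u\<^bsub>i-1\<^esub> \<omega>\<close>, which is the equation of a Francoise pair for \<open>g\<^sub>i = (-1)\<^sup>i u\<^sub>i\<close> and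
  \<open>r\<^sub>i = (-1)\<^bsup>i+1\<^esup> H\<^sub>i\<close>. The total differential of \<open>H\<close> is \<open>u \<alpha> + (\<partial>H/\<partial>\<epsilon>) d\<epsilon>\<close>, so its
  coefficients are \<open>G\<^sub>i = u\<^sub>i\<close> and \<open>R\<^sub>i = i H\<^sub>i\<close>, and it is integrable since it is closed
  (\<open>francoise_imp_godbillon_vey\<close>). Conversely, let \<open>\<Omega> = G (\<alpha> + Q d\<epsilon>)\<close> be integrable. A factor \<open>u\<close>
  for which \<open>u (\<alpha> + Q d\<epsilon>)\<close> is closed is found one power of \<open>\<epsilon>\<close> at a time from
  \<open>\<partial>(u \<alpha>)/\<partial>\<epsilon> = d(u Q)\<close>: the error of order \<open>m\<close> is a one-form in \<open>x, y\<close>, integrability says that it is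
  proportional to \<open>dF\<close>, and the quotient, which exists on all of \<open>U\<close> because \<open>dF\<close> has no zeros
  there, is the next correction of \<open>u\<close> (\<open>integrating_factor\<close>). The potential is recovered from
  \<open>\<partial>H/\<partial>\<epsilon> = u Q\<close>, and \<open>\<Omega> = (G / u) dH\<close> with \<open>d\<close> the total differential
  (\<open>godbillon_vey_imp_francoise\<close>). The statements about an arbitrary
  factorization of \<open>\<Omega>\<close> are comparisons of coefficients.

  \<^emph>\<open>Melnikov functions are periods.\<close> Along a leaf of the deformation \<open>dF = - \<epsilon> \<omega>\<close>, hence a
  Francoise pair turns \<open>\<integral> g\<^bsub>i-1\<^esub> \<omega>\<close> into the increment of \<open>r\<^sub>i\<close> minus \<open>\<epsilon> \<integral> g\<^sub>i \<omega>\<close>. Iteration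
  (\<open>francoise_expansion\<close>) expresses \<open>\<Delta>\<close> by increments of \<open>r\<^sub>1, \<dots>, r\<^sub>j\<close> between two points of
  \<open>\<Sigma>\<close> at distance \<open>O(\<Delta>)\<close>, which do not contribute to the leading term of \<open>\<Delta>\<close>, and by
  \<open>(- \<epsilon>)\<^bsup>j+1\<^esup> \<integral> g\<^sub>j \<omega>\<close>. So \<open>M\<^bsub>j+1\<^esub>(t)\<close> is, up to sign, the period of \<open>g\<^sub>j \<omega>\<close> on \<open>\<gamma>(t)\<close> as soon as
  \<open>M\<^sub>1, \<dots>, M\<^sub>j\<close> vanish (\<open>melnikov_eq_period\<close>). If a next Francoise pair exists, this period is
  the increment of \<open>r\<^bsub>j+1\<^esub>\<close> along a closed curve on which \<open>dF = 0\<close>, that is, zero.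

  \<^emph>\<open>Vanishing periods give Francoise pairs.\<close> This is the analytic core
  (\<open>zero_periods_imp_relatively_exact\<close>): a holomorphic form \<open>\<eta>\<close> on \<open>U\<close> without periods on the cycles is
  \<open>g dF + dr\<close>. The function \<open>r\<close> integrates \<open>\<eta>\<close> along the fibres of \<open>F\<close>, starting on \<open>\<Sigma>\<close>. The
  difficulty is that \<open>r\<close> has to be holomorphic transversally to the fibres although the trivialisation
  \<open>\<Phi>\<close> of the tube is only real \<open>C\<^sup>1\<close>. Near a point \<open>r\<close> is found by straightening \<open>F\<close> holomorphically and
  integrating one complex coordinate. Two local solutions differ by a function of \<open>F\<close>, whose
  derivative is forced to be complex linear, so local solutions can be glued along a path in the
  universal cover of the annulus. They are normalised on \<open>\<Sigma>\<close>, which is a holomorphic section,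
  and the periods are the obstruction to descending from the universal cover.
\<close>

section \<open>Holomorphic functions of two variables\<close>

lemma bounded_linear_pairing: "bounded_linear (pairing \<omega> p)"
  unfolding pairing_def
  by (intro bounded_linear_add bounded_linear_mult_right[THEN bounded_linear_compose]
      bounded_linear_fst bounded_linear_snd)

lemma partials_unique:
  assumes "(f has_derivative (\<lambda>v. a * fst v + b * snd v)) (at p)"
  shows "Dx f p = a" "Dy f p = b"
proof -
  have p: "p = (fst p, snd p)" by simp
  have "((\<lambda>z. (z, snd p)) has_derivative (\<lambda>h. (h, 0))) (at (fst p))"
    by (auto intro!: derivative_eq_intros)
  from has_derivative_compose[OF this] assms
  have "((\<lambda>z. f (z, snd p)) has_derivative (\<lambda>h. a * h)) (at (fst p))" by force
  then show "Dx f p = a" unfolding Dx_def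
    by (intro DERIV_imp_deriv) (simp add: has_field_derivative_def)
  have "((\<lambda>z. (fst p, z)) has_derivative (\<lambda>h. (0, h))) (at (snd p))"
    by (auto intro!: derivative_eq_intros)
  from has_derivative_compose[OF this] assms
  have "((\<lambda>z. f (fst p, z)) has_derivative (\<lambda>h. b * h)) (at (snd p))" by force
  then show "Dy f p = b" unfolding Dy_def
    by (intro DERIV_imp_deriv) (simp add: has_field_derivative_def)
qed

lemma holo2I:
  assumes "\<And>p. p \<in> U \<Longrightarrow> (f has_derivative (\<lambda>v. a p * fst v + b p * snd v)) (at p)"
  shows "holo2 f U"
  unfolding holo2_def case_prod_unfold using assms by blast

lemma holo2_has_derivative:
  assumes "holo2 f U" "p \<in> U"
  shows "(f has_derivative (\<lambda>v. Dx f p * fst v + Dy f p * snd v)) (at p)"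
proof -
  obtain a b where "(f has_derivative (\<lambda>v. a * fst v + b * snd v)) (at p)"
    using assms unfolding holo2_def case_prod_unfold by blast
  with partials_unique[OF this] show ?thesis by simp
qed

lemma holo2_has_derivative_pairing:
  assumes "holo2 f U" "p \<in> U"
  shows "(f has_derivative pairing (dform f) p) (at p)"
  using holo2_has_derivative[OF assms] by (simp add: pairing_def[abs_def] dform_def)

lemma holo2_continuous_on: "holo2 f U \<Longrightarrow> continuous_on U f"
  by (meson holo2_has_derivative has_derivative_continuous continuous_at_imp_continuous_on)

lemma holo2_subset: "holo2 f U \<Longrightarrow> V \<subseteq> U \<Longrightarrow> holo2 f V"
  by (auto simp: holo2_def)

lemma holo2_const [simp]: "holo2 (\<lambda>p. c) U"
  by (rule holo2I[where a="\<lambda>_. 0" and b="\<lambda>_. 0"]) simp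

lemma Dx_const [simp]: "Dx (\<lambda>p. c) p = 0" and Dy_const [simp]: "Dy (\<lambda>p. c) p = 0"
  by (simp_all add: Dx_def Dy_def)

lemma derivative_add_partials:
  assumes "holo2 f U" "holo2 g U" "p \<in> U"
  shows "((\<lambda>p. f p + g p) has_derivative
    (\<lambda>v. (Dx f p + Dx g p) * fst v + (Dy f p + Dy g p) * snd v)) (at p)"
  using has_derivative_add[OF assms(1,2)[THEN holo2_has_derivative, OF assms(3)]]
  by (simp add: algebra_simps)

lemma derivative_mult_partials:
  assumes "holo2 f U" "holo2 g U" "p \<in> U"
  shows "((\<lambda>p. f p * g p) has_derivative
    (\<lambda>v. (f p * Dx g p + Dx f p * g p) * fst v + (f p * Dy g p + Dy f p * g p) * snd v)) (at p)"
  using has_derivative_mult[OF assms(1,2)[THEN holo2_has_derivative, OF assms(3)]]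
  by (simp add: algebra_simps)

lemma derivative_inverse_partials:
  assumes "holo2 f U" "p \<in> U" "f p \<noteq> 0"
  shows "((\<lambda>p. inverse (f p)) has_derivative
    (\<lambda>v. (- Dx f p / (f p)\<^sup>2) * fst v + (- Dy f p / (f p)\<^sup>2) * snd v)) (at p)"
proof -
  have "(\<lambda>h. - (inverse (f p) * (Dx f p * fst h + Dy f p * snd h) * inverse (f p))) =
      (\<lambda>v. (- Dx f p / (f p)\<^sup>2) * fst v + (- Dy f p / (f p)\<^sup>2) * snd v)"
    by (simp add: fun_eq_iff divide_inverse power2_eq_square algebra_simps)
  with Deriv.has_derivative_inverse[OF assms(3) holo2_has_derivative[OF assms(1,2)]]
  show ?thesis by simp
qed

lemma holo2_add [intro]: "holo2 f U \<Longrightarrow> holo2 g U \<Longrightarrow> holo2 (\<lambda>p. f p + g p) U"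
  by (rule holo2I) (rule derivative_add_partials)

lemma holo2_mult [intro]: "holo2 f U \<Longrightarrow> holo2 g U \<Longrightarrow> holo2 (\<lambda>p. f p * g p) U"
  by (rule holo2I) (rule derivative_mult_partials)

lemma holo2_inverse: "holo2 f U \<Longrightarrow> (\<And>p. p \<in> U \<Longrightarrow> f p \<noteq> 0) \<Longrightarrow> holo2 (\<lambda>p. inverse (f p)) U"
  by (rule holo2I) (rule derivative_inverse_partials)

lemma holo2_divide: "holo2 f U \<Longrightarrow> holo2 g U \<Longrightarrow> (\<And>p. p \<in> U \<Longrightarrow> g p \<noteq> 0) \<Longrightarrow> holo2 (\<lambda>p. f p / g p) U"
  unfolding divide_inverse by (intro holo2_mult holo2_inverse)

lemma holo2_cmult [intro]: "holo2 f U \<Longrightarrow> holo2 (\<lambda>p. c * f p) U"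
  by (intro holo2_mult holo2_const)

lemma holo2_minus [intro]: "holo2 f U \<Longrightarrow> holo2 (\<lambda>p. - f p) U"
  using holo2_cmult[of f U "-1"] by simp

lemma holo2_diff [intro]: "holo2 f U \<Longrightarrow> holo2 g U \<Longrightarrow> holo2 (\<lambda>p. f p - g p) U"
  using holo2_add[of f U "\<lambda>p. - g p"] by auto

lemma holo2_sum [intro]: "(\<And>i. i \<in> I \<Longrightarrow> holo2 (f i) U) \<Longrightarrow> holo2 (\<lambda>p. \<Sum>i\<in>I. f i p) U"
  by (induction I rule: infinite_finite_induct) auto

lemma holo2_cong:
  assumes "open U" "\<And>p. p \<in> U \<Longrightarrow> f p = g p" "holo2 f U"
  shows "holo2 g U"
  using holo2_has_derivative[OF assms(3)] has_derivative_transform_within_open[OF _ assms(1)] assms(2)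
  by (intro holo2I) blast

lemma partials_cong:
  assumes "open U" "\<And>p. p \<in> U \<Longrightarrow> f p = g p" "holo2 f U" "p \<in> U"
  shows "Dx f p = Dx g p" "Dy f p = Dy g p"
  using partials_unique[OF has_derivative_transform_within_open[OF
      holo2_has_derivative[OF assms(3,4)] assms(1,4,2)]] by simp_all

lemma
  assumes "holo2 f U" "p \<in> U"
  shows Dx_cmult: "Dx (\<lambda>p. c * f p) p = c * Dx f p" and Dy_cmult: "Dy (\<lambda>p. c * f p) p = c * Dy f p"
  using partials_unique[OF derivative_mult_partials[OF holo2_const assms]] by simp_all

lemma
  assumes "holo2 f U" "holo2 g U" "p \<in> U"
  shows Dx_mult: "Dx (\<lambda>p. f p * g p) p = f p * Dx g p + Dx f p * g p"
    and Dy_mult: "Dy (\<lambda>p. f p * g p) p = f p * Dy g p + Dy f p * g p"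
  using partials_unique[OF derivative_mult_partials[OF assms]] by simp_all

lemma
  assumes "\<And>i. i \<in> I \<Longrightarrow> holo2 (f i) U" "p \<in> U"
  shows Dx_sum: "Dx (\<lambda>p. \<Sum>i\<in>I. f i p) p = (\<Sum>i\<in>I. Dx (f i) p)"
    and Dy_sum: "Dy (\<lambda>p. \<Sum>i\<in>I. f i p) p = (\<Sum>i\<in>I. Dy (f i) p)"
proof -
  have "((\<lambda>p. \<Sum>i\<in>I. f i p) has_derivative
      (\<lambda>v. \<Sum>i\<in>I. (Dx (f i) p * fst v + Dy (f i) p * snd v))) (at p)"
    by (rule has_derivative_sum) (rule holo2_has_derivative[OF assms])
  also have "(\<lambda>v. \<Sum>i\<in>I. (Dx (f i) p * fst v + Dy (f i) p * snd v)) =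
      (\<lambda>v. (\<Sum>i\<in>I. Dx (f i) p) * fst v + (\<Sum>i\<in>I. Dy (f i) p) * snd v)"
    by (simp only: sum.distrib sum_distrib_right)
  finally have "((\<lambda>p. \<Sum>i\<in>I. f i p) has_derivative
      (\<lambda>v. (\<Sum>i\<in>I. Dx (f i) p) * fst v + (\<Sum>i\<in>I. Dy (f i) p) * snd v)) (at p)" .
  from partials_unique[OF this]
  show "Dx (\<lambda>p. \<Sum>i\<in>I. f i p) p = (\<Sum>i\<in>I. Dx (f i) p)"
    "Dy (\<lambda>p. \<Sum>i\<in>I. f i p) p = (\<Sum>i\<in>I. Dy (f i) p)" .
qed

text \<open>
  The complex-linear form \<open>(h, l) \<mapsto> a h + b l\<close> as a bounded operator, so that continuity of a
  derivative in the base point is continuity of the two coefficients.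
\<close>

definition lin2 :: "complex \<Rightarrow> complex \<Rightarrow> pt \<Rightarrow>\<^sub>L complex" where
  "lin2 a b = (blinfun_mult_right a o\<^sub>L fst_blinfun) + (blinfun_mult_right b o\<^sub>L snd_blinfun)"

lemma lin2_apply [simp]: "blinfun_apply (lin2 a b) v = a * fst v + b * snd v"
  by (simp add: lin2_def blinfun.add_left)

lemma continuous_on_lin2 [continuous_intros]:
  "continuous_on S a \<Longrightarrow> continuous_on S b \<Longrightarrow> continuous_on S (\<lambda>x. lin2 (a x) (b x))"
  unfolding lin2_def by (intro continuous_intros) 

text \<open>
  Differentiation under the integral sign. Complex linearity of the derivative survives integration,
  which is how functions defined by integrals are recognised as holomorphic below.
\<close>

lemma has_derivative_integral_param:
  fixes \<phi> :: "pt \<Rightarrow> real \<Rightarrow> complex"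
  assumes V: "open V" "p0 \<in> V"
    and der: "\<And>p s. p \<in> V \<Longrightarrow> s \<in> {0..1} \<Longrightarrow>
      ((\<lambda>p. \<phi> p s) has_derivative (\<lambda>v. A p s * fst v + B p s * snd v)) (at p)"
    and contA: "continuous_on (V \<times> {0..1}) (\<lambda>(p, s). A p s)"
    and contB: "continuous_on (V \<times> {0..1}) (\<lambda>(p, s). B p s)"
    and cont: "\<And>p. p \<in> V \<Longrightarrow> continuous_on {0..1} (\<phi> p)"
  shows "((\<lambda>p. integral {0..1} (\<phi> p)) has_derivative
    (\<lambda>v. integral {0..1} (A p0) * fst v + integral {0..1} (B p0) * snd v)) (at p0)"
proof -
  obtain e where e: "e > 0" "ball p0 e \<subseteq> V" using V open_contains_ball by blast
  let ?W = "ball p0 e"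
  have cont': "continuous_on (?W \<times> cbox 0 1) (\<lambda>(p, s). lin2 (A p s) (B p s))"
  proof -
    have "continuous_on (V \<times> cbox 0 1) (\<lambda>(p, s). lin2 (A p s) (B p s))"
      using continuous_on_lin2[OF contA contB] by (simp add: case_prod_unfold)
    then show ?thesis by (rule continuous_on_subset) (use e in auto)
  qed
  have "((\<lambda>p. integral (cbox 0 1) (\<phi> p)) has_derivative
      integral (cbox 0 1) (\<lambda>s. lin2 (A p0 s) (B p0 s))) (at p0 within ?W)"
  proof (rule leibniz_rule[where U="?W"])
    show "((\<lambda>p. \<phi> p s) has_derivative blinfun_apply (lin2 (A p s) (B p s))) (at p within ?W)"
      if "p \<in> ?W" "s \<in> cbox 0 1" for p s
    proof -
      have "blinfun_apply (lin2 (A p s) (B p s)) = (\<lambda>v. A p s * fst v + B p s * snd v)" by auto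
      moreover have "p \<in> V" "s \<in> {0..1}" using that e by auto
      ultimately show ?thesis using has_derivative_at_withinI[OF der] by metis
    qed
    show "\<phi> p integrable_on cbox 0 1" if "p \<in> ?W" for p
      using cont[of p] that e integrable_continuous_interval[of 0 1 "\<phi> p"] by auto
    show "continuous_on (?W \<times> cbox 0 1) (\<lambda>(p, s). lin2 (A p s) (B p s))" by (rule cont')
  qed (use e in auto)
  moreover have "blinfun_apply (integral {0..1} (\<lambda>s. lin2 (A p0 s) (B p0 s))) =
      (\<lambda>v. integral {0..1} (A p0) * fst v + integral {0..1} (B p0) * snd v)"
  proof
    fix v
    have 1: "continuous_on {0..1} (\<lambda>s. case (p0, s) of (p, s) \<Rightarrow> A p s)"
      by (rule continuous_on_compose2[OF contA]) (use V in \<open>auto intro!: continuous_intros\<close>)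
    have 2: "continuous_on {0..1} (\<lambda>s. case (p0, s) of (p, s) \<Rightarrow> B p s)"
      by (rule continuous_on_compose2[OF contB]) (use V in \<open>auto intro!: continuous_intros\<close>)
    have "(\<lambda>s. lin2 (A p0 s) (B p0 s)) integrable_on {0..1}"
      using 1 2 by (intro integrable_continuous_interval continuous_intros) auto
    then have "blinfun_apply (integral {0..1} (\<lambda>s. lin2 (A p0 s) (B p0 s))) v =
      integral {0..1} (\<lambda>s. A p0 s * fst v + B p0 s * snd v)"
      by (simp add: blinfun_apply_integral)
    also have "\<dots> = integral {0..1} (\<lambda>s. A p0 s * fst v) + integral {0..1} (\<lambda>s. B p0 s * snd v)"
      using 1 2 by (intro integral_add integrable_continuous_interval continuous_intros) auto
    finally show "blinfun_apply (integral {0..1} (\<lambda>s. lin2 (A p0 s) (B p0 s))) v =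
      integral {0..1} (A p0) * fst v + integral {0..1} (B p0) * snd v" by simp
  qed
  ultimately have "((\<lambda>p. integral {0..1} (\<phi> p)) has_derivative
    (\<lambda>v. integral {0..1} (A p0) * fst v + integral {0..1} (B p0) * snd v)) (at p0 within ?W)"
    by (simp add: cbox_interval)
  then show ?thesis using e by (simp add: at_within_open[of p0 ?W])
qed

text \<open>
  Cauchy's formula for the first derivative, on a circle parametrised relative to its centre: the
  circle is then translated with \<open>p\<close>, and \<open>p\<close> enters only through the argument of \<open>f\<close>, so that the
  right-hand side can be differentiated in \<open>p\<close> using derivatives of \<open>f\<close> alone.
\<close>

lemma Dx_Cauchy_integral:
  assumes f: "holo2 f U" and r: "\<rho> > 0" and sub: "\<And>z. cmod z \<le> \<rho> \<Longrightarrow> p + (z, 0) \<in> U"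
  shows "Dx f p = integral {0..1} (\<lambda>s. f (p + (of_real \<rho> * cis (2 * pi * s), 0)) * (cis (- 2 * pi * s) / of_real \<rho>))"
proof -
  define x y where "x = fst p" and "y = snd p"
  have p: "p = (x, y)" by (simp add: x_def y_def)
  define h where "h z = f (z, y)" for z
  have dh: "(h has_field_derivative Dx f (z, y)) (at z)" if "z \<in> cball x \<rho>" for z
  proof -
    have "(z, y) \<in> U" using sub[of "z - x"] that by (simp add: p dist_norm norm_minus_commute)
    note d = holo2_has_derivative[OF f this]
    have "((\<lambda>z. (z, y)) has_derivative (\<lambda>h. (h, 0))) (at z)"
      by (auto intro!: derivative_eq_intros)
    from has_derivative_compose[OF this d] show ?thesis
      by (simp add: has_field_derivative_def h_def[abs_def])
  qed
  have cont: "continuous_on (cball x \<rho>) h"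
    using dh by (meson DERIV_isCont continuous_at_imp_continuous_on)
  have hol: "h holomorphic_on ball x \<rho>"
    unfolding holomorphic_on_open[OF open_ball] using dh ball_subset_cball by blast
  have "deriv h x = 1 / (2 * of_real pi * \<i>) * contour_integral (circlepath x \<rho>) (\<lambda>u. h u / (u - x)\<^sup>2)"
    using Cauchy_derivative_integral_circlepath(2)[OF cont hol, of x] r by (intro DERIV_imp_deriv) simp
  also have "contour_integral (circlepath x \<rho>) (\<lambda>u. h u / (u - x)\<^sup>2) =
     integral {0..1} (\<lambda>s. h (x + \<rho> * cis (2 * pi * s)) / (\<rho> * cis (2 * pi * s))\<^sup>2 *
        (2 * pi * \<i> * \<rho> * cis (2 * pi * s)))"
    unfolding contour_integral_integral
  proof (rule integral_cong)
    fix s :: real assume s: "s \<in> {0..1}"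
    have e: "exp (2 * of_real pi * \<i> * of_real s) = cis (2 * pi * s)"
      by (simp add: cis_conv_exp mult_ac)
    show "h (circlepath x \<rho> s) / (circlepath x \<rho> s - x)\<^sup>2 * vector_derivative (circlepath x \<rho>) (at s) =
      h (x + \<rho> * cis (2 * pi * s)) / (\<rho> * cis (2 * pi * s))\<^sup>2 * (2 * pi * \<i> * \<rho> * cis (2 * pi * s))"
      unfolding vector_derivative_circlepath using e by (simp add: circlepath)
  qed
  also have "\<dots> = integral {0..1} (\<lambda>s. (2 * of_real pi * \<i>) *
      (f (p + (of_real \<rho> * cis (2 * pi * s), 0)) * (cis (- 2 * pi * s) / of_real \<rho>)))"
  proof (rule integral_cong)
    fix s :: real
    have 1: "cis (- 2 * pi * s) = inverse (cis (2 * pi * s))" by simp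
    have "cis (2 * pi * s) \<noteq> 0" by simp
    then show "h (x + \<rho> * cis (2 * pi * s)) / (\<rho> * cis (2 * pi * s))\<^sup>2 * (2 * pi * \<i> * \<rho> * cis (2 * pi * s)) =
      (2 * of_real pi * \<i>) * (f (p + (of_real \<rho> * cis (2 * pi * s), 0)) * (cis (- 2 * pi * s) / of_real \<rho>))"
      unfolding 1 h_def p using r by (simp add: field_simps power2_eq_square)
  qed
  finally show ?thesis unfolding Dx_def h_def[abs_def] x_def y_def by simp
qed

lemma room_for_circles:
  fixes U :: "pt set"
  assumes U: "open U" "p0 \<in> U"
  obtains V \<rho> where "open V" "p0 \<in> V" "V \<subseteq> U" "\<rho> > 0"
    "\<And>p z. p \<in> V \<Longrightarrow> cmod z \<le> \<rho> \<Longrightarrow> p + (z, 0) \<in> U"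
proof -
  obtain e where e: "e > 0" "ball p0 e \<subseteq> U" using U open_contains_ball by blast
  have sub: "p + (z, 0) \<in> U" if "p \<in> ball p0 (e/2)" "cmod z \<le> e/4" for p z
  proof -
    have "dist p0 (p + (z, 0)) \<le> dist p0 p + dist p (p + (z, 0))" by (rule dist_triangle)
    also have "\<dots> < e" using that e by (simp add: norm_Pair dist_norm)
    finally show ?thesis using e by auto
  qed
  show thesis
    by (rule that[of "ball p0 (e/2)" "e/4"]) (use e sub in \<open>auto simp: subset_iff\<close>)
qed

text \<open>
  Complex differentiability alone has to imply a continuous derivative, since both differentiation under
  the integral and the inverse function theorem ask for it. Cauchy's formula provides it.
\<close>

lemma continuous_on_Dx:
  assumes U: "open U" and f: "holo2 f U"
  shows "continuous_on U (Dx f)"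
proof -
  have "isCont (Dx f) p0" if p0: "p0 \<in> U" for p0
  proof -
    obtain V \<rho> where V: "open V" "p0 \<in> V" "V \<subseteq> U" "\<rho> > 0"
      and sub: "\<And>p z. p \<in> V \<Longrightarrow> cmod z \<le> \<rho> \<Longrightarrow> p + (z, 0) \<in> U"
      by (rule room_for_circles[OF U p0]) blast
    have "continuous_on (V \<times> cbox 0 1)
      (\<lambda>(p, s). f (p + (of_real \<rho> * cis (2 * pi * s), 0)) * (cis (- 2 * pi * s) / of_real \<rho>))"
      unfolding case_prod_unfold using V sub
      by (intro continuous_intros continuous_on_compose2[OF holo2_continuous_on[OF f]])
        (auto simp: norm_mult)
    from integral_continuous_on_param[OF this]
    have "continuous_on V (Dx f)"
      using Dx_Cauchy_integral[OF f V(4) sub] by (simp add: cbox_interval cong: continuous_on_cong)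
    then show ?thesis using V continuous_on_eq_continuous_at by blast
  qed
  then show ?thesis by (simp add: continuous_at_imp_continuous_on)
qed

text \<open>
  Exchanging the two variables transports every statement about \<open>Dx\<close> to \<open>Dy\<close>.
\<close>

definition swap2 :: "pt \<Rightarrow> pt" where "swap2 p = (snd p, fst p)"

lemma swap2_simps [simp]: "swap2 (swap2 p) = p" "fst (swap2 p) = snd p" "snd (swap2 p) = fst p"
  by (simp_all add: swap2_def)

lemma swap2_has_derivative: "(swap2 has_derivative swap2) (at p)"
  unfolding swap2_def[abs_def] by (auto intro!: derivative_eq_intros)

lemma Dy_swap2: "Dy f p = Dx (\<lambda>q. f (swap2 q)) (swap2 p)"
  by (simp add: Dx_def Dy_def swap2_def)

lemma open_swap2: "open U \<Longrightarrow> open (swap2 -` U)"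
  using swap2_has_derivative has_derivative_continuous
  by (intro continuous_open_vimage) (auto intro!: has_derivative_continuous)

lemma holo2_swap2: "holo2 f U \<Longrightarrow> holo2 (\<lambda>q. f (swap2 q)) (swap2 -` U)"
proof (rule holo2I)
  fix p assume "holo2 f U" "p \<in> swap2 -` U"
  then show "((\<lambda>q. f (swap2 q)) has_derivative
      (\<lambda>v. Dy f (swap2 p) * fst v + Dx f (swap2 p) * snd v)) (at p)"
    using has_derivative_compose[OF swap2_has_derivative holo2_has_derivative[of f U "swap2 p"]]
    by (simp add: add.commute)
qed

lemma continuous_on_Dy:
  assumes U: "open U" and f: "holo2 f U"
  shows "continuous_on U (Dy f)"
  unfolding Dy_swap2[abs_def]
  by (rule continuous_on_compose2[OF continuous_on_Dx[OF open_swap2[OF U] holo2_swap2[OF f]]])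
    (auto simp: swap2_def intro!: continuous_intros)

text \<open>
  The second partial derivatives of \<open>f\<close> are Cauchy integrals of the first ones. The coefficient of
  \<open>snd v\<close> is also Cauchy's formula for \<open>Dx (Dy f)\<close>, which is why mixed partials commute.
\<close>

lemma Dx_has_derivative_integrals:
  assumes f: "holo2 f U" "open U" and V: "open V" "p0 \<in> V" "\<rho> > 0"
    and sub: "\<And>p z. p \<in> V \<Longrightarrow> cmod z \<le> \<rho> \<Longrightarrow> p + (z, 0) \<in> U"
  shows "(Dx f has_derivative (\<lambda>v.
     integral {0..1} (\<lambda>s. Dx f (p0 + (of_real \<rho> * cis (2 * pi * s), 0)) * (cis (- 2 * pi * s) / of_real \<rho>)) * fst v +
     integral {0..1} (\<lambda>s. Dy f (p0 + (of_real \<rho> * cis (2 * pi * s), 0)) * (cis (- 2 * pi * s) / of_real \<rho>)) * snd v)) (at p0)"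
proof -
  let ?c = "\<lambda>s. cis (- 2 * pi * s) / of_real \<rho>"
  let ?q = "\<lambda>p s. p + (of_real \<rho> * cis (2 * pi * s), 0)"
  have q: "?q p s \<in> U" if "p \<in> V" for p s using sub that V by (simp add: norm_mult)
  have cont: "continuous_on (V \<times> {0..1}) (\<lambda>(p, s). g (?q p s) * ?c s)"
    if g: "continuous_on U g" for g
  proof -
    have "continuous_on (V \<times> {0..1}) (\<lambda>z. ?q (fst z) (snd z))" by (intro continuous_intros)
    then have "continuous_on (V \<times> {0..1}) (\<lambda>z. g (?q (fst z) (snd z)))"
      by (rule continuous_on_compose2[OF g]) (use q in \<open>simp add: image_subset_iff mem_Times_iff\<close>)
    moreover have "continuous_on (V \<times> {0..1}) (\<lambda>z. ?c (snd z))"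
      using V by (intro continuous_intros) auto
    ultimately show ?thesis unfolding case_prod_unfold by (rule continuous_on_mult)
  qed
  have "((\<lambda>p. integral {0..1} (\<lambda>s. f (?q p s) * ?c s)) has_derivative
    (\<lambda>v. integral {0..1} (\<lambda>s. Dx f (?q p0 s) * ?c s) * fst v +
         integral {0..1} (\<lambda>s. Dy f (?q p0 s) * ?c s) * snd v)) (at p0)"
  proof (rule has_derivative_integral_param[OF V(1,2)])
    fix p s assume p: "p \<in> V"
    have "((\<lambda>p. ?q p s) has_derivative (\<lambda>v. v)) (at p)" by (auto intro!: derivative_eq_intros)
    from has_derivative_mult_left[OF has_derivative_compose[OF this holo2_has_derivative[OF f(1) q[OF p]]], of "?c s"]
    show "((\<lambda>p. f (?q p s) * ?c s) has_derivative
      (\<lambda>v. Dx f (?q p s) * ?c s * fst v + Dy f (?q p s) * ?c s * snd v)) (at p)"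
      by (simp add: algebra_simps)
  next
    show "continuous_on (V \<times> {0..1}) (\<lambda>(p, s). Dx f (?q p s) * ?c s)"
      by (rule cont[OF continuous_on_Dx[OF f(2,1)]])
    show "continuous_on (V \<times> {0..1}) (\<lambda>(p, s). Dy f (?q p s) * ?c s)"
      by (rule cont[OF continuous_on_Dy[OF f(2,1)]])
    show "continuous_on {0..1} (\<lambda>s. f (?q p s) * ?c s)" if "p \<in> V" for p
      using V q that
      by (intro continuous_intros continuous_on_compose2[OF holo2_continuous_on[OF f(1)]])
        (simp_all add: image_subset_iff)
  qed
  then show ?thesis
    by (rule has_derivative_transform_within_open[OF _ V(1,2)])
      (use Dx_Cauchy_integral[OF f(1) V(3) sub] in auto)
qed

lemma holo2_Dx:
  assumes U: "open U" and f: "holo2 f U"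
  shows "holo2 (Dx f) U"
proof -
  have "\<exists>a b. (Dx f has_derivative (\<lambda>v. a * fst v + b * snd v)) (at p)" if p: "p \<in> U" for p
    by (rule room_for_circles[OF U p]) (blast intro: Dx_has_derivative_integrals[OF f U])
  then show ?thesis by (simp add: holo2_def case_prod_unfold)
qed

lemma holo2_Dy:
  assumes U: "open U" and f: "holo2 f U"
  shows "holo2 (Dy f) U"
  using holo2_swap2[OF holo2_Dx[OF open_swap2[OF U] holo2_swap2[OF f]]]
  by (simp add: Dy_swap2[abs_def] vimage_def)

lemma mixed_partials:
  assumes U: "open U" and f: "holo2 f U" and p: "p \<in> U"
  shows "Dy (Dx f) p = Dx (Dy f) p"
proof -
  obtain V \<rho> where V: "open V" "p \<in> V" "V \<subseteq> U" "\<rho> > 0"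
    and sub: "\<And>p z. p \<in> V \<Longrightarrow> cmod z \<le> \<rho> \<Longrightarrow> p + (z, 0) \<in> U"
    by (rule room_for_circles[OF U p]) blast
  show ?thesis
    using partials_unique(2)[OF Dx_has_derivative_integrals[OF f U V(1,2,4) sub]]
      Dx_Cauchy_integral[OF holo2_Dy[OF U f] V(4) sub[OF V(2)]] by simp
qed

lemma holo2_local:
  assumes "\<And>p. p \<in> U \<Longrightarrow> \<exists>V. open V \<and> p \<in> V \<and> holo2 f V"
  shows "holo2 f U"
  using assms unfolding holo2_def by blast

text \<open>
  Division of a form \<open>P dx + Q dy\<close> by a form \<open>A dx + B dy\<close> without zeros: \<open>P / A\<close> and \<open>Q / B\<close> agree where
  both are defined, and one of them always is. Applied with \<open>A dx + B dy = dF\<close>.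
\<close>

lemma proportional_forms:
  assumes U: "open U" and PQ: "holo2 P U" "holo2 Q U" and AB: "holo2 A U" "holo2 B U"
    and nz: "\<And>p. p \<in> U \<Longrightarrow> A p \<noteq> 0 \<or> B p \<noteq> 0"
    and pr: "\<And>p. p \<in> U \<Longrightarrow> P p * B p = Q p * A p"
  obtains g where "holo2 g U" "\<And>p. p \<in> U \<Longrightarrow> P p = g p * A p" "\<And>p. p \<in> U \<Longrightarrow> Q p = g p * B p"
proof -
  define g where "g p = (if A p \<noteq> 0 then P p / A p else Q p / B p)" for p
  have gA: "g p = P p / A p" if "p \<in> U" "A p \<noteq> 0" for p using that by (simp add: g_def)
  have gB: "g p = Q p / B p" if "p \<in> U" "B p \<noteq> 0" for p
    using pr[OF that(1)] that by (simp add: g_def field_simps)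
  have oA: "open {p \<in> U. A p \<noteq> 0}" and oB: "open {p \<in> U. B p \<noteq> 0}"
    using continuous_open_preimage[OF holo2_continuous_on[OF AB(1)] U, of "-{0}"]
      continuous_open_preimage[OF holo2_continuous_on[OF AB(2)] U, of "-{0}"]
    by (simp_all add: vimage_def Int_def open_Compl)
  have hA: "holo2 g {p \<in> U. A p \<noteq> 0}"
    by (rule holo2_cong[OF oA, where f="\<lambda>p. P p / A p"])
      (auto simp: gA intro!: holo2_divide holo2_subset[OF PQ(1)] holo2_subset[OF AB(1)])
  have hB: "holo2 g {p \<in> U. B p \<noteq> 0}"
    by (rule holo2_cong[OF oB, where f="\<lambda>p. Q p / B p"])
      (auto simp: gB intro!: holo2_divide holo2_subset[OF PQ(2)] holo2_subset[OF AB(2)])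
  have "holo2 g U"
  proof (rule holo2_local)
    fix p assume p: "p \<in> U"
    from nz[OF p] show "\<exists>V. open V \<and> p \<in> V \<and> holo2 g V"
      using oA oB hA hB p by blast
  qed
  moreover have "P p = g p * A p \<and> Q p = g p * B p" if p: "p \<in> U" for p
  proof (cases "A p = 0")
    case True
    with nz[OF p] pr[OF p] show ?thesis by (simp add: gB[OF p])
  next
    case False
    with pr[OF p] show ?thesis by (simp add: gA[OF p] field_simps)
  qed
  ultimately show thesis using that by blast
qed

lemma holo2_compose:
  assumes f: "holo2 f U" and a: "holo2 a V" and b: "holo2 b V"
    and sub: "\<And>q. q \<in> V \<Longrightarrow> (a q, b q) \<in> U"
  shows "holo2 (\<lambda>q. f (a q, b q)) V"
proof (rule holo2I)
  fix q assume q: "q \<in> V"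
  have "((\<lambda>q. (a q, b q)) has_derivative (\<lambda>v. (Dx a q * fst v + Dy a q * snd v, Dx b q * fst v + Dy b q * snd v))) (at q)"
    by (intro has_derivative_Pair holo2_has_derivative[OF a q] holo2_has_derivative[OF b q])
  from has_derivative_compose[OF this holo2_has_derivative[OF f sub[OF q]]]
  show "((\<lambda>q. f (a q, b q)) has_derivative (\<lambda>v.
     (Dx f (a q, b q) * Dx a q + Dy f (a q, b q) * Dx b q) * fst v +
     (Dx f (a q, b q) * Dy a q + Dy f (a q, b q) * Dy b q) * snd v)) (at q)"
    by (simp add: algebra_simps)
qed

lemma open_contains_ball_Times:
  fixes a b :: complex
  assumes "open V" "(a, b) \<in> V"
  obtains e where "e > 0" "ball a e \<times> ball b e \<subseteq> V"
proof -
  obtain A B where AB: "open A" "open B" "a \<in> A" "b \<in> B" "A \<times> B \<subseteq> V"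
    using open_prod_elim[OF assms] by (metis mem_Times_iff fst_conv snd_conv)
  obtain e1 where e1: "e1 > 0" "ball a e1 \<subseteq> A" using AB open_contains_ball by blast
  obtain e2 where e2: "e2 > 0" "ball b e2 \<subseteq> B" using AB open_contains_ball by blast
  show thesis
    by (rule that[of "min e1 e2"]) (use e1 e2 AB(5) in \<open>auto simp: subset_iff\<close>)
qed


section \<open>Primitives along the fibres, locally\<close>

text \<open>
  The primitive is \<open>r(u, t) = (u - u\<^sub>0) \<integral>\<^sub>0\<^sup>1 h(u\<^sub>0 + s (u - u\<^sub>0), t) ds\<close>. It is holomorphic in both variables by
  differentiation under the integral, and \<open>\<partial>r/\<partial>u = h\<close> because the integrand of the derivative is
  \<open>d/ds (s h(u\<^sub>0 + s (u - u\<^sub>0), t))\<close>.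
\<close>

lemma partial_primitive:
  assumes V: "open V" "(u0, t0) \<in> V" and h: "holo2 h V"
  obtains e r where "e > 0" "ball u0 e \<times> ball t0 e \<subseteq> V" "holo2 r (ball u0 e \<times> ball t0 e)"
    "\<And>q. q \<in> ball u0 e \<times> ball t0 e \<Longrightarrow> Dx r q = h q"
proof -
  obtain e where e: "e > 0" "ball u0 e \<times> ball t0 e \<subseteq> V"
    by (rule open_contains_ball_Times[OF V])
  let ?W = "ball u0 e \<times> ball t0 e"
  let ?q = "\<lambda>p s. (u0 + of_real s * (fst p - u0), snd p)"
  have q: "?q p s \<in> ?W" if "p \<in> ?W" "s \<in> {0..1}" for p s
  proof -
    have "norm (of_real s * (fst p - u0)) \<le> 1 * norm (fst p - u0)"
      unfolding norm_mult by (rule mult_right_mono) (use that in auto)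
    then show ?thesis using that by (auto simp: dist_norm norm_minus_commute)
  qed
  define r where "r p = integral {0..1} (\<lambda>s. h (?q p s) * (fst p - u0))" for p
  have hW: "holo2 h ?W" and oW: "open ?W" using h e by (auto intro: holo2_subset open_Times)
  have cq: "continuous_on (?W \<times> {0..1}) (\<lambda>z. ?q (fst z) (snd z))" by (intro continuous_intros)
  have cont: "continuous_on (?W \<times> {0..1}) (\<lambda>z. f (?q (fst z) (snd z)))" if "continuous_on ?W f" for f
    by (rule continuous_on_compose2[OF that cq]) (use q in \<open>simp add: image_subset_iff mem_Times_iff\<close>)
  have dr: "(r has_derivative (\<lambda>v.
      integral {0..1} (\<lambda>s. Dx h (?q p s) * (of_real s * (fst p - u0)) + h (?q p s)) * fst v +
      integral {0..1} (\<lambda>s. Dy h (?q p s) * (fst p - u0)) * snd v)) (at p)" if p: "p \<in> ?W" for p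
    unfolding r_def
  proof (rule has_derivative_integral_param[OF oW p])
    fix p s assume p: "p \<in> ?W" and s: "s \<in> {0..1::real}"
    have "((\<lambda>p. ?q p s) has_derivative (\<lambda>v. (of_real s * fst v, snd v))) (at p)"
      by (auto intro!: derivative_eq_intros)
    from has_derivative_compose[OF this holo2_has_derivative[OF hW q[OF p s]]]
    have "((\<lambda>p. h (?q p s)) has_derivative
       (\<lambda>v. Dx h (?q p s) * (of_real s * fst v) + Dy h (?q p s) * snd v)) (at p)" by simp
    moreover have "((\<lambda>p. fst p - u0) has_derivative fst) (at p)"
      by (auto intro!: derivative_eq_intros)
    ultimately have "((\<lambda>p. h (?q p s) * (fst p - u0)) has_derivative
      (\<lambda>v. h (?q p s) * fst v + (Dx h (?q p s) * (of_real s * fst v) + Dy h (?q p s) * snd v) * (fst p - u0))) (at p)"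
      by (rule has_derivative_mult)
    then show "((\<lambda>p. h (?q p s) * (fst p - u0)) has_derivative
      (\<lambda>v. (Dx h (?q p s) * (of_real s * (fst p - u0)) + h (?q p s)) * fst v +
           Dy h (?q p s) * (fst p - u0) * snd v)) (at p)"
      by (simp add: algebra_simps)
  next
    show "continuous_on (?W \<times> {0..1})
       (\<lambda>(p, s). Dx h (?q p s) * (of_real s * (fst p - u0)) + h (?q p s))"
      unfolding case_prod_unfold
      by (intro continuous_on_add continuous_on_mult cont continuous_on_Dx[OF oW hW]
          holo2_continuous_on[OF hW]) (intro continuous_intros)+
    show "continuous_on (?W \<times> {0..1}) (\<lambda>(p, s). Dy h (?q p s) * (fst p - u0))"
      unfolding case_prod_unfold
      by (intro continuous_on_mult cont continuous_on_Dy[OF oW hW]) (intro continuous_intros)+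
    show "continuous_on {0..1} (\<lambda>s. h (?q p s) * (fst p - u0))" if "p \<in> ?W" for p
      by (rule continuous_on_mult[OF continuous_on_compose2[OF holo2_continuous_on[OF hW]]])
        (use q that in \<open>auto intro!: continuous_intros simp: image_subset_iff mem_Times_iff\<close>)
  qed
  have Dxr: "Dx r p = h p" if p: "p \<in> ?W" for p
  proof -
    have "((\<lambda>s. Dx h (?q p s) * (of_real s * (fst p - u0)) + h (?q p s)) has_integral
        of_real 1 * h (?q p 1) - of_real 0 * h (?q p 0)) {0..1}"
    proof (rule fundamental_theorem_of_calculus)
      fix s :: real assume s: "s \<in> {0..1}"
      have "((\<lambda>s. ?q p s) has_derivative (\<lambda>v. (of_real v * (fst p - u0), 0))) (at s within {0..1})"
        by (auto intro!: derivative_eq_intros)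
      from has_derivative_compose[OF this holo2_has_derivative[OF hW q[OF p s]]]
      have 1: "((\<lambda>s. h (?q p s)) has_vector_derivative Dx h (?q p s) * (fst p - u0)) (at s within {0..1})"
        by (simp add: has_vector_derivative_def scaleR_conv_of_real algebra_simps)
      have 2: "((\<lambda>s. of_real s :: complex) has_vector_derivative 1) (at s within {0..1})"
        by (auto intro!: derivative_eq_intros simp: has_vector_derivative_def scaleR_conv_of_real)
      show "((\<lambda>s. of_real s * h (?q p s)) has_vector_derivative
          (Dx h (?q p s) * (of_real s * (fst p - u0)) + h (?q p s))) (at s within {0..1})"
        using has_vector_derivative_mult[OF 2 1] by (simp add: algebra_simps)
    qed simp
    then show ?thesis using partials_unique(1)[OF dr[OF p]] by (simp add: integral_unique)
  qed
  show thesis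
    by (rule that[OF e holo2I[OF dr] Dxr])
qed

text \<open>
  A holomorphic chart in which \<open>F\<close> is the second coordinate. Taking
  \<open>(c\<^sub>1, c\<^sub>2) = (cnj F\<^sub>y, - cnj F\<^sub>x)\<close> at \<open>q\<^sub>0\<close> for the first coordinate \<open>c\<^sub>1 x + c\<^sub>2 y\<close> makes the Jacobian
  determinant at \<open>q\<^sub>0\<close> equal to \<open>|F\<^sub>x|\<^sup>2 + |F\<^sub>y|\<^sup>2\<close>, so that the cases \<open>F\<^sub>x \<noteq> 0\<close> and \<open>F\<^sub>y \<noteq> 0\<close> need not be
  distinguished. The inverse is holomorphic because the inverse matrix \<open>L\<close> is complex.
\<close>

lemma straighten_fibres:
  assumes U: "open U" and F: "holo2 F U" and q0: "q0 \<in> U" and nz: "Dx F q0 \<noteq> 0 \<or> Dy F q0 \<noteq> 0"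
  obtains c1 c2 U' V K where "open U'" "U' \<subseteq> U" "q0 \<in> U'" "open V"
    "\<And>p. p \<in> U' \<Longrightarrow> (c1 * fst p + c2 * snd p, F p) \<in> V \<and> K (c1 * fst p + c2 * snd p, F p) = p"
    "\<And>y. y \<in> V \<Longrightarrow> K y \<in> U'" "holo2 (\<lambda>y. fst (K y)) V" "holo2 (\<lambda>y. snd (K y)) V"
proof -
  define c1 c2 where "c1 = cnj (Dy F q0)" and "c2 = - cnj (Dx F q0)"
  define D where "D p = c1 * Dy F p - c2 * Dx F p" for p
  define H where "H p = (c1 * fst p + c2 * snd p, F p)" for p
  have D0: "D q0 \<noteq> 0"
  proof -
    have "D q0 = of_real ((cmod (Dy F q0))\<^sup>2 + (cmod (Dx F q0))\<^sup>2)"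
      by (simp add: D_def c1_def c2_def complex_norm_square mult.commute del: of_real_power)
    also have "\<dots> \<noteq> 0" using nz by (auto simp: add_nonneg_eq_0_iff simp del: of_real_add)
    finally show ?thesis .
  qed
  define U1 where "U1 = {p \<in> U. D p \<noteq> 0}"
  have contD: "continuous_on U D" unfolding D_def
    by (intro continuous_intros continuous_on_Dx[OF U F] continuous_on_Dy[OF U F])
  have U1: "open U1" "q0 \<in> U1" "U1 \<subseteq> U"
    using continuous_open_preimage[OF contD U, of "-{0}"] q0 D0
    by (auto simp: U1_def vimage_def Int_def open_Compl)
  define H' :: "pt \<Rightarrow> pt \<Rightarrow>\<^sub>L pt" where
    "H' p = (Blinfun (\<lambda>z. (z, 0)) o\<^sub>L lin2 c1 c2) + (Blinfun (\<lambda>z. (0, z)) o\<^sub>L lin2 (Dx F p) (Dy F p))" for p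
  have bl: "bounded_linear (\<lambda>z::complex. (z, 0::complex))" "bounded_linear (\<lambda>z::complex. (0::complex, z))"
    by (intro bounded_linear_Pair bounded_linear_ident bounded_linear_zero)+
  have H'_apply: "blinfun_apply (H' p) v = (c1 * fst v + c2 * snd v, Dx F p * fst v + Dy F p * snd v)" for p v
    by (simp add: H'_def blinfun.add_left bounded_linear_Blinfun_apply[OF bl(1)] bounded_linear_Blinfun_apply[OF bl(2)])
  have dH: "(H has_derivative blinfun_apply (H' p)) (at p)" if "p \<in> U1" for p
    unfolding H_def H'_apply[abs_def]
    using that U1 by (intro has_derivative_Pair holo2_has_derivative[OF F]) (auto intro!: derivative_eq_intros)
  have contH': "continuous_on U1 H'" unfolding H'_def
    using U1 by (intro continuous_intros continuous_on_subset[OF continuous_on_Dx[OF U F]]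
      continuous_on_subset[OF continuous_on_Dy[OF U F]]) auto
  define L where "L p w = ((Dy F p * fst w - c2 * snd w) / D p, (c1 * snd w - Dx F p * fst w) / D p)" for p w
  have L: "blinfun_apply (H' p) (L p w) = w" "L p (blinfun_apply (H' p) w) = w" if "p \<in> U1" for p w
  proof -
    have D: "D p \<noteq> 0" using that by (simp add: U1_def)
    show "blinfun_apply (H' p) (L p w) = w"
    proof -
      have "c1 * ((Dy F p * fst w - c2 * snd w) / D p) + c2 * ((c1 * snd w - Dx F p * fst w) / D p)
        = fst w * D p / D p" unfolding D_def by (simp add: add_divide_distrib[symmetric] algebra_simps)
      moreover have "Dx F p * ((Dy F p * fst w - c2 * snd w) / D p) + Dy F p * ((c1 * snd w - Dx F p * fst w) / D p)
        = snd w * D p / D p" unfolding D_def by (simp add: add_divide_distrib[symmetric] algebra_simps)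
      ultimately show ?thesis using D by (simp add: H'_apply L_def prod_eq_iff)
    qed
    show "L p (blinfun_apply (H' p) w) = w"
    proof -
      have "Dy F p * (c1 * fst w + c2 * snd w) - c2 * (Dx F p * fst w + Dy F p * snd w) = fst w * D p"
       "c1 * (Dx F p * fst w + Dy F p * snd w) - Dx F p * (c1 * fst w + c2 * snd w) = snd w * D p"
        unfolding D_def by (simp_all add: algebra_simps)
      then show ?thesis using D by (simp add: H'_apply L_def)
    qed
  qed
  have bL: "bounded_linear (L q0)"
  proof -
    have "L q0 = (\<lambda>w. (Dy F q0 / D q0 * fst w + (- c2 / D q0) * snd w, (- Dx F q0 / D q0) * fst w + c1 / D q0 * snd w))"
      by (simp add: L_def fun_eq_iff diff_divide_distrib add_divide_distrib)
    then show ?thesis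
      by (simp only:) (intro bounded_linear_Pair bounded_linear_add bounded_linear_mult_right[THEN bounded_linear_compose]
      bounded_linear_fst bounded_linear_snd)
  qed
  have inv: "Blinfun (L q0) o\<^sub>L H' q0 = id_blinfun"
    using L(2)[OF U1(2)] by (intro blinfun_eqI) (simp add: bounded_linear_Blinfun_apply[OF bL])
  obtain U' V K K' where UV: "open U'" "U' \<subseteq> U1" "q0 \<in> U'" "open V" "H q0 \<in> V" "homeomorphism U' V H K"
    and K: "\<And>y. y \<in> V \<Longrightarrow> (K has_derivative K' y) (at y)"
    "\<And>y. y \<in> V \<Longrightarrow> K' y = inv (blinfun_apply (H' (K y)))"
    "\<And>y. y \<in> V \<Longrightarrow> bij (blinfun_apply (H' (K y)))"
    by (rule inverse_function_theorem[OF U1(1) dH contH' U1(2) inv], assumption, rule that)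
  have KU: "K y \<in> U'" if "y \<in> V" for y using UV(6) that by (auto simp: homeomorphism_def)
  have HV: "H p \<in> V" "K (H p) = p" if "p \<in> U'" for p using UV(6) that by (auto simp: homeomorphism_def)
  have K': "(K has_derivative L (K y)) (at y)" if "y \<in> V" for y
  proof -
    have "K y \<in> U1" using KU[OF that] UV(2) by blast
    then have "inv (blinfun_apply (H' (K y))) = L (K y)"
      by (intro ext inv_f_eq bij_is_inj K(3)[OF that] L(1))
    then show ?thesis using K(1,2)[OF that] by simp
  qed
  have holK: "holo2 (\<lambda>y. fst (K y)) V" "holo2 (\<lambda>y. snd (K y)) V"
  proof -
    show "holo2 (\<lambda>y. fst (K y)) V"
    proof (rule holo2I)
      fix y assume "y \<in> V"
      from has_derivative_fst[OF K'[OF this]]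
      show "((\<lambda>y. fst (K y)) has_derivative (\<lambda>w. (Dy F (K y) / D (K y)) * fst w + (- c2 / D (K y)) * snd w)) (at y)"
        by (simp add: L_def diff_divide_distrib)
    qed
    show "holo2 (\<lambda>y. snd (K y)) V"
    proof (rule holo2I)
      fix y assume "y \<in> V"
      from has_derivative_snd[OF K'[OF this]]
      show "((\<lambda>y. snd (K y)) has_derivative (\<lambda>w. (- Dx F (K y) / D (K y)) * fst w + (c1 / D (K y)) * snd w)) (at y)"
        by (simp add: L_def diff_divide_distrib add.commute)
    qed
  qed
  show thesis
    by (rule that[of U' V c1 c2 K]) (use UV U1 HV KU holK in \<open>auto simp: H_def\<close>)
qed

text \<open>
  In a straightening chart \<open>(u, t)\<close> with \<open>t = F\<close>, a form is \<open>h du + b dt\<close>. A function \<open>r\<close> with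
  \<open>\<partial>r/\<partial>u = h\<close> differs from it by a multiple of \<open>dF\<close>.
\<close>

lemma local_fibre_primitive:
  assumes U: "open U" and F: "holo2 F U" and \<eta>: "holo_form \<eta> U"
    and q0: "q0 \<in> U" and nz: "Dx F q0 \<noteq> 0 \<or> Dy F q0 \<noteq> 0"
  obtains W r where "open W" "q0 \<in> W" "W \<subseteq> U"
    "\<And>p. p \<in> W \<Longrightarrow> \<exists>l. (r has_derivative (\<lambda>v. pairing \<eta> p v - l * pairing (dform F) p v)) (at p)"
proof -
  obtain c1 c2 U' V K where UV: "open U'" "U' \<subseteq> U" "q0 \<in> U'" "open V"
    and HK: "\<And>p. p \<in> U' \<Longrightarrow> (c1 * fst p + c2 * snd p, F p) \<in> V \<and> K (c1 * fst p + c2 * snd p, F p) = p"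
    and K: "\<And>y. y \<in> V \<Longrightarrow> K y \<in> U'" and hK: "holo2 (\<lambda>y. fst (K y)) V" "holo2 (\<lambda>y. snd (K y)) V"
    by (rule straighten_fibres[OF U F q0 nz]) blast
  define H where "H p = (c1 * fst p + c2 * snd p, F p)" for p
  define a b where "a y = fst (K y)" and "b y = snd (K y)" for y
  have ab: "holo2 a V" "holo2 b V" using hK by (simp_all add: a_def[abs_def] b_def[abs_def])
  define h where "h y = fst (\<eta> (a y, b y)) * Dx a y + snd (\<eta> (a y, b y)) * Dx b y" for y
  have hV: "holo2 h V" unfolding h_def
    using \<eta> K UV(2) unfolding holo_form_def
    by (intro holo2_add holo2_mult holo2_Dx[OF UV(4)] ab holo2_compose[where f="\<lambda>p. fst (\<eta> p)" and U=U]
       holo2_compose[where f="\<lambda>p. snd (\<eta> p)" and U=U]) (auto simp: a_def b_def)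
  have HV: "(fst (H q0), snd (H q0)) \<in> V" using HK UV by (simp add: H_def)
  obtain e r where e: "e > 0" "ball (fst (H q0)) e \<times> ball (snd (H q0)) e \<subseteq> V"
    and r: "holo2 r (ball (fst (H q0)) e \<times> ball (snd (H q0)) e)"
    and Dr: "\<And>q. q \<in> ball (fst (H q0)) e \<times> ball (snd (H q0)) e \<Longrightarrow> Dx r q = h q"
    by (rule partial_primitive[OF UV(4) HV hV]) blast
  let ?W = "ball (fst (H q0)) e \<times> ball (snd (H q0)) e"
  have dH: "(H has_derivative (\<lambda>v. (c1 * fst v + c2 * snd v, pairing (dform F) p v))) (at p)" if "p \<in> U" for p
    unfolding H_def[abs_def] using that
    by (intro has_derivative_Pair holo2_has_derivative_pairing[OF F]) (auto intro!: derivative_eq_intros)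
  have contH: "continuous_on U' H"
    using dH UV(2) has_derivative_continuous by (meson continuous_at_imp_continuous_on subsetD)
  show thesis
  proof (rule that[of "U' \<inter> H -` ?W" "\<lambda>p. r (H p)"])
    show "open (U' \<inter> H -` ?W)" by (rule continuous_open_preimage[OF contH UV(1)]) (intro open_Times open_ball)
    show "q0 \<in> U' \<inter> H -` ?W" using UV e by (simp add: mem_Times_iff)
    show "U' \<inter> H -` ?W \<subseteq> U" using UV by auto
    fix p assume p: "p \<in> U' \<inter> H -` ?W"
    then have pU: "p \<in> U" "p \<in> U'" "H p \<in> ?W" "H p \<in> V" using UV e by auto
    have Kp: "K (H p) = p" using HK pU by (simp add: H_def)
    let ?l = "\<lambda>v::pt. c1 * fst v + c2 * snd v" and ?d = "pairing (dform F) p"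
    have 1: "((\<lambda>p. r (H p)) has_derivative (\<lambda>v. h (H p) * ?l v + Dy r (H p) * ?d v)) (at p)"
      using has_derivative_compose[OF dH[OF pU(1)] holo2_has_derivative[OF r pU(3)]] Dr[OF pU(3)] by simp
    have id: "v = (Dx a (H p) * ?l v + Dy a (H p) * ?d v, Dx b (H p) * ?l v + Dy b (H p) * ?d v)" for v
    proof -
      have "((\<lambda>p. (a (H p), b (H p))) has_derivative
        (\<lambda>v. (Dx a (H p) * ?l v + Dy a (H p) * ?d v, Dx b (H p) * ?l v + Dy b (H p) * ?d v))) (at p)"
        using has_derivative_compose[OF dH[OF pU(1)] holo2_has_derivative[OF ab(1) pU(4)]]
          has_derivative_compose[OF dH[OF pU(1)] holo2_has_derivative[OF ab(2) pU(4)]]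
        by (intro has_derivative_Pair) simp_all
      then have "((\<lambda>p. p) has_derivative
        (\<lambda>v. (Dx a (H p) * ?l v + Dy a (H p) * ?d v, Dx b (H p) * ?l v + Dy b (H p) * ?d v))) (at p)"
        by (rule has_derivative_transform_within_open[OF _ UV(1) pU(2)])
          (use HK in \<open>simp add: H_def a_def b_def\<close>)
      from has_derivative_unique[OF has_derivative_ident this] show ?thesis by (rule fun_cong)
    qed
    have 2: "pairing \<eta> p v = h (H p) * ?l v + (fst (\<eta> p) * Dy a (H p) + snd (\<eta> p) * Dy b (H p)) * ?d v" for v
    proof -
      have "pairing \<eta> p v = fst (\<eta> p) * (Dx a (H p) * ?l v + Dy a (H p) * ?d v) +
         snd (\<eta> p) * (Dx b (H p) * ?l v + Dy b (H p) * ?d v)"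
        unfolding pairing_def[of \<eta>] using id[of v] by (metis fst_conv snd_conv)
      moreover have "(a (H p), b (H p)) = p" using Kp by (simp add: a_def b_def)
      ultimately show ?thesis by (simp add: h_def algebra_simps)
    qed
    show "\<exists>l. ((\<lambda>p. r (H p)) has_derivative (\<lambda>v. pairing \<eta> p v - l * ?d v)) (at p)"
    proof
      have "(\<lambda>v. h (H p) * ?l v + Dy r (H p) * ?d v) = (\<lambda>v. pairing \<eta> p v -
         (fst (\<eta> p) * Dy a (H p) + snd (\<eta> p) * Dy b (H p) - Dy r (H p)) * ?d v)"
        unfolding 2 by (simp add: algebra_simps)
      with 1 show "((\<lambda>p. r (H p)) has_derivative (\<lambda>v. pairing \<eta> p v -
         (fst (\<eta> p) * Dy a (H p) + snd (\<eta> p) * Dy b (H p) - Dy r (H p)) * ?d v)) (at p)" by simp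
    qed
  qed
qed


section \<open>Primitives along the fibres of the tube\<close>

lemma convex_has_derivative_zero:
  fixes f :: "complex \<Rightarrow> complex"
  assumes "convex S" "open S" "\<And>w. w \<in> S \<Longrightarrow> (f has_derivative (\<lambda>_. 0)) (at w)" "w \<in> S" "w' \<in> S"
  shows "f w = f w'"
  using has_derivative_zero_unique_connected[OF assms(2) convex_connected[OF assms(1)] assms(3-5)] by blast

text \<open>
  \<open>T\<close> is the base \<open>F(\<Sigma>)\<close>, and \<open>\<Psi>\<close> is the inverse of the trivialisation \<open>\<Phi>\<close>.
\<close>

locale tube =
  fixes U :: "pt set" and F :: "pt \<Rightarrow> complex" and T :: "complex set"
    and \<Phi> \<Psi> :: "pt \<Rightarrow> pt" and \<Phi>' \<Psi>' :: "pt \<Rightarrow> pt \<Rightarrow>\<^sub>L pt"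
  assumes open_U: "open U" and F: "holo2 F U" and open_T: "open T" and conn_T: "simply_connected T"
    and d\<Phi>: "\<And>q. q \<in> annulus \<times> T \<Longrightarrow> (\<Phi> has_derivative blinfun_apply (\<Phi>' q)) (at q)"
    and d\<Psi>: "\<And>p. p \<in> U \<Longrightarrow> (\<Psi> has_derivative blinfun_apply (\<Psi>' p)) (at p)"
    and \<Phi>: "\<And>q. q \<in> annulus \<times> T \<Longrightarrow> \<Phi> q \<in> U \<and> \<Psi> (\<Phi> q) = q \<and> F (\<Phi> q) = snd q"
    and \<Psi>: "\<And>p. p \<in> U \<Longrightarrow> \<Psi> p \<in> annulus \<times> T \<and> \<Phi> (\<Psi> p) = p"
    and section_holo: "(\<lambda>t. fst (\<Phi> (1, t))) holomorphic_on T" "(\<lambda>t. snd (\<Phi> (1, t))) holomorphic_on T"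
begin

lemma open_annulus: "open annulus"
  unfolding annulus_def by (intro open_Collect_conj open_Collect_less continuous_intros)

lemma snd_\<Psi>: "p \<in> U \<Longrightarrow> snd (\<Psi> p) = F p"
  using \<Phi> \<Psi> by metis

lemma dF_nonzero: "p \<in> U \<Longrightarrow> Dx F p \<noteq> 0 \<or> Dy F p \<noteq> 0"
proof (rule ccontr)
  assume p: "p \<in> U" and z: "\<not> (Dx F p \<noteq> 0 \<or> Dy F p \<noteq> 0)"
  have q: "\<Psi> p \<in> annulus \<times> T" and pq: "\<Phi> (\<Psi> p) = p" using \<Psi>[OF p] by auto
  have oq: "open (annulus \<times> T)" by (intro open_Times open_annulus open_T)
  have "((\<lambda>q. F (\<Phi> q)) has_derivative (\<lambda>v. 0)) (at (\<Psi> p))"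
    using has_derivative_compose[OF d\<Phi>[OF q], of F "\<lambda>v. 0"] holo2_has_derivative[OF F p] z pq by simp
  then have "(snd has_derivative (\<lambda>v. 0)) (at (\<Psi> p))"
    by (rule has_derivative_transform_within_open[OF _ oq q]) (use \<Phi> in auto)
  from has_derivative_unique[OF this has_derivative_snd[OF has_derivative_ident]]
  have "(0::complex) = snd (0::complex, 1::complex)" by (rule fun_cong)
  then show False by simp
qed

text \<open>
  The exponential map makes the strip the universal cover of the annulus. In the coordinates
  \<open>(w, t)\<close> on strip \<open>\<times> T\<close> the tube is covered by \<open>E\<close>, with real derivative \<open>E'\<close>, the cycle
  \<open>\<gamma>(t)\<close> is the image of the segment from \<open>0\<close> to \<open>2\<pi>\<i>\<close>, and any two points of a fibre are joined by a segment.
\<close>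

definition strip :: "complex set" where "strip = {w. exp w \<in> annulus}"

definition E :: "pt \<Rightarrow> pt" where "E q = \<Phi> (exp (fst q), snd q)"

definition E' :: "pt \<Rightarrow> pt \<Rightarrow> pt" where
  "E' q v = blinfun_apply (\<Phi>' (exp (fst q), snd q)) (exp (fst q) * fst v, snd v)"

lemma strip_eq: "strip = {w. - ln 2 < Re w \<and> Re w < ln 2}"
proof -
  have "(1/2 < exp x) = (- ln 2 < x)" for x :: real
  proof -
    have "exp (- ln 2) = (1/2 :: real)" by (simp add: exp_minus)
    then show ?thesis by (metis exp_less_cancel_iff)
  qed
  moreover have "(exp x < 2) = (x < ln 2)" for x :: real
    by (metis exp_less_cancel_iff exp_ln zero_less_numeral)
  ultimately show ?thesis by (simp add: strip_def annulus_def)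
qed

lemma open_strip: "open strip"
  unfolding strip_eq by (intro open_Collect_conj open_Collect_less continuous_intros)

lemma convex_strip: "convex strip"
proof -
  have "strip = {w. Re w > - ln 2} \<inter> {w. Re w < ln 2}" by (auto simp: strip_eq)
  then show ?thesis by (metis convex_Int convex_halfspace_Re_gt convex_halfspace_Re_lt)
qed

lemma zero_strip: "0 \<in> strip" by (simp add: strip_eq)

lemma segment_strip: "w \<in> strip \<Longrightarrow> s \<in> {0..1} \<Longrightarrow> of_real s * w \<in> strip"
  using convexD[OF convex_strip zero_strip, of w "1-s" s] by (simp add: scaleR_conv_of_real)

lemma E_in: "q \<in> strip \<times> T \<Longrightarrow> E q \<in> U"
  and F_E: "q \<in> strip \<times> T \<Longrightarrow> F (E q) = snd q"
  using \<Phi>[of "(exp (fst q), snd q)"] by (auto simp: E_def strip_def)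

lemma E_has_derivative:
  assumes "q \<in> strip \<times> T"
  shows "(E has_derivative E' q) (at q)"
proof -
  have "(exp (fst q), snd q) \<in> annulus \<times> T" using assms by (auto simp: strip_def)
  note d = d\<Phi>[OF this]
  have "((\<lambda>q. exp (fst q)) has_derivative (\<lambda>v. exp (fst q) * fst v)) (at q)"
  proof -
    have "(exp has_derivative (\<lambda>h. exp (fst q) * h)) (at (fst q))"
      using DERIV_exp[of "fst q"] by (simp add: has_field_derivative_def)
    from has_derivative_compose[OF has_derivative_fst[OF has_derivative_ident] this]
    show ?thesis .
  qed
  then have "((\<lambda>q. (exp (fst q), snd q)) has_derivative (\<lambda>v. (exp (fst q) * fst v, snd v))) (at q)"
    by (intro has_derivative_Pair has_derivative_snd[OF has_derivative_ident])
  from has_derivative_compose[OF this d] show ?thesis by (simp add: E_def[abs_def] E'_def[abs_def])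
qed

lemma open_domain: "open (strip \<times> T)"
  by (intro open_Times open_strip open_T)

lemma dF_E': 
  assumes q: "q \<in> strip \<times> T"
  shows "pairing (dform F) (E q) (E' q v) = snd v"
proof -
  have "((\<lambda>q. F (E q)) has_derivative (\<lambda>v. pairing (dform F) (E q) (E' q v))) (at q)"
    by (rule has_derivative_compose[OF E_has_derivative[OF q] holo2_has_derivative_pairing[OF F E_in[OF q]]])
  then have "(snd has_derivative (\<lambda>v. pairing (dform F) (E q) (E' q v))) (at q)"
    by (rule has_derivative_transform_within_open[OF _ open_domain q]) (rule F_E)
  from has_derivative_unique[OF this has_derivative_snd[OF has_derivative_ident]]
  show ?thesis by (rule fun_cong)
qed

lemma linear_E': "q \<in> strip \<times> T \<Longrightarrow> bounded_linear (E' q)"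
  by (rule has_derivative_bounded_linear[OF E_has_derivative])

lemma ray_has_vector_derivative:
  assumes q: "(of_real s * w, t) \<in> strip \<times> T"
  shows "((\<lambda>s. E (of_real s * w, t)) has_vector_derivative E' (of_real s * w, t) (w, 0)) (at s within S)"
proof -
  interpret E: bounded_linear "E' (of_real s * w, t)" by (rule linear_E'[OF q])
  have "((\<lambda>s. (of_real s * w, t)) has_derivative (\<lambda>h. h *\<^sub>R (w, 0))) (at s within S)"
    by (auto intro!: derivative_eq_intros simp: scaleR_conv_of_real)
  from has_derivative_compose[OF this E_has_derivative[OF q]] show ?thesis
    unfolding has_vector_derivative_def E.scaleR .
qed

text \<open>
  \<open>U\<close> is the image of strip \<open>\<times> T\<close>. Connectedness makes a function on \<open>U\<close> with vanishing differential constant.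
\<close>

lemma connected_U: "connected U"
proof -
  have contE: "continuous_on (strip \<times> T) E"
    using E_has_derivative has_derivative_continuous by (meson continuous_at_imp_continuous_on)
  have "U \<subseteq> E ` (strip \<times> T)"
  proof
    fix p assume p: "p \<in> U"
    let ?q = "(Ln (fst (\<Psi> p)), snd (\<Psi> p))"
    have "fst (\<Psi> p) \<noteq> 0" using \<Psi>[OF p] by (auto simp: annulus_def)
    then have "E ?q = p" "?q \<in> strip \<times> T" using \<Psi>[OF p] by (auto simp: E_def strip_def mem_Times_iff)
    then show "p \<in> E ` (strip \<times> T)" by force
  qed
  then have "U = E ` (strip \<times> T)" using E_in by auto
  moreover have "connected (strip \<times> T)"
    by (intro connected_Times convex_connected[OF convex_strip] simply_connected_imp_connected conn_T)
  ultimately show ?thesis using connected_continuous_image[OF contE] by simp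
qed

text \<open>
  \<open>\<rho>\<close> is a primitive of \<open>\<eta>\<close> along the fibres if \<open>d\<rho> = E\<^sup>*\<eta> - l dt\<close> with a \<^emph>\<open>complex\<close> number \<open>l\<close> at each point.
  Since \<open>dt = E\<^sup>*dF\<close>, this says at once that \<open>\<rho>\<close> integrates \<open>\<eta>\<close> on fibres and that
  \<open>\<rho>\<close> is locally holomorphic when viewed on \<open>U\<close>, even though \<open>E\<close> is only real \<open>C\<^sup>1\<close>.
\<close>

definition primitive :: "oneform \<Rightarrow> (pt \<Rightarrow> complex) \<Rightarrow> pt set \<Rightarrow> bool" where
  "primitive \<eta> \<rho> S \<longleftrightarrow>
     (\<forall>q\<in>S. \<exists>l. (\<rho> has_derivative (\<lambda>v. pairing \<eta> (E q) (E' q v) - l * snd v)) (at q))"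

lemma primitive_subset: "primitive \<eta> \<rho> S \<Longrightarrow> S' \<subseteq> S \<Longrightarrow> primitive \<eta> \<rho> S'"
  by (auto simp: primitive_def)

lemma primitive_cong:
  assumes "primitive \<eta> \<rho> S" "open S" "\<And>q. q \<in> S \<Longrightarrow> \<rho> q = \<rho>' q"
  shows "primitive \<eta> \<rho>' S"
  using assms has_derivative_transform_within_open[OF _ assms(2)] unfolding primitive_def by blast

lemma local_primitive:
  assumes \<eta>: "holo_form \<eta> U" and q: "(w0, t0) \<in> strip \<times> T"
  obtains e \<rho> where "e > 0" "ball w0 e \<times> ball t0 e \<subseteq> strip \<times> T" "primitive \<eta> \<rho> (ball w0 e \<times> ball t0 e)"
proof -
  obtain W r where W: "open W" "E (w0, t0) \<in> W" "W \<subseteq> U"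
    and r: "\<And>p. p \<in> W \<Longrightarrow> \<exists>l. (r has_derivative (\<lambda>v. pairing \<eta> p v - l * pairing (dform F) p v)) (at p)"
    by (rule local_fibre_primitive[OF open_U F \<eta> E_in[OF q] dF_nonzero[OF E_in[OF q]]]) blast
  have contE: "continuous_on (strip \<times> T) E"
    using E_has_derivative has_derivative_continuous by (meson continuous_at_imp_continuous_on)
  define O1 where "O1 = (strip \<times> T) \<inter> E -` W"
  have O1: "open O1" "(w0, t0) \<in> O1"
    using continuous_open_preimage[OF contE open_domain W(1)] q W by (auto simp: O1_def)
  obtain e where e: "e > 0" "ball w0 e \<times> ball t0 e \<subseteq> O1"
    by (rule open_contains_ball_Times[OF O1])
  have "primitive \<eta> (\<lambda>q. r (E q)) O1" unfolding primitive_def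
  proof
    fix q assume "q \<in> O1"
    then have q: "q \<in> strip \<times> T" "E q \<in> W" by (auto simp: O1_def)
    obtain l where "(r has_derivative (\<lambda>v. pairing \<eta> (E q) v - l * pairing (dform F) (E q) v)) (at (E q))"
      using r[OF q(2)] by blast
    from has_derivative_compose[OF E_has_derivative[OF q(1)] this]
    show "\<exists>l. ((\<lambda>q. r (E q)) has_derivative (\<lambda>v. pairing \<eta> (E q) (E' q v) - l * snd v)) (at q)"
      using dF_E'[OF q(1)] by auto
  qed
  then have "primitive \<eta> (\<lambda>q. r (E q)) (ball w0 e \<times> ball t0 e)" using e(2) by (rule primitive_subset)
  moreover have "ball w0 e \<times> ball t0 e \<subseteq> strip \<times> T" using e(2) by (auto simp: O1_def)
  ultimately show thesis using that e(1) by blast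
qed

lemma primitive_add_base:
  assumes "primitive \<eta> \<rho> (S \<times> D)" "\<And>t. t \<in> D \<Longrightarrow> \<exists>d. (\<delta> has_field_derivative d) (at t)"
  shows "primitive \<eta> (\<lambda>q. \<rho> q + \<delta> (snd q)) (S \<times> D)"
  unfolding primitive_def
proof
  fix q assume q: "q \<in> S \<times> D"
  obtain l where l: "(\<rho> has_derivative (\<lambda>v. pairing \<eta> (E q) (E' q v) - l * snd v)) (at q)"
    using assms(1) q by (auto simp: primitive_def)
  have "snd q \<in> D" using q by auto
  from assms(2)[OF this] obtain d where "(\<delta> has_field_derivative d) (at (snd q))" by blast
  then have "((\<lambda>q. \<delta> (snd q)) has_derivative (\<lambda>v. d * snd v)) (at q)"
    using has_derivative_compose[OF has_derivative_snd[OF has_derivative_ident]]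
    unfolding has_field_derivative_def by blast
  from has_derivative_add[OF l this]
  have "((\<lambda>q. \<rho> q + \<delta> (snd q)) has_derivative (\<lambda>v. pairing \<eta> (E q) (E' q v) - (l - d) * snd v)) (at q)"
    by (simp add: algebra_simps)
  then show "\<exists>l. ((\<lambda>q. \<rho> q + \<delta> (snd q)) has_derivative (\<lambda>v. pairing \<eta> (E q) (E' q v) - l * snd v)) (at q)" ..
qed

text \<open>
  The difference of two primitives has differential \<open>l dt\<close>. So it is constant on connected pieces of
  fibres, and as a function of \<open>t\<close> it has the complex derivative \<open>l\<close>. Holomorphy in the direction transversal to the
  fibres comes from here.
\<close>

lemma primitives_differ_by_base:
  assumes \<rho>: "primitive \<eta> \<rho>1 (S \<times> D)" "primitive \<eta> \<rho>2 (S \<times> D)" and S: "convex S" "open S" "w1 \<in> S"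
  shows "t \<in> D \<Longrightarrow> w \<in> S \<Longrightarrow> \<rho>1 (w, t) - \<rho>2 (w, t) = \<rho>1 (w1, t) - \<rho>2 (w1, t)"
    and "t \<in> D \<Longrightarrow> \<exists>d. ((\<lambda>t. \<rho>1 (w1, t) - \<rho>2 (w1, t)) has_field_derivative d) (at t)"
proof -
  have ex: "\<exists>d. ((\<lambda>q. \<rho>1 q - \<rho>2 q) has_derivative (\<lambda>v. d * snd v)) (at (w, t))" if "w \<in> S" "t \<in> D" for w t
  proof -
    have q: "(w, t) \<in> S \<times> D" using that by simp
    obtain l1 l2 where
      "(\<rho>1 has_derivative (\<lambda>v. pairing \<eta> (E (w, t)) (E' (w, t) v) - l1 * snd v)) (at (w, t))"
      "(\<rho>2 has_derivative (\<lambda>v. pairing \<eta> (E (w, t)) (E' (w, t) v) - l2 * snd v)) (at (w, t))"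
      using \<rho> q unfolding primitive_def by blast
    from has_derivative_diff[OF this]
    have "((\<lambda>q. \<rho>1 q - \<rho>2 q) has_derivative (\<lambda>v. (l2 - l1) * snd v)) (at (w, t))"
      by (simp add: algebra_simps)
    then show ?thesis ..
  qed
  show "\<rho>1 (w, t) - \<rho>2 (w, t) = \<rho>1 (w1, t) - \<rho>2 (w1, t)" if t: "t \<in> D" and w: "w \<in> S"
  proof (rule convex_has_derivative_zero[OF S(1,2) _ w S(3)])
    fix w assume "w \<in> S"
    then obtain d where d: "((\<lambda>q. \<rho>1 q - \<rho>2 q) has_derivative (\<lambda>v. d * snd v)) (at (w, t))" using ex t by blast
    have "((\<lambda>w. (w, t)) has_derivative (\<lambda>h. (h, 0))) (at w)" by (auto intro!: derivative_eq_intros)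
    from has_derivative_compose[OF this d]
    show "((\<lambda>w. \<rho>1 (w, t) - \<rho>2 (w, t)) has_derivative (\<lambda>_. 0)) (at w)" by simp
  qed
  show "\<exists>d. ((\<lambda>t. \<rho>1 (w1, t) - \<rho>2 (w1, t)) has_field_derivative d) (at t)" if t: "t \<in> D"
  proof -
    obtain d where d: "((\<lambda>q. \<rho>1 q - \<rho>2 q) has_derivative (\<lambda>v. d * snd v)) (at (w1, t))" using ex t S by blast
    have "((\<lambda>t. (w1, t)) has_derivative (\<lambda>h. (0, h))) (at t)" by (auto intro!: derivative_eq_intros)
    from has_derivative_compose[OF this d] show ?thesis
      by (intro exI[of _ d]) (simp add: has_field_derivative_def)
  qed
qed

text \<open>
  The \<open>e\<close>-neighbourhood of the part of the segment from \<open>0\<close> to \<open>w\<close> that has parameters in \<open>[a, b]\<close>. It is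
  convex, so that two of them meet in a connected set.
\<close>

definition thick :: "complex \<Rightarrow> real \<Rightarrow> real \<Rightarrow> real \<Rightarrow> complex set" where
  "thick w a b e = (\<Union>u\<in>{a..b}. ball (of_real u * w) e)"

lemma open_thick: "open (thick w a b e)"
  by (auto simp: thick_def)

lemma convex_thick: "convex (thick w a b e)"
proof -
  have "thick w a b e = (\<Union>x\<in>(\<lambda>u. u *\<^sub>R w) ` {a..b}. \<Union>y\<in>ball 0 e. {x + y})"
  proof -
    have ball: "ball x e = (\<Union>y\<in>ball 0 e. {x + y})" for x :: complex
    proof (intro equalityI subsetI)
      fix y assume "y \<in> ball x e"
      then have "y - x \<in> ball 0 e" "y = x + (y - x)" by (simp_all add: dist_norm norm_minus_commute)
      then show "y \<in> (\<Union>y\<in>ball 0 e. {x + y})" by blast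
    qed (auto simp: dist_norm)
    show ?thesis by (simp add: thick_def scaleR_conv_of_real ball[of "of_real u * w" for u])
  qed
  moreover have "convex ((\<lambda>u. u *\<^sub>R w) ` {a..b})"
    by (intro convex_linear_image linearI) (auto simp: algebra_simps)
  ultimately show ?thesis using convex_sums[OF _ convex_ball, of "(\<lambda>u. u *\<^sub>R w) ` {a..b}" 0 e] by simp
qed

lemma thick_mono: "e \<le> e' \<Longrightarrow> thick w a b e \<subseteq> thick w a b e'"
  by (force simp: thick_def)

lemma thick_Un: "a \<le> b \<Longrightarrow> b \<le> c \<Longrightarrow> thick w a c e = thick w a b e \<union> thick w b c e"
  unfolding thick_def using ivl_disj_un_two_touch(4)[of a b c] by (metis UN_Un)

text \<open>
  Bisection of the segment: primitives exist on short pieces, and on two adjacent pieces the second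
  primitive is changed by a holomorphic function of \<open>t\<close> to fit the first one. Only finitely many
  pieces occur, so a common neighbourhood of \<open>t\<close> remains.
\<close>

lemma primitive_thick_segment:
  assumes \<eta>: "holo_form \<eta> U" and w: "w \<in> strip" and t: "t \<in> T"
  shows "\<exists>e>0. \<exists>\<rho>. primitive \<eta> \<rho> (thick w 0 1 e \<times> ball t e)"
proof -
  define P where "P a b \<longleftrightarrow> (0 \<le> a \<longrightarrow> b \<le> 1 \<longrightarrow> (\<exists>e>0. \<exists>\<rho>. primitive \<eta> \<rho> (thick w a b e \<times> ball t e)))" for a b :: real
  have "P 0 1"
  proof (rule Bolzano[of 0 1 P])
    fix a b c assume trans: "P a b" "P b c" "a \<le> b" "b \<le> c"
    show "P a c" unfolding P_def
    proof (intro impI)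
      assume "0 \<le> a" "c \<le> 1"
      then obtain e1 \<rho>1 e2 \<rho>2 where e12: "e1 > 0" "e2 > 0"
        "primitive \<eta> \<rho>1 (thick w a b e1 \<times> ball t e1)" "primitive \<eta> \<rho>2 (thick w b c e2 \<times> ball t e2)"
        using trans unfolding P_def by fastforce
      define e where "e = min e1 e2"
      have e: "e > 0" "e \<le> e1" "e \<le> e2" using e12 by (auto simp: e_def)
      let ?S1 = "thick w a b e" and ?S2 = "thick w b c e" and ?D = "ball t e"
      have \<rho>1: "primitive \<eta> \<rho>1 (?S1 \<times> ?D)"
        by (rule primitive_subset[OF e12(3)]) (intro Sigma_mono thick_mono e subset_ball)
      have \<rho>2: "primitive \<eta> \<rho>2 (?S2 \<times> ?D)"
        by (rule primitive_subset[OF e12(4)]) (intro Sigma_mono thick_mono e subset_ball)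
      let ?b = "of_real b * w"
      \<comment> \<open>The correction that fits the two primitives together, measured at the common end point.\<close>
      define \<delta> where "\<delta> t = \<rho>1 (?b, t) - \<rho>2 (?b, t)" for t
      have b: "?b \<in> ?S1 \<inter> ?S2" using trans e by (auto simp: thick_def intro!: bexI[of _ b])
      have cS: "convex (?S1 \<inter> ?S2)" "open (?S1 \<inter> ?S2)"
        by (intro convex_Int open_Int convex_thick open_thick)+
      have \<rho>12: "primitive \<eta> \<rho>1 ((?S1 \<inter> ?S2) \<times> ?D)" "primitive \<eta> \<rho>2 ((?S1 \<inter> ?S2) \<times> ?D)"
        by (rule primitive_subset[OF \<rho>1] primitive_subset[OF \<rho>2]; blast)+
      note diff = primitives_differ_by_base[OF \<rho>12 cS b]
      have \<rho>3: "primitive \<eta> (\<lambda>q. \<rho>2 q + \<delta> (snd q)) (?S2 \<times> ?D)"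
        by (rule primitive_add_base[OF \<rho>2]) (use diff(2) in \<open>simp add: \<delta>_def[abs_def]\<close>)
      define \<rho> where "\<rho> q = (if fst q \<in> ?S1 then \<rho>1 q else \<rho>2 q + \<delta> (snd q))" for q
      have "primitive \<eta> \<rho> (?S1 \<times> ?D)"
        by (rule primitive_cong[OF \<rho>1]) (auto simp: \<rho>_def intro!: open_Times open_thick)
      moreover have "primitive \<eta> \<rho> (?S2 \<times> ?D)"
      proof (rule primitive_cong[OF \<rho>3])
        fix q assume "q \<in> ?S2 \<times> ?D"
        then show "\<rho>2 q + \<delta> (snd q) = \<rho> q"
          using diff(1)[of "snd q" "fst q"] by (auto simp: \<rho>_def \<delta>_def algebra_simps)
      qed (intro open_Times open_thick open_ball)
      ultimately have "primitive \<eta> \<rho> (thick w a c e \<times> ?D)"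
        unfolding thick_Un[OF trans(3,4)] primitive_def by blast
      then show "\<exists>e>0. \<exists>\<rho>. primitive \<eta> \<rho> (thick w a c e \<times> ball t e)" using e(1) by blast
    qed
  next
    fix x :: real assume local: "0 \<le> x" "x \<le> 1"
    then have "(of_real x * w, t) \<in> strip \<times> T" using segment_strip[OF w, of x] t by simp
    then obtain e \<rho> where e: "e > 0" "primitive \<eta> \<rho> (ball (of_real x * w) e \<times> ball t e)"
      by (rule local_primitive[OF \<eta>]) blast
    \<comment> \<open>Parameters closer than \<open>d\<close> give points of the segment closer than \<open>e/2\<close>.\<close>
    define d where "d = e / (2 * (cmod w + 1))"
    have pos: "cmod w + 1 > 0" by (rule add_nonneg_pos) auto
    show "\<exists>d>0. \<forall>a b. a \<le> x \<and> x \<le> b \<and> b - a < d \<longrightarrow> P a b"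
    proof (intro exI[of _ d] conjI allI impI)
      show "d > 0" using e pos by (simp add: d_def)
      fix a b assume ab: "a \<le> x \<and> x \<le> b \<and> b - a < d"
      have "thick w a b (e/2) \<subseteq> ball (of_real x * w) e"
      proof
        fix y assume "y \<in> thick w a b (e/2)"
        then obtain u where u: "u \<in> {a..b}" "dist (of_real u * w) y < e/2" by (auto simp: thick_def)
        have "dist (of_real x * w) (of_real u * w) = \<bar>x - u\<bar> * cmod w"
          unfolding dist_norm by (metis left_diff_distrib norm_mult norm_of_real of_real_diff)
        also have "\<dots> \<le> d * (cmod w + 1)" by (rule mult_mono) (use u ab in auto)
        also have "\<dots> = e/2" using pos by (simp add: d_def field_simps)
        finally show "y \<in> ball (of_real x * w) e"
          using u(2) dist_triangle[of "of_real x * w" y "of_real u * w"] by simp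
      qed
      then have "thick w a b (e/2) \<times> ball t (e/2) \<subseteq> ball (of_real x * w) e \<times> ball t e"
        using e by (intro Sigma_mono subset_ball) auto
      then show "P a b" unfolding P_def using e primitive_subset by (metis half_gt_zero)
    qed
  qed simp
  then show ?thesis by (simp add: P_def)
qed

text \<open>
  The integral of \<open>\<eta>\<close> over the image of the segment from \<open>(0, t)\<close> to \<open>(w, t)\<close>. Its starting point \<open>E(0, t)\<close>
  lies on \<open>\<Sigma>\<close>.
\<close>

definition transport :: "oneform \<Rightarrow> pt \<Rightarrow> complex" where
  "transport \<eta> q = integral {0..1} (\<lambda>s. pairing \<eta> (E (of_real s * fst q, snd q)) (E' (of_real s * fst q, snd q) (fst q, 0)))"

lemma transport_eq:
  assumes \<rho>: "primitive \<eta> \<rho> (S \<times> D)" and t: "t \<in> D" and seg: "\<And>s. s \<in> {0..1} \<Longrightarrow> of_real s * w \<in> S"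
  shows "transport \<eta> (w, t) = \<rho> (w, t) - \<rho> (0, t)"
proof -
  have "((\<lambda>s. pairing \<eta> (E (of_real s * w, t)) (E' (of_real s * w, t) (w, 0))) has_integral
     \<rho> (of_real 1 * w, t) - \<rho> (of_real 0 * w, t)) {0..1}"
  proof (rule fundamental_theorem_of_calculus)
    fix s :: real assume s: "s \<in> {0..1}"
    let ?q = "(of_real s * w, t)"
    obtain l where l: "(\<rho> has_derivative (\<lambda>v. pairing \<eta> (E ?q) (E' ?q v) - l * snd v)) (at ?q)"
      using \<rho> seg[OF s] t unfolding primitive_def by blast
    interpret l: bounded_linear "\<lambda>v. pairing \<eta> (E ?q) (E' ?q v) - l * snd v"
      by (rule has_derivative_bounded_linear[OF l])
    have "((\<lambda>s. (of_real s * w, t)) has_derivative (\<lambda>h. h *\<^sub>R (w, 0))) (at s within {0..1})"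
      by (auto intro!: derivative_eq_intros simp: scaleR_conv_of_real)
    from has_derivative_compose[OF this l]
    show "((\<lambda>s. \<rho> (of_real s * w, t)) has_vector_derivative pairing \<eta> (E ?q) (E' ?q (w, 0))) (at s within {0..1})"
      unfolding has_vector_derivative_def l.scaleR by simp
  qed simp
  then show ?thesis by (simp add: transport_def integral_unique)
qed

text \<open>
  Near a point \<open>(w\<^sub>0, t\<^sub>0)\<close> the integral is \<open>\<rho>(w, t) - \<rho>(0, t)\<close> for a primitive \<open>\<rho>\<close> on a neighbourhood of the
  whole segment. The subtracted term is a holomorphic function of \<open>t\<close> because \<open>t \<mapsto> E(0, t)\<close> is the
  holomorphic section \<open>\<Sigma>\<close>; for a merely \<open>C\<^sup>1\<close> section the result need not be holomorphic.
\<close>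

lemma transport_primitive:
  assumes \<eta>: "holo_form \<eta> U"
  shows "primitive \<eta> (transport \<eta>) (strip \<times> T)"
proof -
  have "\<exists>l. (transport \<eta> has_derivative (\<lambda>v. pairing \<eta> (E q) (E' q v) - l * snd v)) (at q)"
    if q: "q \<in> strip \<times> T" for q
  proof -
    obtain w0 t0 where q0: "q = (w0, t0)" "w0 \<in> strip" "t0 \<in> T" using q by auto
    obtain e1 \<rho> where e1: "e1 > 0" and \<rho>1: "primitive \<eta> \<rho> (thick w0 0 1 e1 \<times> ball t0 e1)"
      using primitive_thick_segment[OF \<eta> q0(2,3)] by blast
    obtain e2 where e2: "e2 > 0" "ball t0 e2 \<subseteq> T" using open_T q0(3) open_contains_ball by blast
    define e where "e = min e1 e2"
    have e: "e > 0" "e \<le> e1" "ball t0 e \<subseteq> T" using e1 e2 by (auto simp: e_def)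
    let ?S = "thick w0 0 1 e" and ?D = "ball t0 e"
    have \<rho>: "primitive \<eta> \<rho> (?S \<times> ?D)"
      by (rule primitive_subset[OF \<rho>1]) (intro Sigma_mono thick_mono e subset_ball)
    have in0: "0 \<in> ?S" using e by (auto simp: thick_def intro!: bexI[of _ 0])
    have in1: "ball w0 e \<subseteq> ?S" by (force simp: thick_def intro!: bexI[of _ 1])
    have seg: "of_real s * w \<in> ?S" if "w \<in> ?S" "s \<in> {0..1}" for s w
      using convexD[OF convex_thick in0 that(1), of "1 - s" s] that by (simp add: scaleR_conv_of_real)
    have base: "\<exists>d. ((\<lambda>t. - \<rho> (0, t)) has_field_derivative d) (at t)" if t: "t \<in> ?D" for t
    proof -
      have tT: "t \<in> T" and q: "(0, t) \<in> strip \<times> T" using t e zero_strip by auto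
      obtain l where l: "(\<rho> has_derivative (\<lambda>v. pairing \<eta> (E (0, t)) (E' (0, t) v) - l * snd v)) (at (0, t))"
        using \<rho> in0 t unfolding primitive_def by blast
      have i: "((\<lambda>t. (0, t)) has_derivative (\<lambda>h. (0, h))) (at t)" by (auto intro!: derivative_eq_intros)
      have dE: "((\<lambda>t. \<Phi> (1, t)) has_derivative (\<lambda>h. E' (0, t) (0, h))) (at t)"
        using has_derivative_compose[OF i E_has_derivative[OF q]] by (simp add: E_def)
      obtain a b where ab: "((\<lambda>t. fst (\<Phi> (1, t))) has_field_derivative a) (at t)"
         "((\<lambda>t. snd (\<Phi> (1, t))) has_field_derivative b) (at t)"
        using section_holo[unfolded holomorphic_on_open[OF open_T]] tT by blast
      have "((\<lambda>t. (fst (\<Phi> (1, t)), snd (\<Phi> (1, t)))) has_derivative (\<lambda>h. (a * h, b * h))) (at t)"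
        using ab unfolding has_field_derivative_def by (rule has_derivative_Pair)
      from has_derivative_unique[OF dE this[simplified]]
      have "E' (0, t) (0, h) = (a * h, b * h)" for h by (rule fun_cong)
      then have "(\<lambda>h. - (pairing \<eta> (E (0, t)) (E' (0, t) (0, h)) - l * snd (0::complex, h))) =
        (*) (- (fst (\<eta> (E (0, t))) * a + snd (\<eta> (E (0, t))) * b - l))"
        by (simp add: pairing_def fun_eq_iff algebra_simps)
      moreover have "((\<lambda>t. - \<rho> (0, t)) has_derivative
          (\<lambda>h. - (pairing \<eta> (E (0, t)) (E' (0, t) (0, h)) - l * snd (0::complex, h)))) (at t)"
        by (rule has_derivative_minus[OF has_derivative_compose[OF i l]])
      ultimately show ?thesis by (auto simp: has_field_derivative_def)
    qed
    have \<rho>0: "primitive \<eta> (\<lambda>q. \<rho> q + - \<rho> (0, snd q)) (?S \<times> ?D)"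
      by (rule primitive_add_base[OF \<rho> base])
    have "primitive \<eta> (transport \<eta>) (?S \<times> ?D)"
    proof (rule primitive_cong[OF \<rho>0])
      fix q assume "q \<in> ?S \<times> ?D"
      then show "\<rho> q + - \<rho> (0, snd q) = transport \<eta> q"
        using transport_eq[OF \<rho>, of "snd q" "fst q"] seg by auto
    qed (intro open_Times open_thick open_ball)
    moreover have "q \<in> ?S \<times> ?D" using in1 e q0 by auto
    ultimately show ?thesis by (auto simp: primitive_def)
  qed
  then show ?thesis by (simp add: primitive_def)
qed

lemma transport_fibre_derivative:
  assumes \<eta>: "holo_form \<eta> U" and w: "w \<in> strip" and t: "t \<in> T"
  shows "((\<lambda>w. transport \<eta> (w, t)) has_derivative (\<lambda>h. pairing \<eta> (E (w, t)) (E' (w, t) (h, 0)))) (at w)"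
proof -
  obtain l where l: "(transport \<eta> has_derivative (\<lambda>v. pairing \<eta> (E (w, t)) (E' (w, t) v) - l * snd v)) (at (w, t))"
    using transport_primitive[OF \<eta>] w t by (auto simp: primitive_def)
  have "((\<lambda>w. (w, t)) has_derivative (\<lambda>h. (h, 0))) (at w)" by (auto intro!: derivative_eq_intros)
  from has_derivative_compose[OF this l] show ?thesis by simp
qed

definition period :: "oneform \<Rightarrow> complex \<Rightarrow> complex" where
  "period \<eta> t = transport \<eta> (2 * of_real pi * \<i>, t)"

text \<open>
  The two sides have the same derivative along the fibre, as \<open>E\<close> is \<open>2\<pi>\<i>\<close>-periodic, and the period is
  their difference at \<open>w = 0\<close>.
\<close>

lemma transport_periodic:
  assumes \<eta>: "holo_form \<eta> U" and per: "period \<eta> t = 0" and t: "t \<in> T" and w: "w \<in> strip"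
  shows "transport \<eta> (w + 2 * of_real pi * \<i>, t) = transport \<eta> (w, t)"
proof -
  let ?c = "2 * of_real pi * \<i>"
  have shift: "w + ?c \<in> strip" if "w \<in> strip" for w using that by (simp add: strip_eq)
  have "transport \<eta> (w + ?c, t) - transport \<eta> (w, t) = transport \<eta> (0 + ?c, t) - transport \<eta> (0, t)"
  proof (rule convex_has_derivative_zero[OF convex_strip open_strip _ w zero_strip])
    fix w assume w: "w \<in> strip"
    have 1: "((\<lambda>w. w + ?c) has_derivative (\<lambda>h. h)) (at w)" by (auto intro!: derivative_eq_intros)
    have "exp (w + ?c) = exp w" by (simp add: exp_add)
    then have "pairing \<eta> (E (w + ?c, t)) (E' (w + ?c, t) (h, 0)) = pairing \<eta> (E (w, t)) (E' (w, t) (h, 0))" for h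
      by (simp only: E_def E'_def fst_conv snd_conv)
    with has_derivative_diff[OF has_derivative_compose[OF 1 transport_fibre_derivative[OF \<eta> shift[OF w] t]]
        transport_fibre_derivative[OF \<eta> w t]]
    show "((\<lambda>w. transport \<eta> (w + ?c, t) - transport \<eta> (w, t)) has_derivative (\<lambda>_. 0)) (at w)" by simp
  qed
  moreover have "transport \<eta> (0, t) = 0"
    using linear_E'[of "(0, t)"] t zero_strip
    by (simp add: transport_def pairing_def linear_simps zero_prod_def[symmetric])
  ultimately show ?thesis using per by (simp add: period_def)
qed

lemma transport_exp_cong:
  assumes \<eta>: "holo_form \<eta> U" and per: "period \<eta> t = 0" and t: "t \<in> T"
    and w: "w \<in> strip" and eq: "exp w = exp w'"
  shows "transport \<eta> (w, t) = transport \<eta> (w', t)"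
proof -
  let ?c = "2 * of_real pi * \<i>"
  have up: "transport \<eta> (w + of_nat n * ?c, t) = transport \<eta> (w, t)" if "w \<in> strip" for n w
  proof (induction n)
    case (Suc n)
    have "w + of_nat n * ?c \<in> strip" using that by (simp add: strip_eq)
    from transport_periodic[OF \<eta> per t this] Suc show ?case by (simp add: algebra_simps)
  qed simp
  have w': "w' \<in> strip" using w eq by (simp add: strip_def)
  obtain n :: int where "w = w' + (of_int (2 * n) * pi) * \<i>" using eq exp_eq by blast
  then have n: "w = w' + of_int (2 * n) * of_real pi * \<i>" by simp
  show ?thesis
  proof (cases "n \<ge> 0")
    case True
    then have "w = w' + of_nat (nat n) * ?c" using n by (simp add: mult_ac)
    then show ?thesis using up[OF w'] by simp
  next
    case False
    then have "w' = w + of_nat (nat (- n)) * ?c" using n by (simp add: algebra_simps)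
    then show ?thesis using up[OF w] by simp
  qed
qed

text \<open>
  By periodicity, integration from \<open>\<Sigma>\<close> along the fibre defines a function \<open>r\<close> on \<open>U\<close>. It may be computed with any
  branch of the logarithm, and with a branch \<open>L\<close> smooth near a given point, \<open>p \<mapsto> (L p, F p)\<close> is a local inverse of
  \<open>E\<close>. So \<open>dr = \<eta> - l dF\<close> at every point, and the factor \<open>l\<close> is holomorphic as a
  quotient of holomorphic forms.
\<close>

theorem zero_periods_imp_relatively_exact:
  assumes \<eta>: "holo_form \<eta> U" and per: "\<And>t. t \<in> T \<Longrightarrow> period \<eta> t = 0"
  obtains g r where "holo2 g U" "holo2 r U"
    "\<And>p. p \<in> U \<Longrightarrow> fst (\<eta> p) = g p * Dx F p + Dx r p"
    "\<And>p. p \<in> U \<Longrightarrow> snd (\<eta> p) = g p * Dy F p + Dy r p"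
proof -
  define r where "r p = transport \<eta> (Ln (fst (\<Psi> p)), F p)" for p
  have dr: "\<exists>l. (r has_derivative (\<lambda>v. pairing \<eta> p v - l * pairing (dform F) p v)) (at p)" if p: "p \<in> U" for p
  proof -
    define z0 where "z0 = fst (\<Psi> p)"
    have z0: "z0 \<in> annulus" using \<Psi>[OF p] by (auto simp: z0_def)
    have nz: "z \<noteq> 0" if "z \<in> annulus" for z using that by (auto simp: annulus_def)
    \<comment> \<open>A logarithm of \<open>fst (\<Psi> x)\<close> that is smooth near \<open>p\<close>, even if \<open>z0\<close> lies on the cut of \<open>Ln\<close>.\<close>
    define L where "L x = Ln z0 + Ln (fst (\<Psi> x) / z0)" for x
    have expL: "exp (L x) = fst (\<Psi> x)" if "x \<in> U" for x
      using nz[OF z0] nz[of "fst (\<Psi> x)"] \<Psi>[OF that] by (auto simp: L_def exp_add)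
    have q: "(L x, F x) \<in> strip \<times> T" if "x \<in> U" for x
      using expL[OF that] \<Psi>[OF that] snd_\<Psi>[OF that] by (auto simp: strip_def mem_Times_iff)
    have EL: "E (L x, F x) = x" if "x \<in> U" for x
      using expL[OF that] \<Psi>[OF that] snd_\<Psi>[OF that] by (metis E_def fst_conv snd_conv prod.collapse)
    have r_eq: "transport \<eta> (L x, F x) = r x" if "x \<in> U" for x
      unfolding r_def
    proof (rule transport_exp_cong[OF \<eta>])
      show "F x \<in> T" "L x \<in> strip" using q[OF that] by auto
      then show "period \<eta> (F x) = 0" using per by blast
      show "exp (L x) = exp (Ln (fst (\<Psi> x)))" using expL[OF that] nz[of "fst (\<Psi> x)"] \<Psi>[OF that] by auto
    qed
    obtain L' where dL: "(L has_derivative L') (at p)"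
    proof -
      have 1: "((\<lambda>x. fst (\<Psi> x) / z0) has_derivative (\<lambda>v. fst (blinfun_apply (\<Psi>' p) v) / z0)) (at p)"
        using has_derivative_fst[OF d\<Psi>[OF p]] unfolding divide_inverse by (rule has_derivative_mult_left)
      have "fst (\<Psi> p) / z0 = 1" using nz[OF z0] by (simp add: z0_def)
      then have "(Ln has_derivative (*) 1) (at (fst (\<Psi> p) / z0))"
        using has_field_derivative_Ln[of 1] by (simp add: has_field_derivative_def)
      from has_derivative_add[OF has_derivative_const[of "Ln z0"] has_derivative_compose[OF 1 this]]
      have "(L has_derivative (\<lambda>v. fst (blinfun_apply (\<Psi>' p) v) / z0)) (at p)"
        unfolding L_def by simp
      then show thesis by (rule that)
    qed
    have dq: "((\<lambda>x. (L x, F x)) has_derivative (\<lambda>v. (L' v, pairing (dform F) p v))) (at p)"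
      by (intro has_derivative_Pair dL holo2_has_derivative_pairing[OF F p])
    have id: "E' (L p, F p) (L' v, pairing (dform F) p v) = v" for v
    proof -
      have "((\<lambda>x. x) has_derivative (\<lambda>v. E' (L p, F p) (L' v, pairing (dform F) p v))) (at p)"
        by (rule has_derivative_transform_within_open[OF
              has_derivative_compose[OF dq E_has_derivative[OF q[OF p]]] open_U p EL])
      from has_derivative_unique[OF this has_derivative_ident] show ?thesis by (rule fun_cong)
    qed
    obtain l where "(transport \<eta> has_derivative (\<lambda>v. pairing \<eta> (E (L p, F p)) (E' (L p, F p) v) - l * snd v)) (at (L p, F p))"
      using transport_primitive[OF \<eta>] q[OF p] by (auto simp: primitive_def)
    from has_derivative_compose[OF dq this]
    have "((\<lambda>x. transport \<eta> (L x, F x)) has_derivative (\<lambda>v. pairing \<eta> p v - l * pairing (dform F) p v)) (at p)"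
      by (simp add: id EL[OF p])
    then have "(r has_derivative (\<lambda>v. pairing \<eta> p v - l * pairing (dform F) p v)) (at p)"
      by (rule has_derivative_transform_within_open[OF _ open_U p r_eq])
    then show ?thesis ..
  qed
  have dr': "\<exists>l. (r has_derivative (\<lambda>v. (fst (\<eta> p) - l * Dx F p) * fst v + (snd (\<eta> p) - l * Dy F p) * snd v)) (at p)"
    if "p \<in> U" for p
    using dr[OF that] by (simp add: pairing_def dform_def algebra_simps)
  have r: "holo2 r U" unfolding holo2_def case_prod_unfold using dr' by blast
  have ex: "\<exists>l. fst (\<eta> p) - Dx r p = l * Dx F p \<and> snd (\<eta> p) - Dy r p = l * Dy F p" if p: "p \<in> U" for p
  proof -
    obtain l where "(r has_derivative (\<lambda>v. (fst (\<eta> p) - l * Dx F p) * fst v + (snd (\<eta> p) - l * Dy F p) * snd v)) (at p)"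
      using dr'[OF p] by blast
    from partials_unique[OF this] show ?thesis by (intro exI[of _ l]) simp
  qed
  have hol: "holo2 (\<lambda>p. fst (\<eta> p) - Dx r p) U" "holo2 (\<lambda>p. snd (\<eta> p) - Dy r p) U"
    using \<eta> r open_U by (auto simp: holo_form_def intro!: holo2_diff holo2_Dx holo2_Dy)
  have pr: "(fst (\<eta> p) - Dx r p) * Dy F p = (snd (\<eta> p) - Dy r p) * Dx F p" if "p \<in> U" for p
    using ex[OF that] by force
  obtain g where g: "holo2 g U" "\<And>p. p \<in> U \<Longrightarrow> fst (\<eta> p) - Dx r p = g p * Dx F p"
    "\<And>p. p \<in> U \<Longrightarrow> snd (\<eta> p) - Dy r p = g p * Dy F p"
    by (rule proportional_forms[OF open_U hol holo2_Dx[OF open_U F] holo2_Dy[OF open_U F] dF_nonzero pr])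
      (assumption, assumption, rule that)
  show thesis
    by (rule that[OF g(1) r]) (use g(2,3) in \<open>simp_all add: diff_eq_eq\<close>)
qed

end


section \<open>Melnikov functions as periods\<close>

definition fscale :: "(pt \<Rightarrow> complex) \<Rightarrow> oneform \<Rightarrow> oneform" where
  "fscale g \<omega> p = (g p * fst (\<omega> p), g p * snd (\<omega> p))"

lemma pairing_fscale: "pairing (fscale g \<omega>) p v = g p * pairing \<omega> p v"
  by (simp add: pairing_def fscale_def algebra_simps)

lemma holo_form_fscale: "holo2 g U \<Longrightarrow> holo_form \<omega> U \<Longrightarrow> holo_form (fscale g \<omega>) U"
  by (auto simp: holo_form_def fscale_def)

lemma francoise_sequence_mono: "francoise_sequence U F \<omega> k g r \<Longrightarrow> j \<le> k \<Longrightarrow> francoise_sequence U F \<omega> j g r"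
  by (auto simp: francoise_sequence_def)

lemma francoise_sequence_holo2_g:
  assumes "open U" "francoise_sequence U F \<omega> k g r" "i \<le> k"
  shows "holo2 (g i) U"
proof (cases "i = 0")
  case True
  then show ?thesis
    using assms by (intro holo2_cong[OF assms(1) _ holo2_const[of 1]]) (auto simp: francoise_sequence_def)
qed (use assms in \<open>auto simp: francoise_sequence_def\<close>)

lemma francoise_pair_pairing:
  assumes "francoise_sequence U F \<omega> (Suc j) g r" "p \<in> U"
  shows "pairing (fscale (g j) \<omega>) p v =
    g (Suc j) p * pairing (dform F) p v + pairing (dform (r (Suc j))) p v"
proof -
  have "g j p * fst (\<omega> p) = g (Suc j) p * Dx F p + Dx (r (Suc j)) p"
    "g j p * snd (\<omega> p) = g (Suc j) p * Dy F p + Dy (r (Suc j)) p"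
    using assms by (force simp: francoise_sequence_def)+
  then show ?thesis
    unfolding pairing_def fscale_def dform_def by (simp add: algebra_simps)
qed

lemma holo2_along_path:
  assumes "holo2 f U" "c s \<in> U" "(c has_vector_derivative c') (at s within S)"
  shows "((\<lambda>s. f (c s)) has_vector_derivative pairing (dform f) (c s) c') (at s within S)"
proof -
  interpret bounded_linear "pairing (dform f) (c s)" by (rule bounded_linear_pairing)
  show ?thesis
    using has_derivative_compose[OF assms(3)[unfolded has_vector_derivative_def] holo2_has_derivative_pairing[OF assms(1,2)]]
    by (simp add: has_vector_derivative_def scaleR)
qed

definition path_integral :: "oneform \<Rightarrow> (real \<Rightarrow> pt) \<Rightarrow> (real \<Rightarrow> pt) \<Rightarrow> complex" where
  "path_integral \<eta> c c' = integral {0..1} (\<lambda>s. pairing \<eta> (c s) (c' s))"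

lemma path_integral_exact:
  assumes f: "holo2 f U" and c: "\<And>s. s \<in> {0..1} \<Longrightarrow> c s \<in> U \<and> (c has_vector_derivative c' s) (at s within {0..1})"
  shows "path_integral (dform f) c c' = f (c 1) - f (c 0)"
  unfolding path_integral_def
  by (rule integral_unique, rule fundamental_theorem_of_calculus)
    (use c in \<open>auto intro!: holo2_along_path[OF f]\<close>)

lemma pairing_continuous_on:
  assumes "holo_form \<eta> U" "continuous_on S c" "continuous_on S c'" "c ` S \<subseteq> U"
  shows "continuous_on S (\<lambda>x. pairing \<eta> (c x) (c' x))"
  unfolding pairing_def using assms
  by (intro continuous_intros continuous_on_compose2[OF holo2_continuous_on]) (auto simp: holo_form_def)

text \<open>
  On a leaf of \<open>dF + \<epsilon>\<omega> = 0\<close> the form \<open>g\<^sub>j \<omega> = g\<^bsub>j+1\<^esub> dF + dr\<^bsub>j+1\<^esub>\<close> restricts to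
  \<open>dr\<^bsub>j+1\<^esub> - \<epsilon> g\<^bsub>j+1\<^esub> \<omega>\<close>.
\<close>

lemma francoise_pair_integral:
  assumes U: "open U" and F: "holo2 F U" and \<omega>: "holo_form \<omega> U"
    and fs: "francoise_sequence U F \<omega> (Suc j) g r"
    and c: "\<And>s. s \<in> {0..1} \<Longrightarrow> c s \<in> U \<and> (c has_vector_derivative c' s) (at s within {0..1}) \<and>
              pairing (dform F) (c s) (c' s) + \<epsilon> * pairing \<omega> (c s) (c' s) = 0"
    and c': "continuous_on {0..1} c'"
  shows "path_integral (fscale (g j) \<omega>) c c' =
    (r (Suc j) (c 1) - r (Suc j) (c 0)) - \<epsilon> * path_integral (fscale (g (Suc j)) \<omega>) c c'"
proof -
  have cont: "continuous_on {0..1} c"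
    using c has_vector_derivative_continuous by (meson continuous_on_eq_continuous_within)
  have r: "holo2 (r (Suc j)) U" using fs by (auto simp: francoise_sequence_def)
  have eq: "pairing (fscale (g j) \<omega>) (c s) (c' s) =
     pairing (dform (r (Suc j))) (c s) (c' s) - \<epsilon> * pairing (fscale (g (Suc j)) \<omega>) (c s) (c' s)"
    if s: "s \<in> {0..1}" for s
  proof -
    have "pairing (fscale (g j) \<omega>) (c s) (c' s) =
       g (Suc j) (c s) * pairing (dform F) (c s) (c' s) + pairing (dform (r (Suc j))) (c s) (c' s)"
      by (rule francoise_pair_pairing[OF fs]) (use c[OF s] in blast)
    moreover have "pairing (dform F) (c s) (c' s) = - \<epsilon> * pairing \<omega> (c s) (c' s)"
      using c[OF s] by (simp add: eq_neg_iff_add_eq_0)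
    ultimately show ?thesis by (simp add: pairing_fscale)
  qed
  have h: "holo_form (fscale (g (Suc j)) \<omega>) U" "holo_form (dform (r (Suc j))) U"
  proof -
    show "holo_form (fscale (g (Suc j)) \<omega>) U"
      by (rule holo_form_fscale[OF francoise_sequence_holo2_g[OF U fs order_refl] \<omega>])
    show "holo_form (dform (r (Suc j))) U"
      using holo2_Dx[OF U r] holo2_Dy[OF U r] by (simp add: holo_form_def dform_def)
  qed
  have "path_integral (fscale (g j) \<omega>) c c' = integral {0..1} (\<lambda>s. pairing (dform (r (Suc j))) (c s) (c' s)
      - \<epsilon> * pairing (fscale (g (Suc j)) \<omega>) (c s) (c' s))"
    unfolding path_integral_def by (rule integral_cong) (rule eq)
  also have "\<dots> = path_integral (dform (r (Suc j))) c c' - \<epsilon> * path_integral (fscale (g (Suc j)) \<omega>) c c'"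
    unfolding path_integral_def using c
    by (subst integral_diff) (auto intro!: integrable_continuous_interval continuous_on_mult_left
      pairing_continuous_on[OF h(1) cont c'] pairing_continuous_on[OF h(2) cont c'])
  also have "path_integral (dform (r (Suc j))) c c' = r (Suc j) (c 1) - r (Suc j) (c 0)"
    by (rule path_integral_exact[OF r]) (use c in blast)
  finally show ?thesis .
qed

lemma francoise_expansion:
  assumes U: "open U" and F: "holo2 F U" and \<omega>: "holo_form \<omega> U"
    and fs: "francoise_sequence U F \<omega> j g r"
    and c: "\<And>s. s \<in> {0..1} \<Longrightarrow> c s \<in> U \<and> (c has_vector_derivative c' s) (at s within {0..1}) \<and>
              pairing (dform F) (c s) (c' s) + \<epsilon> * pairing \<omega> (c s) (c' s) = 0"
    and c': "continuous_on {0..1} c'"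
  shows "F (c 1) - F (c 0) = (\<Sum>i=1..j. (- \<epsilon>) ^ i * (r i (c 1) - r i (c 0)))
    + (- \<epsilon>) ^ Suc j * path_integral (fscale (g j) \<omega>) c c'"
  using fs
proof (induction j)
  case 0
  have "F (c 1) - F (c 0) = path_integral (dform F) c c'"
    by (rule path_integral_exact[OF F, symmetric]) (use c in blast)
  also have "\<dots> = integral {0..1} (\<lambda>s. (- \<epsilon>) * pairing (fscale (g 0) \<omega>) (c s) (c' s))"
    unfolding path_integral_def
  proof (rule integral_cong)
    fix s :: real assume s: "s \<in> {0..1}"
    have "g 0 (c s) = 1" using 0 c[OF s] by (simp add: francoise_sequence_def)
    then show "pairing (dform F) (c s) (c' s) = (- \<epsilon>) * pairing (fscale (g 0) \<omega>) (c s) (c' s)"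
      using c[OF s] by (simp add: pairing_fscale eq_neg_iff_add_eq_0)
  qed
  finally show ?case by (simp add: path_integral_def)
next
  case (Suc j)
  have "F (c 1) - F (c 0) = (\<Sum>i=1..j. (- \<epsilon>) ^ i * (r i (c 1) - r i (c 0)))
    + (- \<epsilon>) ^ Suc j * path_integral (fscale (g j) \<omega>) c c'"
    using Suc francoise_sequence_mono by (metis le_add2 plus_1_eq_Suc)
  also have "path_integral (fscale (g j) \<omega>) c c' =
    (r (Suc j) (c 1) - r (Suc j) (c 0)) - \<epsilon> * path_integral (fscale (g (Suc j)) \<omega>) c c'"
    by (rule francoise_pair_integral[OF U F \<omega> Suc.prems c c'])
  finally show ?case by (simp add: right_diff_distrib mult.assoc mult.left_commute)
qed

text \<open>
  The indexing \<open>\<epsilon>\<^bsup>i+1\<^esup> a\<^bsub>i+1\<^esub>\<close> is that of the expansion of the displacement function, which has no constant term.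
\<close>

lemma power_series_leading_coefficient:
  fixes a :: "nat \<Rightarrow> complex"
  assumes sums: "eventually (\<lambda>\<epsilon>. (\<lambda>i. \<epsilon> ^ Suc i * a (Suc i)) sums \<Delta> \<epsilon>) (nhds 0)"
    and z: "\<And>i. i \<in> {1..n} \<Longrightarrow> a i = 0"
  shows "((\<lambda>\<epsilon>. \<Delta> \<epsilon> / \<epsilon> ^ Suc n) \<longlongrightarrow> a (Suc n)) (at 0)"
proof -
  obtain d where d: "d > 0" "\<And>\<epsilon>. norm \<epsilon> < d \<Longrightarrow> (\<lambda>i. \<epsilon> ^ Suc i * a (Suc i)) sums \<Delta> \<epsilon>"
    using sums unfolding eventually_nhds_metric by (auto simp: dist_norm)
  have "((\<lambda>\<epsilon>. \<Delta> \<epsilon> / \<epsilon> ^ Suc n) \<longlongrightarrow> a (Suc (0 + n))) (at 0)"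
  proof (rule powser_limit_0_strong[OF d(1), where a="\<lambda>i. a (Suc (i + n))"])
    fix \<epsilon> :: complex assume e: "\<epsilon> \<noteq> 0" "norm \<epsilon> < d"
    have "(\<Sum>i<n. \<epsilon> ^ Suc i * a (Suc i)) = 0" using z by (intro sum.neutral) auto
    then have "(\<lambda>i. \<epsilon> ^ Suc (i + n) * a (Suc (i + n))) sums \<Delta> \<epsilon>"
      using sums_split_initial_segment[OF d(2)[OF e(2)], of n] by (simp only: diff_zero)
    then have "(\<lambda>i. \<epsilon> ^ Suc (i + n) * a (Suc (i + n)) / \<epsilon> ^ Suc n) sums (\<Delta> \<epsilon> / \<epsilon> ^ Suc n)"
      by (rule sums_divide)
    moreover have "\<epsilon> ^ Suc (i + n) * a (Suc (i + n)) / \<epsilon> ^ Suc n = a (Suc (i + n)) * \<epsilon> ^ i" for i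
      using e by (simp add: power_add field_simps)
    ultimately show "(\<lambda>i. a (Suc (i + n)) * \<epsilon> ^ i) sums (\<Delta> \<epsilon> / \<epsilon> ^ Suc n)" by simp
  qed
  then show ?thesis by simp
qed

locale deformation = tube +
  fixes \<gamma> :: "complex \<Rightarrow> real \<Rightarrow> pt" and \<Sigma> :: "pt set" and \<omega> :: oneform and M :: "nat \<Rightarrow> complex \<Rightarrow> complex"
  assumes \<gamma>: "\<And>t s. t \<in> T \<Longrightarrow> s \<in> {0..1} \<Longrightarrow> \<gamma> t s = \<Phi> (cis (2 * pi * s), t)"
    and \<Sigma>: "\<Sigma> = (\<lambda>t. \<Phi> (1, t)) ` T"
    and \<omega>: "holo_form \<omega> U"
    and M: "melnikov_functions U F \<omega> \<Sigma> \<gamma> M"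
begin

lemma one_annulus: "1 \<in> annulus" by (simp add: annulus_def)

lemma F_image_\<Sigma>: "F ` \<Sigma> = T"
  unfolding \<Sigma> image_image using \<Phi> one_annulus by force

text \<open>
  The derivative of a parametrisation of \<open>\<gamma>(t)\<close> on the closed interval is unique, so the velocity \<open>c' 0\<close>
  that comes with a displacement function may be used to compute the period.
\<close>

lemma period_eq_path_integral:
  assumes t: "t \<in> T" and c: "\<And>s. s \<in> {0..1} \<Longrightarrow> c s = \<gamma> t s"
    "\<And>s. s \<in> {0..1} \<Longrightarrow> (c has_vector_derivative c' s) (at s within {0..1})"
  shows "period \<eta> t = path_integral \<eta> c c'"
proof -
  let ?w = "2 * of_real pi * \<i>"
  have "pairing \<eta> (E (of_real s * ?w, t)) (E' (of_real s * ?w, t) (?w, 0)) = pairing \<eta> (c s) (c' s)"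
    if s: "s \<in> {0..1}" for s :: real
  proof -
    have Ec: "E (of_real s * ?w, t) = c s" if "s \<in> {0..1}" for s
    proof -
      have "exp (of_real s * ?w) = cis (2 * pi * s)" by (simp add: cis_conv_exp mult_ac)
      then show ?thesis using c(1)[OF that] \<gamma>[OF t that] by (simp add: E_def)
    qed
    have q: "(of_real s * ?w, t) \<in> strip \<times> T" using t by (simp add: strip_eq)
    from ray_has_vector_derivative[OF q]
    have "((\<lambda>s. E (of_real s * ?w, t)) has_vector_derivative E' (of_real s * ?w, t) (?w, 0)) (at s within {0..1})" .
    then have "(c has_vector_derivative E' (of_real s * ?w, t) (?w, 0)) (at s within {0..1})"
      by (rule has_vector_derivative_transform[OF s, rotated]) (simp add: Ec)
    with c(2)[OF s] have "E' (of_real s * ?w, t) (?w, 0) = c' s"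
      using vector_derivative_unique_within_closed_interval[of 0 1 s] s by (metis box_real(2) zero_less_one)
    then show ?thesis using Ec[OF s] by simp
  qed
  then show ?thesis unfolding period_def transport_def path_integral_def
    by (intro integral_cong) simp
qed

text \<open>
  Divide the expansion of \<open>\<Delta>\<close> by \<open>\<epsilon>\<^bsup>j+1\<^esup>\<close> and let \<open>\<epsilon>\<close> tend to \<open>0\<close>. The left-hand side tends to
  \<open>M\<^bsub>j+1\<^esub>(t)\<close>, and the last term on the right tends to the period up to sign. The increment of \<open>r\<^sub>i\<close> between the points of
  \<open>\<Sigma>\<close> over \<open>t\<close> and \<open>t + \<Delta>\<close> is \<open>O(\<Delta>) = O(\<epsilon>\<^bsup>j+1\<^esup>)\<close> and carries a further factor \<open>\<epsilon>\<^sup>i\<close> with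
  \<open>i \<ge> 1\<close>, so it disappears in the limit.
\<close>

lemma melnikov_eq_period:
  assumes fs: "francoise_sequence U F \<omega> j g r" and t: "t \<in> T"
    and z: "\<And>i. i \<in> {1..j} \<Longrightarrow> M i t = 0"
  shows "M (Suc j) t = (-1) ^ Suc j * period (fscale (g j) \<omega>) t"
proof -
  let ?\<eta> = "fscale (g j) \<omega>"
  obtain \<Delta> where disp: "displacement_function U F \<omega> \<Sigma> \<gamma> \<Delta>"
    and sums: "\<And>t. t \<in> T \<Longrightarrow> eventually (\<lambda>\<epsilon>. (\<lambda>i. \<epsilon> ^ Suc i * M (Suc i) t) sums \<Delta> t \<epsilon>) (nhds 0)"
    using M unfolding melnikov_functions_def F_image_\<Sigma> by blast
  obtain \<delta> c c' where \<delta>: "\<delta> > 0"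
    and cont: "continuous_on (ball 0 \<delta> \<times> {0..1}) (\<lambda>(\<epsilon>, s). c \<epsilon> s)"
      "continuous_on (ball 0 \<delta> \<times> {0..1}) (\<lambda>(\<epsilon>, s). c' \<epsilon> s)"
    and c0': "\<forall>s\<in>{0..1}. c 0 s = \<gamma> t s"
    and c_all: "\<forall>\<epsilon>\<in>ball 0 \<delta>.
           (\<forall>s\<in>{0..1}. c \<epsilon> s \<in> U \<and>
              (c \<epsilon> has_vector_derivative c' \<epsilon> s) (at s within {0..1}) \<and>
              pairing (dform F) (c \<epsilon> s) (c' \<epsilon> s) + \<epsilon> * pairing \<omega> (c \<epsilon> s) (c' \<epsilon> s) = 0) \<and>
           c \<epsilon> 0 = \<gamma> t 0 \<and> c \<epsilon> 1 \<in> \<Sigma> \<and> F (c \<epsilon> 1) = t + \<Delta> t \<epsilon>"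
    using bspec[OF disp[unfolded displacement_function_def F_image_\<Sigma>] t]
    by (elim exE conjE) (rule that)
  have c0: "c 0 s = \<gamma> t s" if "s \<in> {0..1}" for s using c0' that by blast
  have c: "c \<epsilon> s \<in> U \<and> (c \<epsilon> has_vector_derivative c' \<epsilon> s) (at s within {0..1}) \<and>
              pairing (dform F) (c \<epsilon> s) (c' \<epsilon> s) + \<epsilon> * pairing \<omega> (c \<epsilon> s) (c' \<epsilon> s) = 0"
    if "\<epsilon> \<in> ball 0 \<delta>" "s \<in> {0..1}" for \<epsilon> s using c_all that by blast
  have ends: "c \<epsilon> 0 = \<gamma> t 0 \<and> c \<epsilon> 1 \<in> \<Sigma> \<and> F (c \<epsilon> 1) = t + \<Delta> t \<epsilon>" if "\<epsilon> \<in> ball 0 \<delta>" for \<epsilon>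
    using c_all that by blast
  have start: "c \<epsilon> 0 = \<Phi> (1, t)" and stop: "c \<epsilon> 1 = \<Phi> (1, t + \<Delta> t \<epsilon>)" if e: "\<epsilon> \<in> ball 0 \<delta>" for \<epsilon>
  proof -
    show "c \<epsilon> 0 = \<Phi> (1, t)" using ends[OF e] \<gamma>[OF t, of 0] by simp
    obtain t' where t': "t' \<in> T" "c \<epsilon> 1 = \<Phi> (1, t')" using ends[OF e] \<Sigma> by auto
    then show "c \<epsilon> 1 = \<Phi> (1, t + \<Delta> t \<epsilon>)" using ends[OF e] \<Phi>[of "(1, t')"] one_annulus by simp
  qed
  have F0: "F (\<Phi> (1, t)) = t" using \<Phi>[of "(1, t)"] one_annulus t by simp
  have \<eta>: "holo_form ?\<eta> U"
    by (rule holo_form_fscale[OF francoise_sequence_holo2_g[OF open_U fs] \<omega>]) simp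
  define I where "I \<epsilon> = path_integral ?\<eta> (c \<epsilon>) (c' \<epsilon>)" for \<epsilon>
  \<comment> \<open>\<open>r\<^sub>i\<close> restricted to \<open>\<Sigma>\<close>, where both end points of the deformed paths lie.\<close>
  define K where "K i = (\<lambda>\<tau>. r i (\<Phi> (1, \<tau>)))" for i
  have expansion: "\<Delta> t \<epsilon> = (\<Sum>i=1..j. (- \<epsilon>) ^ i * (K i (t + \<Delta> t \<epsilon>) - K i t)) + (- \<epsilon>) ^ Suc j * I \<epsilon>"
    if e: "\<epsilon> \<in> ball 0 \<delta>" for \<epsilon>
  proof -
    have "continuous_on {0..1} (\<lambda>s. case (\<epsilon>, s) of (\<epsilon>, s) \<Rightarrow> c' \<epsilon> s)"
      by (rule continuous_on_compose2[OF cont(2)]) (use e in \<open>auto intro!: continuous_intros\<close>)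
    then have "continuous_on {0..1} (c' \<epsilon>)" by simp
    from francoise_expansion[OF open_U F \<omega> fs c[OF e] this] start[OF e] stop[OF e] ends[OF e] F0
    show ?thesis by (simp add: I_def K_def)
  qed
  have lead: "((\<lambda>\<epsilon>. \<Delta> t \<epsilon> / \<epsilon> ^ Suc j) \<longlongrightarrow> M (Suc j) t) (at 0)"
    by (rule power_series_leading_coefficient[OF sums[OF t] z])
  have \<Delta>0: "(\<Delta> t \<longlongrightarrow> 0) (at 0)"
  proof -
    have "((\<lambda>\<epsilon>. \<Delta> t \<epsilon> / \<epsilon> ^ Suc j * \<epsilon> ^ Suc j) \<longlongrightarrow> M (Suc j) t * 0 ^ Suc j) (at 0)"
      by (intro tendsto_mult lead tendsto_power tendsto_ident_at)
    then have "((\<lambda>\<epsilon>. \<Delta> t \<epsilon> / \<epsilon> ^ Suc j * \<epsilon> ^ Suc j) \<longlongrightarrow> 0) (at 0)" by simp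
    then show ?thesis
      by (rule Lim_transform_eventually) (auto simp: eventually_at_filter)
  qed
  have I0: "(I \<longlongrightarrow> I 0) (at 0)"
  proof -
    have "continuous_on (ball 0 \<delta> \<times> cbox 0 1) (\<lambda>(\<epsilon>, s). pairing ?\<eta> (c \<epsilon> s) (c' \<epsilon> s))"
      using pairing_continuous_on[OF \<eta> cont] c by (force simp: case_prod_unfold cbox_interval)
    from integral_continuous_on_param[OF this]
    have "continuous_on (ball 0 \<delta>) I" by (simp add: I_def[abs_def] path_integral_def cbox_interval)
    then show ?thesis using \<delta> by (simp add: continuous_on_eq_continuous_at isCont_def)
  qed
  have endpoint: "((\<lambda>\<epsilon>. (-1) ^ i * \<epsilon> ^ i * (K i (t + \<Delta> t \<epsilon>) - K i t) / \<epsilon> ^ Suc j) \<longlongrightarrow> 0) (at 0)" if i: "i \<in> {1..j}" for i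
  proof -
    have ri: "holo2 (r i) U" using fs i by (simp add: francoise_sequence_def)
    obtain a b where ab: "((\<lambda>t. fst (\<Phi> (1, t))) has_field_derivative a) (at t)"
         "((\<lambda>t. snd (\<Phi> (1, t))) has_field_derivative b) (at t)"
      using section_holo[unfolded holomorphic_on_open[OF open_T]] t by blast
    have U1: "\<Phi> (1, t) \<in> U" using \<Phi>[of "(1, t)"] one_annulus t by simp
    have "((\<lambda>t. (fst (\<Phi> (1, t)), snd (\<Phi> (1, t)))) has_derivative (\<lambda>h. (a * h, b * h))) (at t)"
      using ab unfolding has_field_derivative_def by (rule has_derivative_Pair)
    then have "((\<lambda>t. \<Phi> (1, t)) has_derivative (\<lambda>h. (a * h, b * h))) (at t)" by simp
    from has_derivative_compose[OF this holo2_has_derivative[OF ri U1]]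
    moreover have "(\<lambda>h. Dx (r i) (\<Phi> (1, t)) * (a * h) + Dy (r i) (\<Phi> (1, t)) * (b * h)) =
        (*) (Dx (r i) (\<Phi> (1, t)) * a + Dy (r i) (\<Phi> (1, t)) * b)"
      by (simp add: fun_eq_iff algebra_simps)
    ultimately have "(K i has_field_derivative (Dx (r i) (\<Phi> (1, t)) * a + Dy (r i) (\<Phi> (1, t)) * b)) (at t)"
      by (simp add: has_field_derivative_def K_def)
    \<comment> \<open>The difference quotient, extended continuously to \<open>t\<close>; \<open>\<Delta> t \<epsilon>\<close> may vanish.\<close>
    then obtain Q where Q: "\<And>z. K i z - K i t = Q z * (z - t)" "isCont Q t"
      using CARAT_DERIV by blast
    have "((\<lambda>\<epsilon>. t + \<Delta> t \<epsilon>) \<longlongrightarrow> t + 0) (at 0)" by (intro tendsto_add tendsto_const \<Delta>0)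
    then have "((\<lambda>\<epsilon>. Q (t + \<Delta> t \<epsilon>)) \<longlongrightarrow> Q t) (at 0)"
      using isCont_tendsto_compose[OF Q(2)] by simp
    then have "((\<lambda>\<epsilon>. (-1) ^ i * \<epsilon> ^ i * (Q (t + \<Delta> t \<epsilon>) * (\<Delta> t \<epsilon> / \<epsilon> ^ Suc j)))
        \<longlongrightarrow> (-1) ^ i * 0 ^ i * (Q t * M (Suc j) t)) (at 0)"
      by (intro tendsto_mult tendsto_const tendsto_power tendsto_ident_at lead)
    then show ?thesis using i by (simp add: Q(1) mult.assoc power_0_left)
  qed
  have "((\<lambda>\<epsilon>. (\<Sum>i=1..j. (-1) ^ i * \<epsilon> ^ i * (K i (t + \<Delta> t \<epsilon>) - K i t) / \<epsilon> ^ Suc j) + (-1) ^ Suc j * I \<epsilon>)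
      \<longlongrightarrow> (\<Sum>i=1..j. 0) + (-1) ^ Suc j * I 0) (at 0)"
    by (intro tendsto_add tendsto_sum endpoint tendsto_mult tendsto_const I0)
  moreover have "eventually (\<lambda>\<epsilon>. (\<Sum>i=1..j. (-1) ^ i * \<epsilon> ^ i * (K i (t + \<Delta> t \<epsilon>) - K i t) / \<epsilon> ^ Suc j)
      + (-1) ^ Suc j * I \<epsilon> = \<Delta> t \<epsilon> / \<epsilon> ^ Suc j) (at 0)"
    unfolding eventually_at
  proof (intro exI[of _ \<delta>] conjI \<delta> ballI impI)
    fix \<epsilon> :: complex assume "\<epsilon> \<noteq> 0 \<and> dist \<epsilon> 0 < \<delta>"
    then have e: "\<epsilon> \<noteq> 0" "\<epsilon> \<in> ball 0 \<delta>" by auto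
    have m: "(- \<epsilon>) ^ i = (-1) ^ i * \<epsilon> ^ i" for i by (rule power_minus)
    have "(- \<epsilon>) ^ Suc j * I \<epsilon> / \<epsilon> ^ Suc j = (-1) ^ Suc j * I \<epsilon>" unfolding m using e(1) by simp
    with arg_cong[OF expansion[OF e(2)], of "\<lambda>x. x / \<epsilon> ^ Suc j"]
    show "(\<Sum>i=1..j. (-1) ^ i * \<epsilon> ^ i * (K i (t + \<Delta> t \<epsilon>) - K i t) / \<epsilon> ^ Suc j)
      + (-1) ^ Suc j * I \<epsilon> = \<Delta> t \<epsilon> / \<epsilon> ^ Suc j"
      by (simp only: add_divide_distrib sum_divide_distrib m)
  qed
  ultimately have "((\<lambda>\<epsilon>. \<Delta> t \<epsilon> / \<epsilon> ^ Suc j) \<longlongrightarrow> (\<Sum>i=1..j. 0) + (-1) ^ Suc j * I 0) (at 0)"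
    by (rule Lim_transform_eventually)
  from tendsto_unique[OF _ lead this] have "M (Suc j) t = (-1) ^ Suc j * I 0" by simp
  moreover have "I 0 = period ?\<eta> t"
    unfolding I_def by (rule period_eq_path_integral[OF t c0, symmetric]) (use c[of 0] \<delta> in auto)
  ultimately show ?thesis by simp
qed

text \<open>
  On the cycle \<open>dF = 0\<close>, so \<open>g\<^sub>j \<omega>\<close> restricts to the exact form \<open>dr\<^bsub>j+1\<^esub>\<close>.
\<close>

lemma period_francoise_zero:
  assumes fs: "francoise_sequence U F \<omega> (Suc j) g r" and t: "t \<in> T"
  shows "period (fscale (g j) \<omega>) t = 0"
proof -
  let ?w = "2 * of_real pi * \<i>"
  have r: "holo2 (r (Suc j)) U" using fs by (simp add: francoise_sequence_def)
  define c where "c s = E (of_real s * ?w, t)" for s :: real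
  define c' where "c' s = E' (of_real s * ?w, t) (?w, 0)" for s :: real
  have q: "(of_real s * ?w, t) \<in> strip \<times> T" for s using t by (simp add: strip_eq)
  have c: "c s \<in> U \<and> (c has_vector_derivative c' s) (at s within {0..1}) \<and>
     pairing (fscale (g j) \<omega>) (c s) (c' s) = pairing (dform (r (Suc j))) (c s) (c' s)" for s
  proof (intro conjI)
    show cU: "c s \<in> U" unfolding c_def by (rule E_in[OF q])
    show "(c has_vector_derivative c' s) (at s within {0..1})"
      unfolding c_def[abs_def] c'_def by (rule ray_has_vector_derivative[OF q])
    have "pairing (dform F) (c s) (c' s) = 0" using dF_E'[OF q] by (simp add: c_def c'_def)
    with francoise_pair_pairing[OF fs cU, of "c' s"]
    show "pairing (fscale (g j) \<omega>) (c s) (c' s) = pairing (dform (r (Suc j))) (c s) (c' s)" by simp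
  qed
  have "period (fscale (g j) \<omega>) t = path_integral (dform (r (Suc j))) c c'"
    unfolding period_def transport_def path_integral_def
    by (rule integral_cong) (use c in \<open>simp add: c_def c'_def\<close>)
  also have "\<dots> = r (Suc j) (c 1) - r (Suc j) (c 0)" by (rule path_integral_exact[OF r]) (use c in blast)
  also have "c 1 = c 0" by (simp add: c_def E_def)
  finally show ?thesis by simp
qed

theorem francoise_imp_melnikov_zero:
  assumes "francoise_sequence U F \<omega> k g r" "t \<in> T" "i \<in> {1..k}"
  shows "M i t = 0"
  using assms
proof (induction k arbitrary: i)
  case (Suc k)
  have fs: "francoise_sequence U F \<omega> k g r" using Suc.prems francoise_sequence_mono by (metis le_add2 plus_1_eq_Suc)
  show ?case
  proof (cases "i = Suc k")
    case True
    then show ?thesis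
      using melnikov_eq_period[OF fs Suc.prems(2) Suc.IH[OF fs Suc.prems(2)]]
        period_francoise_zero[OF Suc.prems(1,2)] by simp
  next
    case False
    then show ?thesis using Suc.IH[OF fs Suc.prems(2)] Suc.prems(3) by auto
  qed
qed simp

theorem melnikov_zero_imp_francoise:
  assumes "\<And>i t. i \<in> {1..k} \<Longrightarrow> t \<in> T \<Longrightarrow> M i t = 0"
  shows "\<exists>g r. francoise_sequence U F \<omega> k g r"
  using assms
proof (induction k)
  case 0
  have "francoise_sequence U F \<omega> 0 (\<lambda>_ _. 1) (\<lambda>_ _. 0)" by (simp add: francoise_sequence_def)
  then show ?case by blast
next
  case (Suc k)
  then obtain g r where fs: "francoise_sequence U F \<omega> k g r" by fastforce
  have per: "period (fscale (g k) \<omega>) t = 0" if t: "t \<in> T" for t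
    using melnikov_eq_period[OF fs t] Suc.prems t by simp
  obtain G R where GR: "holo2 G U" "holo2 R U"
    "\<And>p. p \<in> U \<Longrightarrow> fst (fscale (g k) \<omega> p) = G p * Dx F p + Dx R p"
    "\<And>p. p \<in> U \<Longrightarrow> snd (fscale (g k) \<omega> p) = G p * Dy F p + Dy R p"
    by (rule zero_periods_imp_relatively_exact[OF
        holo_form_fscale[OF francoise_sequence_holo2_g[OF open_U fs order_refl] \<omega>] per])
      (assumption, rule that)
  have "francoise_sequence U F \<omega> (Suc k) (g(Suc k := G)) (r(Suc k := R))"
    using fs GR by (auto simp: francoise_sequence_def fscale_def)
  then show ?case by blast
qed

end


section \<open>Series of holomorphic functions\<close>

lemma fps_mult_nth_cong:
  assumes "\<And>i. i \<le> n \<Longrightarrow> fps_nth f i = fps_nth f' i" "\<And>i. i \<le> n \<Longrightarrow> fps_nth g i = fps_nth g' i"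
  shows "fps_nth (f * g) n = fps_nth (f' * g') n"
  unfolding fps_mult_nth using assms by (intro sum.cong) auto

lemma holo_series_nth: "holo_series f U \<Longrightarrow> holo2 (\<lambda>p. fps_nth (f p) i) U"
  by (simp add: holo_series_def)

lemma sDx_nth [simp]: "fps_nth (sDx f p) i = Dx (\<lambda>q. fps_nth (f q) i) p"
  and sDy_nth [simp]: "fps_nth (sDy f p) i = Dy (\<lambda>q. fps_nth (f q) i) p"
  and sDe_nth [simp]: "fps_nth (sDe f p) i = of_nat (i + 1) * fps_nth (f p) (i + 1)"
  and eps_series_nth [simp]: "fps_nth (eps_series a p) i = a i p"
  by (simp_all add: sDx_def sDy_def sDe_def eps_series_def)

lemma holo_series_mult:
  assumes "holo_series f U" "holo_series g U"
  shows "holo_series (\<lambda>p. f p * g p) U"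
  unfolding holo_series_def fps_mult_nth using assms
  by (auto intro!: holo2_sum holo2_mult holo_series_nth)

lemma
  assumes "holo_series f U" "holo_series g U" "p \<in> U"
  shows sDx_mult: "sDx (\<lambda>p. f p * g p) p = f p * sDx g p + sDx f p * g p"
    and sDy_mult: "sDy (\<lambda>p. f p * g p) p = f p * sDy g p + sDy f p * g p"
proof -
  have h: "holo2 (\<lambda>q. fps_nth (f q) i * fps_nth (g q) j) U" for i j
    using assms by (auto intro!: holo_series_nth)
  show "sDx (\<lambda>p. f p * g p) p = f p * sDx g p + sDx f p * g p"
  proof (rule fps_ext)
    fix n
    have "Dx (\<lambda>q. \<Sum>i=0..n. fps_nth (f q) i * fps_nth (g q) (n - i)) p =
      (\<Sum>i=0..n. Dx (\<lambda>q. fps_nth (f q) i * fps_nth (g q) (n - i)) p)"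
      by (rule Dx_sum[OF h assms(3)])
    also have "\<dots> = (\<Sum>i=0..n. fps_nth (f p) i * Dx (\<lambda>q. fps_nth (g q) (n - i)) p +
        Dx (\<lambda>q. fps_nth (f q) i) p * fps_nth (g p) (n - i))"
      by (intro sum.cong refl Dx_mult[OF holo_series_nth[OF assms(1)] holo_series_nth[OF assms(2)] assms(3)])
    finally show "fps_nth (sDx (\<lambda>p. f p * g p) p) n = fps_nth (f p * sDx g p + sDx f p * g p) n"
      by (simp add: fps_mult_nth sum.distrib)
  qed
  show "sDy (\<lambda>p. f p * g p) p = f p * sDy g p + sDy f p * g p"
  proof (rule fps_ext)
    fix n
    have "Dy (\<lambda>q. \<Sum>i=0..n. fps_nth (f q) i * fps_nth (g q) (n - i)) p =
      (\<Sum>i=0..n. Dy (\<lambda>q. fps_nth (f q) i * fps_nth (g q) (n - i)) p)"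
      by (rule Dy_sum[OF h assms(3)])
    also have "\<dots> = (\<Sum>i=0..n. fps_nth (f p) i * Dy (\<lambda>q. fps_nth (g q) (n - i)) p +
        Dy (\<lambda>q. fps_nth (f q) i) p * fps_nth (g p) (n - i))"
      by (intro sum.cong refl Dy_mult[OF holo_series_nth[OF assms(1)] holo_series_nth[OF assms(2)] assms(3)])
    finally show "fps_nth (sDy (\<lambda>p. f p * g p) p) n = fps_nth (f p * sDy g p + sDy f p * g p) n"
      by (simp add: fps_mult_nth sum.distrib)
  qed
qed

lemma sDe_mult: "sDe (\<lambda>p. f p * g p) p = f p * sDe g p + sDe f p * g p"
  by (simp add: sDe_def)

lemma holo_series_inverse:
  assumes U: "open U" and f: "holo_series f U" and f0: "\<And>p. p \<in> U \<Longrightarrow> fps_nth (f p) 0 = 1"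
  shows "holo_series (\<lambda>p. inverse (f p)) U"
proof -
  have "holo2 (\<lambda>p. fps_nth (inverse (f p)) n) U" for n
  proof (induction n rule: less_induct)
    case (less n)
    show ?case
    proof (cases "n = 0")
      case True
      show ?thesis
        by (rule holo2_cong[OF U _ holo2_const[of 1]]) (simp add: True f0)
    next
      case False
      have "- (\<Sum>i=1..n. fps_nth (f p) i * fps_nth (inverse (f p)) (n - i)) = fps_nth (inverse (f p)) n"
        if p: "p \<in> U" for p
      proof -
        have "fps_nth (f p * inverse (f p)) n = 0"
          using f0[OF p] False by (simp add: inverse_mult_eq_1')
        then have "(\<Sum>i=0..n. fps_nth (f p) i * fps_nth (inverse (f p)) (n - i)) = 0"
          by (simp add: fps_mult_nth)
        then have "fps_nth (inverse (f p)) n + (\<Sum>i=1..n. fps_nth (f p) i * fps_nth (inverse (f p)) (n - i)) = 0"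
          using f0[OF p] by (simp add: sum.atLeast_Suc_atMost)
        then show ?thesis by (simp only: eq_neg_iff_add_eq_0[symmetric])
      qed
      then show ?thesis
        by (rule holo2_cong[OF U]) (auto intro!: holo2_minus holo2_sum holo2_mult holo_series_nth[OF f] less)
    qed
  qed
  then show ?thesis by (simp add: holo_series_def)
qed

lemma sDx_sDy_commute:
  assumes "open U" "holo_series f U" "p \<in> U"
  shows "sDx (sDy f) p = sDy (sDx f) p"
  using mixed_partials[OF assms(1) holo_series_nth[OF assms(2)] assms(3)] by (intro fps_ext) simp

lemma sDx_sDe_commute:
  assumes "holo_series f U" "p \<in> U"
  shows "sDx (sDe f) p = sDe (sDx f) p" "sDy (sDe f) p = sDe (sDy f) p"
  using assms
  by (auto intro!: fps_ext Dx_cmult[OF holo_series_nth[OF assms(1)] assms(2)]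
      Dy_cmult[OF holo_series_nth[OF assms(1)] assms(2)] simp del: of_nat_add of_nat_Suc)

lemma N_series_nth: "fps_nth (N_series k n p) j = (if j = 0 then 1 else if j \<le> k then n j p else 0)"
proof -
  have "fps_nth (N_series k n p) j = fps_nth 1 j + (\<Sum>i=1..k. if i = j then n i p else 0)"
    unfolding N_series_def fps_add_nth fps_sum_nth
    by (intro arg_cong2[of _ _ _ _ "(+)"] sum.cong refl) (auto simp: fps_X_power_mult_nth)
  then show ?thesis by (auto simp: sum.delta')
qed

lemma F_series_nth: "fps_nth (F_series F k r p) j =
   (if j = 0 then F p else if j \<le> k then (-1) ^ (j + 1) * r j p else 0)"
proof -
  have c: "(-1) ^ (i + 1) * fps_X ^ i * fps_const (r i p) = fps_X ^ i * fps_const ((-1) ^ (i + 1) * r i p)" for i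
  proof -
    have "(-1 :: complex fps) = fps_const (-1)" by (rule fps_ext) auto
    then have "(-1 :: complex fps) ^ (i + 1) = fps_const ((-1) ^ (i + 1))"
      by (simp only: fps_const_power)
    then show ?thesis by (simp only: fps_const_mult[symmetric] mult_ac)
  qed
  have "fps_nth (F_series F k r p) j = fps_nth (fps_const (F p)) j + (\<Sum>i=1..k. if i = j then (-1) ^ (i + 1) * r i p else 0)"
    unfolding F_series_def fps_add_nth fps_sum_nth c
    by (intro arg_cong2[of _ _ _ _ "(+)"] sum.cong refl) (auto simp: fps_X_power_mult_nth)
  then show ?thesis by (auto simp: sum.delta')
qed

lemma holo_N_series:
  assumes "\<And>i. i \<in> {1..k} \<Longrightarrow> holo2 (n i) U"
  shows "holo_series (N_series k n) U"
proof -
  have "holo2 (\<lambda>p. fps_nth (N_series k n p) i) U" for i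
    using assms[of i] by (cases "i = 0"; cases "i \<le> k") (simp_all add: N_series_nth)
  then show ?thesis by (simp add: holo_series_def)
qed

lemma holo_F_series:
  assumes "holo2 F U" "\<And>i. i \<in> {1..k} \<Longrightarrow> holo2 (r i) U"
  shows "holo_series (F_series F k r) U"
proof -
  have "holo2 (\<lambda>p. fps_nth (F_series F k r p) i) U" for i
    using assms(1) holo2_cmult[OF assms(2)[of i], of "(-1) ^ (i + 1)"]
    by (cases "i = 0"; cases "i \<le> k") (simp_all add: F_series_nth)
  then show ?thesis by (simp add: holo_series_def)
qed

text \<open>
  The weights match: differentiation in \<open>\<epsilon>\<close> loses one power of \<open>\<epsilon>\<close>, but it is applied only to the \<open>dx\<close> and
  \<open>dy\<close> coefficients, which are known to one order more than the \<open>d\<epsilon>\<close> coefficient.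
\<close>

lemma wedge_dt1_cong_mod:
  assumes U: "open U" and eq: "form1_eq_mod (Suc k) U \<alpha> \<beta>"
    and hol: "holo_series (cx \<beta>) U" "holo_series (cy \<beta>) U" "holo_series (ce \<beta>) U"
    and p: "p \<in> U" and i: "i < k"
  shows "fps_nth (wedge12 \<alpha> (dt1 \<alpha>) p) i = fps_nth (wedge12 \<beta> (dt1 \<beta>) p) i"
proof -
  have xy: "fps_nth (cx \<alpha> q) j = fps_nth (cx \<beta> q) j" "fps_nth (cy \<alpha> q) j = fps_nth (cy \<beta> q) j"
    if "q \<in> U" "j \<le> k" for q j using eq that by (auto simp: form1_eq_mod_def)
  have e: "fps_nth (ce \<alpha> q) j = fps_nth (ce \<beta> q) j" if "q \<in> U" "j < k" for q j
    using eq that by (auto simp: form1_eq_mod_def)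
  have d: "Dx (\<lambda>q. fps_nth (cy \<alpha> q) j) p = Dx (\<lambda>q. fps_nth (cy \<beta> q) j) p"
    "Dy (\<lambda>q. fps_nth (cx \<alpha> q) j) p = Dy (\<lambda>q. fps_nth (cx \<beta> q) j) p"
    "Dx (\<lambda>q. fps_nth (ce \<alpha> q) j) p = Dx (\<lambda>q. fps_nth (ce \<beta> q) j) p"
    "Dy (\<lambda>q. fps_nth (ce \<alpha> q) j) p = Dy (\<lambda>q. fps_nth (ce \<beta> q) j) p" if "j \<le> i" for j
    using partials_cong[OF U xy(1)[symmetric] holo_series_nth[OF hol(1)] p]
      partials_cong[OF U xy(2)[symmetric] holo_series_nth[OF hol(2)] p]
      partials_cong[OF U e[symmetric] holo_series_nth[OF hol(3)] p] i that by auto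
  show ?thesis
    unfolding wedge12_def dt1_def fps_add_nth fps_sub_nth form2.sel
    by (intro arg_cong2[of _ _ _ _ "(+)"] arg_cong2[of _ _ _ _ "(-)"] fps_mult_nth_cong)
      (use i p in \<open>auto simp: xy e d simp del: of_nat_add of_nat_Suc\<close>)
qed

lemma wedge_dt1_exact:
  assumes U: "open U" and H: "holo_series H U" and p: "p \<in> U"
  shows "wedge12 (dt0 H) (dt1 (dt0 H)) p = 0"
  by (simp add: wedge12_def dt1_def dt0_def sDx_sDy_commute[OF U H p] sDx_sDe_commute[OF H p])

lemma equal_partials_imp_differ_by_const:
  assumes U: "open U" "connected U" and fg: "holo2 f U" "holo2 g U"
    and eq: "\<And>p. p \<in> U \<Longrightarrow> Dx f p = Dx g p \<and> Dy f p = Dy g p"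
  shows "\<exists>c. \<forall>p\<in>U. f p = c + g p"
proof (cases "U = {}")
  case False
  then obtain p0 where p0: "p0 \<in> U" by blast
  have "f p - g p = f p0 - g p0" if p: "p \<in> U" for p
  proof (rule has_derivative_zero_unique_connected[OF U _ p p0])
    fix q assume q: "q \<in> U"
    from has_derivative_diff[OF holo2_has_derivative[OF fg(1) q] holo2_has_derivative[OF fg(2) q]] eq[OF q]
    show "((\<lambda>p. f p - g p) has_derivative (\<lambda>v. 0)) (at q)" by simp
  qed
  then show ?thesis by (intro exI[of _ "f p0 - g p0"]) (simp add: diff_eq_eq)
qed simp


section \<open>Integrating factors\<close>

locale foliation =
  fixes U :: "pt set" and F :: "pt \<Rightarrow> complex" and \<omega> :: oneform
  assumes U: "open U" "connected U" and F: "holo2 F U" and \<omega>: "holo_form \<omega> U"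
    and dF: "\<And>p. p \<in> U \<Longrightarrow> Dx F p \<noteq> 0 \<or> Dy F p \<noteq> 0"
begin

text \<open>
  The coefficients of \<open>\<alpha> = dF + \<epsilon>\<omega>\<close>.
\<close>

definition alpha_x :: series where "alpha_x p = fps_const (Dx F p) + fps_X * fps_const (fst (\<omega> p))"
definition alpha_y :: series where "alpha_y p = fps_const (Dy F p) + fps_X * fps_const (snd (\<omega> p))"

lemma alpha_x_nth: "fps_nth (alpha_x p) i = (if i = 0 then Dx F p else if i = 1 then fst (\<omega> p) else 0)"
  and alpha_y_nth: "fps_nth (alpha_y p) i = (if i = 0 then Dy F p else if i = 1 then snd (\<omega> p) else 0)"
  by (auto simp: alpha_x_def alpha_y_def)

lemma holo_alpha_x: "holo_series alpha_x U" and holo_alpha_y: "holo_series alpha_y U"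
proof -
  have "holo2 (\<lambda>p. fps_nth (alpha_x p) i) U \<and> holo2 (\<lambda>p. fps_nth (alpha_y p) i) U" for i
    using \<omega> holo2_Dx[OF U(1) F] holo2_Dy[OF U(1) F]
    by (cases "i = 0"; cases "i = 1") (simp_all add: alpha_x_nth alpha_y_nth holo_form_def)
  then show "holo_series alpha_x U" "holo_series alpha_y U" by (simp_all add: holo_series_def)
qed

lemma mult_alpha_x_nth: "fps_nth (f * alpha_x p) i = fps_nth f i * Dx F p + (if i = 0 then 0 else fps_nth f (i - 1) * fst (\<omega> p))"
  and mult_alpha_y_nth: "fps_nth (f * alpha_y p) i = fps_nth f i * Dy F p + (if i = 0 then 0 else fps_nth f (i - 1) * snd (\<omega> p))"
  by (simp_all add: alpha_x_def alpha_y_def distrib_left mult.assoc[symmetric])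

lemma gv_form_sel:
  "cx (gv_form F \<omega> G R) p = eps_series G p * alpha_x p"
  "cy (gv_form F \<omega> G R) p = eps_series G p * alpha_y p"
  "ce (gv_form F \<omega> G R) p = eps_series (\<lambda>i. R (i + 1)) p"
  by (simp_all add: gv_form_def add1_def scale1_def deps_def lift_form_def dform_def alpha_x_def alpha_y_def)

lemma gv_coeffs_holo:
  assumes "gv_coeffs U G R"
  shows "holo_series (eps_series G) U" "holo_series (eps_series (\<lambda>i. R (i + 1))) U"
    "\<And>p. p \<in> U \<Longrightarrow> fps_nth (eps_series G p) 0 = 1"
proof -
  have "holo2 (G 0) U"
    by (rule holo2_cong[OF U(1) _ holo2_const[of 1]]) (use assms in \<open>simp add: gv_coeffs_def\<close>)
  then have "holo2 (G i) U" for i using assms by (cases "i = 0") (auto simp: gv_coeffs_def)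
  then show "holo_series (eps_series G) U" by (simp add: holo_series_def)
qed (use assms in \<open>auto simp: gv_coeffs_def holo_series_def\<close>)

lemma sDe_alpha_x_nth: "fps_nth (sDe (\<lambda>p. f p * alpha_x p) p) i =
   of_nat (i + 1) * (fps_nth (f p) (i + 1) * Dx F p + fps_nth (f p) i * fst (\<omega> p))"
  and sDe_alpha_y_nth: "fps_nth (sDe (\<lambda>p. f p * alpha_y p) p) i =
   of_nat (i + 1) * (fps_nth (f p) (i + 1) * Dy F p + fps_nth (f p) i * snd (\<omega> p))"
  by (simp_all add: mult_alpha_x_nth mult_alpha_y_nth)

text \<open>
  The coefficient of \<open>dx \<and> dy \<and> d\<epsilon>\<close> in \<open>\<beta> \<and> d\<beta>\<close> for \<open>\<beta> = \<alpha> + Q d\<epsilon>\<close>.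
\<close>

definition integrability :: "series \<Rightarrow> series" where
  "integrability Q p = alpha_x p * sDy Q p - alpha_y p * sDx Q p - alpha_x p * sDe alpha_y p + alpha_y p * sDe alpha_x p
     + Q p * (sDx alpha_y p - sDy alpha_x p)"

text \<open>
  \<open>G\<beta> \<and> d(G\<beta>) = G\<^sup>2 \<beta> \<and> d\<beta>\<close>: the term with \<open>dG\<close> contains \<open>\<beta> \<and> \<beta>\<close>.
\<close>

lemma wedge_normalise:
  assumes \<alpha>: "\<alpha> = Form1 (\<lambda>p. G p * alpha_x p) (\<lambda>p. G p * alpha_y p) (\<lambda>p. G p * Q p)"
    and G: "holo_series G U" and Q: "holo_series Q U" and p: "p \<in> U"
  shows "wedge12 \<alpha> (dt1 \<alpha>) p = G p ^ 2 * integrability Q p"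
proof -
  have "cx \<alpha> = (\<lambda>p. G p * alpha_x p)" "cy \<alpha> = (\<lambda>p. G p * alpha_y p)" "ce \<alpha> = (\<lambda>p. G p * Q p)" using \<alpha> by simp_all
  then show ?thesis
    unfolding wedge12_def dt1_def form2.sel integrability_def
    by (simp only: sDx_mult[OF G holo_alpha_y p] sDy_mult[OF G holo_alpha_x p] sDx_mult[OF G Q p] sDy_mult[OF G Q p] sDe_mult)
      (simp add: algebra_simps power2_eq_square)
qed

text \<open>
  Vanishing, up to order \<open>m\<close>, of the \<open>dx \<and> d\<epsilon>\<close> and \<open>dy \<and> d\<epsilon>\<close> coefficients of \<open>d(u (\<alpha> + Q d\<epsilon>))\<close>.
\<close>

definition integrates_mod :: "nat \<Rightarrow> series \<Rightarrow> series \<Rightarrow> bool" where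
  "integrates_mod m Q u \<longleftrightarrow> (\<forall>p\<in>U. \<forall>i<m.
     fps_nth (sDe (\<lambda>p. u p * alpha_x p) p) i = fps_nth (sDx (\<lambda>p. u p * Q p) p) i \<and>
     fps_nth (sDe (\<lambda>p. u p * alpha_y p) p) i = fps_nth (sDy (\<lambda>p. u p * Q p) p) i)"

text \<open>
  The remaining \<open>dx \<and> dy\<close> coefficient, that is \<open>d(u\<alpha>)\<close> with \<open>d\<close> in \<open>x, y\<close>, has the \<open>\<epsilon>\<close>-derivative
  \<open>d(\<partial>(u\<alpha>)/\<partial>\<epsilon>) = d(d(uQ)) = 0\<close> up to order \<open>m\<close>, and its constant term is \<open>d(dF) = 0\<close>.
\<close>

lemma integrates_mod_imp_closed:
  assumes u: "holo_series u U" "\<And>p. p \<in> U \<Longrightarrow> fps_nth (u p) 0 = 1" and Q: "holo_series Q U"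
    and cl: "integrates_mod m Q u" and p: "p \<in> U" and i: "i \<le> m"
  shows "fps_nth (sDx (\<lambda>p. u p * alpha_y p) p - sDy (\<lambda>p. u p * alpha_x p) p) i = 0"
proof (cases i)
  case 0
  have u0: "Dx F q = fps_nth (u q * alpha_x q) 0" "Dy F q = fps_nth (u q * alpha_y q) 0" if "q \<in> U" for q
    using u(2)[OF that] by (simp_all add: alpha_x_nth alpha_y_nth)
  have "Dx (Dy F) p = Dx (\<lambda>q. fps_nth (u q * alpha_y q) 0) p"
    by (rule partials_cong(1)[OF U(1) u0(2) holo2_Dy[OF U(1) F] p])
  moreover have "Dy (Dx F) p = Dy (\<lambda>q. fps_nth (u q * alpha_x q) 0) p"
    by (rule partials_cong(2)[OF U(1) u0(1) holo2_Dx[OF U(1) F] p])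
  ultimately show ?thesis unfolding 0 fps_sub_nth sDx_nth sDy_nth using mixed_partials[OF U(1) F p] by (metis right_minus_eq)
next
  case (Suc j)
  have j: "j < m" using Suc i by simp
  have hx: "holo_series (\<lambda>p. u p * alpha_x p) U" and hy: "holo_series (\<lambda>p. u p * alpha_y p) U"
    and hQ: "holo_series (\<lambda>p. u p * Q p) U"
    using u Q holo_alpha_x holo_alpha_y by (auto intro: holo_series_mult)
  have clx: "fps_nth (sDx (\<lambda>p. u p * Q p) q) j = fps_nth (sDe (\<lambda>p. u p * alpha_x p) q) j"
    and cly: "fps_nth (sDy (\<lambda>p. u p * Q p) q) j = fps_nth (sDe (\<lambda>p. u p * alpha_y p) q) j" if "q \<in> U" for q
    using cl j that unfolding integrates_mod_def by metis+
  have hQx: "holo2 (\<lambda>q. fps_nth (sDx (\<lambda>p. u p * Q p) q) j) U"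
    and hQy: "holo2 (\<lambda>q. fps_nth (sDy (\<lambda>p. u p * Q p) q) j) U"
    unfolding sDx_nth sDy_nth
    by (rule holo2_Dx[OF U(1) holo_series_nth[OF hQ]] holo2_Dy[OF U(1) holo_series_nth[OF hQ]])+
  have "fps_nth (sDe (sDx (\<lambda>p. u p * alpha_y p)) p) j = fps_nth (sDx (sDe (\<lambda>p. u p * alpha_y p)) p) j"
    by (simp only: sDx_sDe_commute(1)[OF hy p])
  also have "\<dots> = fps_nth (sDx (sDy (\<lambda>p. u p * Q p)) p) j"
    unfolding sDx_nth by (rule partials_cong(1)[OF U(1) cly hQy p, symmetric])
  also have "\<dots> = fps_nth (sDy (sDx (\<lambda>p. u p * Q p)) p) j"
    by (simp only: sDx_sDy_commute[OF U(1) hQ p])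
  also have "\<dots> = fps_nth (sDy (sDe (\<lambda>p. u p * alpha_x p)) p) j"
    unfolding sDy_nth by (rule partials_cong(2)[OF U(1) clx hQx p])
  also have "\<dots> = fps_nth (sDe (sDy (\<lambda>p. u p * alpha_x p)) p) j"
    by (simp only: sDx_sDe_commute(2)[OF hx p])
  finally have "of_nat (j + 1) * (fps_nth (sDx (\<lambda>p. u p * alpha_y p) p) (j + 1)) =
      (of_nat (j + 1) :: complex) * (fps_nth (sDy (\<lambda>p. u p * alpha_x p) p) (j + 1))"
    unfolding sDe_nth .
  moreover have "(of_nat (j + 1) :: complex) \<noteq> 0" by (simp del: of_nat_add of_nat_Suc)
  ultimately have "fps_nth (sDx (\<lambda>p. u p * alpha_y p) p) (j + 1) = fps_nth (sDy (\<lambda>p. u p * alpha_x p) p) (j + 1)"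
    by (metis mult_left_cancel)
  then show ?thesis unfolding Suc fps_sub_nth Suc_eq_plus1 by simp
qed

text \<open>
  Let \<open>A dx + B dy = \<partial>(u\<alpha>)/\<partial>\<epsilon> - d(uQ)\<close>, which vanishes to order \<open>m\<close>. The product rule gives
  \<open>(A dx + B dy) \<and> \<alpha> = (u I - Q C) dx \<and> dy\<close>, where \<open>I\<close> is the integrability expression and \<open>C\<close> the
  coefficient of \<open>d(u\<alpha>)\<close>. Both terms vanish in order \<open>m\<close>, and there \<open>\<alpha>\<close> contributes only \<open>dF\<close>, so the error of order \<open>m\<close>
  is \<open>v dF\<close>. Subtracting \<open>\<epsilon>\<^bsup>m+1\<^esup> v / (m + 1)\<close> from \<open>u\<close> removes it.
\<close>

lemma integrating_factor:
  assumes Q: "holo_series Q U" and int: "\<And>p i. p \<in> U \<Longrightarrow> i < k \<Longrightarrow> fps_nth (integrability Q p) i = 0"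
    and m: "m \<le> k"
  shows "\<exists>u. holo_series u U \<and> (\<forall>p\<in>U. fps_nth (u p) 0 = 1) \<and> integrates_mod m Q u"
  using m
proof (induction m)
  case 0
  have "holo_series (\<lambda>p. 1) U" by (simp add: holo_series_def)
  then show ?case by (intro exI[of _ "\<lambda>p. 1"]) (auto simp: integrates_mod_def)
next
  case (Suc m)
  then obtain u where u: "holo_series u U" "\<And>p. p \<in> U \<Longrightarrow> fps_nth (u p) 0 = 1" and cl: "integrates_mod m Q u"
    by force
  define A where "A p = sDe (\<lambda>p. u p * alpha_x p) p - sDx (\<lambda>p. u p * Q p) p" for p
  define B where "B p = sDe (\<lambda>p. u p * alpha_y p) p - sDy (\<lambda>p. u p * Q p) p" for p
  have low: "fps_nth (A p) i = 0" "fps_nth (B p) i = 0" if "p \<in> U" "i < m" for p i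
    using cl that by (simp_all add: A_def B_def integrates_mod_def del: sDe_nth sDx_nth sDy_nth)
  have pr: "fps_nth (A p) m * Dy F p = fps_nth (B p) m * Dx F p" if p: "p \<in> U" for p
  proof -
    have id: "A p * alpha_y p - B p * alpha_x p = u p * integrability Q p -
        Q p * (sDx (\<lambda>p. u p * alpha_y p) p - sDy (\<lambda>p. u p * alpha_x p) p)"
      unfolding A_def B_def integrability_def
      by (simp only: sDx_mult[OF u(1) holo_alpha_y p] sDy_mult[OF u(1) holo_alpha_x p]
          sDx_mult[OF u(1) Q p] sDy_mult[OF u(1) Q p] sDe_mult) (simp add: algebra_simps)
    have "fps_nth (u p * integrability Q p) m = fps_nth (u p * 0) m"
      by (rule fps_mult_nth_cong) (use Suc.prems in \<open>simp_all add: int[OF p]\<close>)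
    moreover have "fps_nth (Q p * (sDx (\<lambda>p. u p * alpha_y p) p - sDy (\<lambda>p. u p * alpha_x p) p)) m = fps_nth (Q p * 0) m"
      by (rule fps_mult_nth_cong) (use integrates_mod_imp_closed[OF u Q cl p] in auto)
    ultimately have "fps_nth (A p * alpha_y p - B p * alpha_x p) m = 0" unfolding id by simp
    then have "fps_nth (A p * alpha_y p) m = fps_nth (B p * alpha_x p) m" by simp
    then show ?thesis using low[OF p] by (simp add: mult_alpha_x_nth mult_alpha_y_nth split: if_splits)
  qed
  have hA: "holo2 (\<lambda>p. fps_nth (A p) m) U" and hB: "holo2 (\<lambda>p. fps_nth (B p) m) U"
  proof -
    note hx = holo_series_nth[OF holo_series_mult[OF u(1) holo_alpha_x]]
      and hy = holo_series_nth[OF holo_series_mult[OF u(1) holo_alpha_y]]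
      and hQ = holo_series_nth[OF holo_series_mult[OF u(1) Q]]
    show "holo2 (\<lambda>p. fps_nth (A p) m) U" unfolding A_def fps_sub_nth sDe_nth sDx_nth
      by (rule holo2_diff[OF holo2_cmult[OF hx] holo2_Dx[OF U(1) hQ]])
    show "holo2 (\<lambda>p. fps_nth (B p) m) U" unfolding B_def fps_sub_nth sDe_nth sDy_nth
      by (rule holo2_diff[OF holo2_cmult[OF hy] holo2_Dy[OF U(1) hQ]])
  qed
  obtain v where v: "holo2 v U" "\<And>p. p \<in> U \<Longrightarrow> fps_nth (A p) m = v p * Dx F p"
    "\<And>p. p \<in> U \<Longrightarrow> fps_nth (B p) m = v p * Dy F p"
    by (rule proportional_forms[OF U(1) hA hB holo2_Dx[OF U(1) F] holo2_Dy[OF U(1) F] dF pr])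
      (assumption, assumption, rule that)
  define u' where "u' p = u p - fps_const (inverse (of_nat (m + 1)) * v p) * fps_X ^ (m + 1)" for p
  have u'_nth: "fps_nth (u' p) i = (if i = m + 1 then fps_nth (u p) i - inverse (of_nat (m + 1)) * v p else fps_nth (u p) i)" for p i
    by (auto simp: u'_def fps_X_power_mult_right_nth)
  have hu': "holo_series u' U"
    unfolding holo_series_def
  proof
    fix i
    have "holo2 (\<lambda>p. fps_nth (u p) i - inverse (of_nat (m + 1)) * v p) U"
      by (intro holo2_diff holo2_cmult v holo_series_nth[OF u(1)])
    then show "holo2 (\<lambda>p. fps_nth (u' p) i) U"
      using holo_series_nth[OF u(1), of i] by (cases "i = m + 1") (simp_all add: u'_nth del: of_nat_add of_nat_Suc)
  qed
  have Qu: "fps_nth (u' p * Q p) i = fps_nth (u p * Q p) i" if "i \<le> m" for p i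
    by (rule fps_mult_nth_cong) (use that in \<open>auto simp: u'_nth\<close>)
  have ne: "(of_nat (m + 1) :: complex) \<noteq> 0" by (simp del: of_nat_add of_nat_Suc)
  have "integrates_mod (Suc m) Q u'"
    unfolding integrates_mod_def
  proof (intro ballI allI impI)
    fix p i assume p: "p \<in> U" and i: "i < Suc m"
    have "fps_nth (A p) i = (if i = m then v p * Dx F p else 0)" "fps_nth (B p) i = (if i = m then v p * Dy F p else 0)"
      using low[OF p, of i] v(2,3)[OF p] i by (auto simp: less_Suc_eq)
    then have AB: "fps_nth (sDe (\<lambda>p. u p * alpha_x p) p) i - fps_nth (sDx (\<lambda>p. u p * Q p) p) i = (if i = m then v p * Dx F p else 0)"
      "fps_nth (sDe (\<lambda>p. u p * alpha_y p) p) i - fps_nth (sDy (\<lambda>p. u p * Q p) p) i = (if i = m then v p * Dy F p else 0)"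
      by (simp_all only: A_def B_def fps_sub_nth)
    have Ai: "fps_nth (sDe (\<lambda>p. u p * alpha_x p) p) i - (if i = m then v p * Dx F p else 0) = fps_nth (sDx (\<lambda>p. u p * Q p) p) i"
      "fps_nth (sDe (\<lambda>p. u p * alpha_y p) p) i - (if i = m then v p * Dy F p else 0) = fps_nth (sDy (\<lambda>p. u p * Q p) p) i"
      unfolding AB[symmetric] by simp_all
    have 1: "fps_nth (sDe (\<lambda>p. u' p * alpha_x p) p) i = fps_nth (sDe (\<lambda>p. u p * alpha_x p) p) i - (if i = m then v p * Dx F p else 0)"
      "fps_nth (sDe (\<lambda>p. u' p * alpha_y p) p) i = fps_nth (sDe (\<lambda>p. u p * alpha_y p) p) i - (if i = m then v p * Dy F p else 0)"
    proof -
      have "c * ((a - inverse c * w) * x + b) = c * (a * x + b) - w * x" if "c \<noteq> 0" for a b c w x :: complex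
        using that by (simp add: field_simps)
      note this[OF ne]
      then show "fps_nth (sDe (\<lambda>p. u' p * alpha_x p) p) i = fps_nth (sDe (\<lambda>p. u p * alpha_x p) p) i - (if i = m then v p * Dx F p else 0)"
        "fps_nth (sDe (\<lambda>p. u' p * alpha_y p) p) i = fps_nth (sDe (\<lambda>p. u p * alpha_y p) p) i - (if i = m then v p * Dy F p else 0)"
        unfolding sDe_alpha_x_nth sDe_alpha_y_nth u'_nth using i by (cases "i = m"; simp del: of_nat_add of_nat_Suc)+
    qed
    show "fps_nth (sDe (\<lambda>p. u' p * alpha_x p) p) i = fps_nth (sDx (\<lambda>p. u' p * Q p) p) i \<and>
       fps_nth (sDe (\<lambda>p. u' p * alpha_y p) p) i = fps_nth (sDy (\<lambda>p. u' p * Q p) p) i"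
      unfolding 1 Ai using Qu[of i] i by simp
  qed
  moreover have "fps_nth (u' p) 0 = 1" if "p \<in> U" for p using u(2)[OF that] by (simp add: u'_nth)
  ultimately show ?case using hu' by blast
qed


section \<open>Godbillon-Vey forms and Francoise sequences\<close>

text \<open>
  Write \<open>\<Omega> = G (\<alpha> + Q d\<epsilon>)\<close> with \<open>Q = R / G\<close>, and let \<open>u\<close> be an integrating factor of \<open>\<alpha> + Q d\<epsilon>\<close>. The
  potential \<open>H\<close> has \<open>\<partial>H/\<partial>\<epsilon> = u Q\<close>, that is \<open>H\<^sub>i = (u Q)\<^bsub>i-1\<^esub> / i\<close>, which explains the formula for \<open>r\<^sub>i\<close>. The
  remaining factor is \<open>N = G / u\<close>.
\<close>

lemma godbillon_vey_imp_francoise: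
  assumes gv: "gv_sequence U F \<omega> k G R"
  obtains n g r where "francoise_sequence U F \<omega> k g r"
    "factorization_mod U k (gv_form F \<omega> G R) n (F_series F k r)"
proof -
  have co: "gv_coeffs U G R" using gv by (simp add: gv_sequence_def)
  let ?G = "eps_series G" and ?R = "eps_series (\<lambda>i. R (i + 1))"
  note hG = gv_coeffs_holo[OF co]
  define Q where "Q p = inverse (?G p) * ?R p" for p
  have hQ: "holo_series Q U" unfolding Q_def
    by (intro holo_series_mult holo_series_inverse[OF U(1) hG(1)] hG)
  have GQ: "?G p * Q p = ?R p" if "p \<in> U" for p
    using hG(3)[OF that] by (simp add: Q_def mult.assoc[symmetric] inverse_mult_eq_1')
  define \<beta> where "\<beta> = Form1 (\<lambda>p. ?G p * alpha_x p) (\<lambda>p. ?G p * alpha_y p) (\<lambda>p. ?G p * Q p)"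
  have int: "fps_nth (integrability Q p) i = 0" if p: "p \<in> U" and i: "i < k" for p i
  proof -
    have W: "fps_nth (?G p ^ 2 * integrability Q p) j = 0" if j: "j \<le> i" for j
    proof -
      have "fps_nth (wedge12 (gv_form F \<omega> G R) (dt1 (gv_form F \<omega> G R)) p) j = fps_nth (wedge12 \<beta> (dt1 \<beta>) p) j"
      proof (rule wedge_dt1_cong_mod[OF U(1) _ _ _ _ p])
        show "form1_eq_mod (Suc k) U (gv_form F \<omega> G R) \<beta>"
          by (simp add: form1_eq_mod_def gv_form_sel \<beta>_def GQ)
        show "j < k" using i j by simp
        show "holo_series (cx \<beta>) U" "holo_series (cy \<beta>) U" "holo_series (ce \<beta>) U"
          unfolding \<beta>_def form1.sel
          by (rule holo_series_mult[OF hG(1) holo_alpha_x] holo_series_mult[OF hG(1) holo_alpha_y] holo_series_mult[OF hG(1) hQ])+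
      qed
      moreover have zero: "\<forall>p\<in>U. \<forall>i. i + 1 < k + 1 \<longrightarrow>
          fps_nth (wedge12 (gv_form F \<omega> G R) (dt1 (gv_form F \<omega> G R)) p) i = 0"
        using gv unfolding gv_sequence_def form3_zero_mod_def by blast
      have "fps_nth (wedge12 (gv_form F \<omega> G R) (dt1 (gv_form F \<omega> G R)) p) j = 0"
        by (rule zero[rule_format, OF p]) (use i j in simp)
      ultimately show ?thesis unfolding wedge_normalise[OF \<beta>_def hG(1) hQ p] by (rule trans[OF sym])
    qed
    have "fps_nth (?G p ^ 2) 0 \<noteq> 0"
      unfolding power2_eq_square fps_mult_nth_0 hG(3)[OF p] by simp
    then have "inverse (?G p ^ 2) * ?G p ^ 2 = 1" by (rule inverse_mult_eq_1)
    then have "integrability Q p = inverse (?G p ^ 2) * (?G p ^ 2 * integrability Q p)"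
      by (simp only: mult.assoc[symmetric] mult_1)
    moreover have "fps_nth (inverse (?G p ^ 2) * (?G p ^ 2 * integrability Q p)) i = fps_nth (inverse (?G p ^ 2) * 0) i"
    proof (rule fps_mult_nth_cong)
      show "fps_nth (?G p ^ 2 * integrability Q p) j = fps_nth 0 j" if "j \<le> i" for j
        using W[OF that] by (simp only: fps_zero_nth)
    qed (rule refl)
    ultimately show ?thesis by (simp only: mult_zero_right fps_zero_nth)
  qed
  obtain u where u: "holo_series u U" "\<And>p. p \<in> U \<Longrightarrow> fps_nth (u p) 0 = 1" and cl: "integrates_mod k Q u"
    using integrating_factor[OF hQ int order_refl] by blast
  define g where "g i p = (-1) ^ i * fps_nth (u p) i" for i p
  define r where "r i p = ((-1) ^ (i + 1) / of_nat i) * fps_nth (u p * Q p) (i - 1)" for i p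
  have huQ: "holo_series (\<lambda>p. u p * Q p) U" by (intro holo_series_mult u hQ)
  have hr: "holo2 (r i) U" for i unfolding r_def by (intro holo2_cmult holo_series_nth[OF huQ])
  have hg: "holo2 (g i) U" for i unfolding g_def by (intro holo2_cmult holo_series_nth[OF u(1)])
  have Dr: "(-1) ^ (i + 1) * Dx (r i) p = fps_nth (u p * alpha_x p) i"
    "(-1) ^ (i + 1) * Dy (r i) p = fps_nth (u p * alpha_y p) i" if p: "p \<in> U" and i: "i \<in> {1..k}" for p i
  proof -
    obtain j where j: "i = Suc j" "j < k" using i by (cases i) auto
    have sg: "(-1) ^ (i + 1) * ((-1) ^ (i + 1) / of_nat i) = (1 / of_nat i :: complex)"
      by (simp add: power_add[symmetric] flip: power_mult_distrib)
    have ne: "(of_nat i :: complex) \<noteq> 0" using i by auto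
    have D: "Dx (r i) p = ((-1) ^ (i + 1) / of_nat i) * Dx (\<lambda>p. fps_nth (u p * Q p) j) p"
      "Dy (r i) p = ((-1) ^ (i + 1) / of_nat i) * Dy (\<lambda>p. fps_nth (u p * Q p) j) p"
      unfolding r_def j(1) diff_Suc_1
      by (rule Dx_cmult[OF holo_series_nth[OF huQ] p] Dy_cmult[OF holo_series_nth[OF huQ] p])+
    have "Dx (\<lambda>p. fps_nth (u p * Q p) j) p = of_nat i * fps_nth (u p * alpha_x p) i"
      "Dy (\<lambda>p. fps_nth (u p * Q p) j) p = of_nat i * fps_nth (u p * alpha_y p) i"
      using cl p j by (auto simp: integrates_mod_def)
    then show "(-1) ^ (i + 1) * Dx (r i) p = fps_nth (u p * alpha_x p) i"
      "(-1) ^ (i + 1) * Dy (r i) p = fps_nth (u p * alpha_y p) i"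
      unfolding D mult.assoc[symmetric] sg using ne by simp_all
  qed
  have fs: "francoise_sequence U F \<omega> k g r"
    unfolding francoise_sequence_def
  proof (intro conjI ballI hr hg)
    show "g 0 p = 1" if "p \<in> U" for p using u(2)[OF that] by (simp add: g_def)
    fix i p assume i: "i \<in> {1..k}" and p: "p \<in> U"
    obtain j where j: "i = Suc j" using i by (cases i) auto
    show "g (i - 1) p * fst (\<omega> p) = g i p * Dx F p + Dx (r i) p"
    proof -
      have "(-1) ^ i * ((-1) ^ (i + 1) * Dx (r i) p) = (-1) ^ i * fps_nth (u p * alpha_x p) i"
        using Dr(1)[OF p i] by simp
      then show ?thesis
        by (simp add: g_def j mult_alpha_x_nth algebra_simps flip: power_mult_distrib)
    qed
    show "g (i - 1) p * snd (\<omega> p) = g i p * Dy F p + Dy (r i) p"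
    proof -
      have "(-1) ^ i * ((-1) ^ (i + 1) * Dy (r i) p) = (-1) ^ i * fps_nth (u p * alpha_y p) i"
        using Dr(2)[OF p i] by simp
      then show ?thesis
        by (simp add: g_def j mult_alpha_y_nth algebra_simps flip: power_mult_distrib)
    qed
  qed
  define N where "N p = ?G p * inverse (u p)" for p
  define n where "n i p = fps_nth (N p) i" for i p
  have hN: "holo_series N U" unfolding N_def
    by (intro holo_series_mult hG holo_series_inverse[OF U(1) u])
  have Nn: "fps_nth (N_series k n p) i = fps_nth (N p) i" if "p \<in> U" "i \<le> k" for p i
    using that u(2) hG(3) by (auto simp: N_series_nth n_def N_def)
  have Nu: "N p * (u p * f) = ?G p * f" if "p \<in> U" for p f
  proof -
    have "inverse (u p) * u p = 1" using u(2)[OF that] by (simp add: inverse_mult_eq_1)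
    then show ?thesis unfolding N_def by (metis mult.assoc mult_1)
  qed
  have Fx: "fps_nth (sDx (F_series F k r) p) i = fps_nth (u p * alpha_x p) i"
    and Fy: "fps_nth (sDy (F_series F k r) p) i = fps_nth (u p * alpha_y p) i" if p: "p \<in> U" and i: "i \<le> k" for p i
  proof -
    have "fps_nth (sDx (F_series F k r) p) i = fps_nth (u p * alpha_x p) i \<and>
      fps_nth (sDy (F_series F k r) p) i = fps_nth (u p * alpha_y p) i"
    proof (cases "i = 0")
      case True
      then show ?thesis using u(2)[OF p] by (simp add: F_series_nth alpha_x_nth alpha_y_nth)
    next
      case False
      then have "(\<lambda>q. fps_nth (F_series F k r q) i) = (\<lambda>q. (-1) ^ (i + 1) * r i q)"
        using i by (simp add: F_series_nth fun_eq_iff)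
      then show ?thesis
        using Dr[OF p, of i] i False Dx_cmult[OF hr p, of "(-1) ^ (i + 1)"] Dy_cmult[OF hr p, of "(-1) ^ (i + 1)"]
        by simp
    qed
    then show "fps_nth (sDx (F_series F k r) p) i = fps_nth (u p * alpha_x p) i"
      "fps_nth (sDy (F_series F k r) p) i = fps_nth (u p * alpha_y p) i" by auto
  qed
  have Fe: "fps_nth (sDe (F_series F k r) p) i = fps_nth (u p * Q p) i" if i: "i < k" for p i
  proof -
    have "(of_nat (i + 1) :: complex) \<noteq> 0" by (simp del: of_nat_add of_nat_Suc)
    then show ?thesis
      using i by (simp add: F_series_nth r_def power_add[symmetric] del: of_nat_add of_nat_Suc flip: power_mult_distrib)
  qed
  have "factorization_mod U k (gv_form F \<omega> G R) n (F_series F k r)"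
    unfolding factorization_mod_def
  proof (intro conjI ballI)
    show "holo2 (n i) U" for i unfolding n_def by (rule holo_series_nth[OF hN])
    show "holo_series (F_series F k r) U"
      by (rule holo_F_series[OF F hr])
    show "form1_eq_mod (k + 1) U (gv_form F \<omega> G R) (scale1 (N_series k n) (dt0 (F_series F k r)))"
      unfolding form1_eq_mod_def scale1_def dt0_def form1.sel gv_form_sel
    proof (intro ballI allI conjI impI)
      fix p i assume p: "p \<in> U"
      { assume i: "i < k + 1"
        show "fps_nth (?G p * alpha_x p) i = fps_nth (N_series k n p * sDx (F_series F k r) p) i"
          unfolding Nu[OF p, symmetric] by (rule fps_mult_nth_cong) (use i Nn[OF p] Fx[OF p] in auto)
        show "fps_nth (?G p * alpha_y p) i = fps_nth (N_series k n p * sDy (F_series F k r) p) i"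
          unfolding Nu[OF p, symmetric] by (rule fps_mult_nth_cong) (use i Nn[OF p] Fy[OF p] in auto) }
      assume i: "i + 1 < k + 1"
      show "fps_nth (?R p) i = fps_nth (N_series k n p * sDe (F_series F k r) p) i"
        unfolding GQ[OF p, symmetric] Nu[OF p, symmetric]
        by (rule fps_mult_nth_cong) (use i Nn[OF p] Fe in \<open>auto simp del: sDe_nth\<close>)
    qed
  qed
  then show thesis using fs that by blast
qed

text \<open>
  With these coefficients the form is the total differential of
  \<open>H = F + \<epsilon> r\<^sub>1 - \<epsilon>\<^sup>2 r\<^sub>2 + \<dots>\<close> up to terms of weight above \<open>k\<close>, and an exact form is integrable.
\<close>

lemma francoise_imp_godbillon_vey:
  assumes fs: "francoise_sequence U F \<omega> k g r"
  obtains G R where "gv_sequence U F \<omega> k G R" "gv_francoise_relation U k g r G R"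
proof -
  define G where "G i p = (if i \<le> k then (-1) ^ i * g i p else 0)" for i p
  define R where "R i p = (if i \<in> {1..k} then (-1) ^ (i + 1) * of_nat i * r i p else 0)" for i p
  have r: "holo2 (r i) U" "holo2 (g i) U" if "i \<in> {1..k}" for i using fs that by (auto simp: francoise_sequence_def)
  have g0: "g 0 p = 1" if "p \<in> U" for p using fs that by (auto simp: francoise_sequence_def)
  have "holo2 (G i) U \<and> holo2 (R i) U" if "i \<ge> 1" for i
  proof (cases "i \<le> k")
    case True
    then have "G i = (\<lambda>p. (-1) ^ i * g i p)" "R i = (\<lambda>p. (-1) ^ (i + 1) * of_nat i * r i p)"
      using that by (simp_all add: G_def R_def fun_eq_iff)
    then show ?thesis using r[of i] True that by (simp only:) (intro conjI holo2_cmult; simp)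
  next
    case False
    then have "G i = (\<lambda>p. 0)" "R i = (\<lambda>p. 0)" by (simp_all add: G_def R_def fun_eq_iff)
    then show ?thesis by simp
  qed
  then have co: "gv_coeffs U G R" by (simp add: gv_coeffs_def G_def g0)
  define H where "H = F_series F k r"
  have hH: "holo_series H U" unfolding H_def by (rule holo_F_series[OF F r(1)])
  have eq: "form1_eq_mod (Suc k) U (gv_form F \<omega> G R) (dt0 H)"
    unfolding form1_eq_mod_def dt0_def form1.sel gv_form_sel
  proof (intro ballI allI conjI impI)
    fix p i assume p: "p \<in> U"
    { assume i: "i < Suc k"
      show "fps_nth (eps_series G p * alpha_x p) i = fps_nth (sDx H p) i"
      proof (cases i)
        case 0 then show ?thesis by (simp add: H_def F_series_nth alpha_x_nth G_def g0[OF p])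
      next
        case (Suc j)
        have "g j p * fst (\<omega> p) = g i p * Dx F p + Dx (r i) p"
          using fs p i Suc by (force simp: francoise_sequence_def)
        then have "(-1) ^ j * (g j p * fst (\<omega> p)) = (-1) ^ j * (g i p * Dx F p + Dx (r i) p)" by simp
        then show ?thesis using Suc i Dx_cmult[OF r(1)[of i] p]
          by (simp add: H_def F_series_nth mult_alpha_x_nth G_def algebra_simps)
      qed
      show "fps_nth (eps_series G p * alpha_y p) i = fps_nth (sDy H p) i"
      proof (cases i)
        case 0 then show ?thesis by (simp add: H_def F_series_nth alpha_y_nth G_def g0[OF p])
      next
        case (Suc j)
        have "g j p * snd (\<omega> p) = g i p * Dy F p + Dy (r i) p"
          using fs p i Suc by (force simp: francoise_sequence_def)
        then have "(-1) ^ j * (g j p * snd (\<omega> p)) = (-1) ^ j * (g i p * Dy F p + Dy (r i) p)" by simp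
        then show ?thesis using Suc i Dy_cmult[OF r(1)[of i] p]
          by (simp add: H_def F_series_nth mult_alpha_y_nth G_def algebra_simps)
      qed }
    assume "i + 1 < Suc k"
    then show "fps_nth (eps_series (\<lambda>i. R (i + 1)) p) i = fps_nth (sDe H p) i"
      by (simp add: H_def F_series_nth R_def)
  qed
  have hd: "holo_series (cx (dt0 H)) U" "holo_series (cy (dt0 H)) U" "holo_series (ce (dt0 H)) U"
    using hH by (auto simp: dt0_def holo_series_def simp del: of_nat_add of_nat_Suc
      intro!: holo2_Dx[OF U(1)] holo2_Dy[OF U(1)] holo2_cmult)
  have "form3_zero_mod (k + 1) U (wedge12 (gv_form F \<omega> G R) (dt1 (gv_form F \<omega> G R)))"
    unfolding form3_zero_mod_def
    using wedge_dt1_cong_mod[OF U(1) eq hd] wedge_dt1_exact[OF U(1) hH] by simp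
  then have "gv_sequence U F \<omega> k G R" using co by (simp add: gv_sequence_def)
  moreover have "gv_francoise_relation U k g r G R"
    by (simp add: gv_francoise_relation_def G_def R_def)
  ultimately show thesis using that by blast
qed

text \<open>
  \<open>\<Omega> = N dF\<^sub>\<epsilon>\<close> gives \<open>dF\<^sub>\<epsilon> = (G / N) \<alpha> + (\<partial>F\<^sub>\<epsilon>/\<partial>\<epsilon>) d\<epsilon>\<close>, where \<open>N\<close> is invertible as its constant term is
  \<open>1\<close>.
\<close>

lemma factorization_potential:
  assumes co: "gv_coeffs U G R" and fac: "factorization_mod U k (gv_form F \<omega> G R) n Fe"
  obtains Gt Rt where "gv_coeffs U Gt Rt" "form1_eq_mod (k + 1) U (dt0 Fe) (gv_form F \<omega> Gt Rt)"
proof -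
  note hG = gv_coeffs_holo[OF co]
  have hn: "holo2 (n i) U" if "i \<in> {1..k}" for i using fac that by (auto simp: factorization_mod_def)
  have hFe: "holo_series Fe U" using fac by (simp add: factorization_mod_def)
  have hN: "holo_series (N_series k n) U" by (rule holo_N_series[OF hn])
  have N0: "fps_nth (N_series k n p) 0 = 1" for p by (simp add: N_series_nth)
  define S where "S p = inverse (N_series k n p) * eps_series G p" for p
  have hS: "holo_series S U" unfolding S_def
    by (intro holo_series_mult holo_series_inverse[OF U(1) hN N0] hG)
  define Gt where "Gt i p = fps_nth (S p) i" for i p
  define Rt where "Rt i p = of_nat i * fps_nth (Fe p) i" for i p
  have "gv_coeffs U Gt Rt"
    unfolding gv_coeffs_def
  proof (intro conjI ballI allI impI)
    show "Gt 0 p = 1" if "p \<in> U" for p using hG(3)[OF that] N0 by (simp add: Gt_def S_def)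
    show "holo2 (Gt i) U" "holo2 (Rt i) U" for i
      unfolding Gt_def Rt_def by (intro holo2_cmult holo_series_nth[OF hS] holo_series_nth[OF hFe])+
  qed
  moreover have "form1_eq_mod (k + 1) U (dt0 Fe) (gv_form F \<omega> Gt Rt)"
    unfolding form1_eq_mod_def dt0_def form1.sel gv_form_sel
  proof (intro ballI allI conjI impI)
    fix p i assume p: "p \<in> U"
    have Gt: "eps_series Gt p = S p" by (rule fps_ext) (simp add: Gt_def)
    have inv: "inverse (N_series k n p) * (N_series k n p * f) = f" for f
      using N0 by (simp add: mult.assoc[symmetric] inverse_mult_eq_1)
    have fx: "fps_nth (eps_series G p * alpha_x p) j = fps_nth (N_series k n p * sDx Fe p) j"
      "fps_nth (eps_series G p * alpha_y p) j = fps_nth (N_series k n p * sDy Fe p) j" if "j \<le> k" for j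
      using fac p that by (auto simp: factorization_mod_def form1_eq_mod_def scale1_def dt0_def gv_form_sel)
    { assume i: "i < k + 1"
      have "fps_nth (eps_series Gt p * alpha_x p) i = fps_nth (inverse (N_series k n p) * (N_series k n p * sDx Fe p)) i"
        unfolding Gt S_def mult.assoc by (rule fps_mult_nth_cong) (use fx i in auto)
      then show "fps_nth (sDx Fe p) i = fps_nth (eps_series Gt p * alpha_x p) i" unfolding inv by simp
      have "fps_nth (eps_series Gt p * alpha_y p) i = fps_nth (inverse (N_series k n p) * (N_series k n p * sDy Fe p)) i"
        unfolding Gt S_def mult.assoc by (rule fps_mult_nth_cong) (use fx i in auto)
      then show "fps_nth (sDy Fe p) i = fps_nth (eps_series Gt p * alpha_y p) i" unfolding inv by simp }
    show "fps_nth (sDe Fe p) i = fps_nth (eps_series (\<lambda>i. Rt (i + 1)) p) i" by (simp add: Rt_def)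
  qed
  ultimately show thesis using that by blast
qed

text \<open>
  The coefficients of \<open>dF\<^sub>\<epsilon> = G \<alpha> + R d\<epsilon>\<close>. In order \<open>0\<close> they say \<open>dF\<^sub>0 = dF\<close>, which determines \<open>F\<^sub>0\<close> only up to a
  constant.
\<close>

lemma potential_coefficients:
  assumes hFe: "holo_series Fe U" and co: "gv_coeffs U Gt Rt"
    and eq: "form1_eq_mod (k + 1) U (dt0 Fe) (gv_form F \<omega> Gt Rt)"
  shows "p \<in> U \<Longrightarrow> i \<in> {1..k} \<Longrightarrow> Dx (\<lambda>q. fps_nth (Fe q) i) p = Gt i p * Dx F p + Gt (i - 1) p * fst (\<omega> p)"
    and "p \<in> U \<Longrightarrow> i \<in> {1..k} \<Longrightarrow> Dy (\<lambda>q. fps_nth (Fe q) i) p = Gt i p * Dy F p + Gt (i - 1) p * snd (\<omega> p)"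
    and "p \<in> U \<Longrightarrow> i \<in> {1..k} \<Longrightarrow> Rt i p = of_nat i * fps_nth (Fe p) i"
    and "\<exists>c. \<forall>p\<in>U. fps_nth (Fe p) 0 = c + F p"
proof -
  have xy: "Dx (\<lambda>q. fps_nth (Fe q) i) p = Gt i p * Dx F p + (if i = 0 then 0 else Gt (i - 1) p * fst (\<omega> p))"
    "Dy (\<lambda>q. fps_nth (Fe q) i) p = Gt i p * Dy F p + (if i = 0 then 0 else Gt (i - 1) p * snd (\<omega> p))"
    if "p \<in> U" "i \<le> k" for p i
    using eq that by (auto simp: form1_eq_mod_def dt0_def gv_form_sel mult_alpha_x_nth mult_alpha_y_nth)
  show "p \<in> U \<Longrightarrow> i \<in> {1..k} \<Longrightarrow> Dx (\<lambda>q. fps_nth (Fe q) i) p = Gt i p * Dx F p + Gt (i - 1) p * fst (\<omega> p)"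
    "p \<in> U \<Longrightarrow> i \<in> {1..k} \<Longrightarrow> Dy (\<lambda>q. fps_nth (Fe q) i) p = Gt i p * Dy F p + Gt (i - 1) p * snd (\<omega> p)"
    using xy[of p i] by auto
  show "Rt i p = of_nat i * fps_nth (Fe p) i" if "p \<in> U" "i \<in> {1..k}"
  proof -
    obtain j where "i = Suc j" "j < k" using \<open>i \<in> {1..k}\<close> by (cases i) auto
    then show ?thesis using eq that(1) by (auto simp: form1_eq_mod_def dt0_def gv_form_sel)
  qed
  show "\<exists>c. \<forall>p\<in>U. fps_nth (Fe p) 0 = c + F p"
    by (rule equal_partials_imp_differ_by_const[OF U holo_series_nth[OF hFe] F])
      (use xy[of _ 0] co in \<open>auto simp: gv_coeffs_def\<close>)
qed

lemma potential_eq_F_series: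
  assumes c: "\<forall>p\<in>U. fps_nth (Fe p) 0 = c + F p"
    and r: "\<And>p i. p \<in> U \<Longrightarrow> i \<in> {1..k} \<Longrightarrow> fps_nth (Fe p) i = (-1) ^ (i + 1) * r i p"
  shows "fun_eq_mod (k + 1) U Fe (\<lambda>p. fps_const c + F_series F k r p)"
  unfolding fun_eq_mod_def using c r by (auto simp: F_series_nth)

lemma potential_imp_francoise:
  assumes hFe: "holo_series Fe U" and co: "gv_coeffs U Gt Rt"
    and eq: "form1_eq_mod (k + 1) U (dt0 Fe) (gv_form F \<omega> Gt Rt)"
    and g0: "\<forall>p\<in>U. g 0 p = 1" and rel: "gv_francoise_relation U k g r Gt Rt"
  shows "francoise_sequence U F \<omega> k g r"
    and "\<exists>c. fun_eq_mod (k + 1) U Fe (\<lambda>p. fps_const c + F_series F k r p)"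
proof -
  note pc = potential_coefficients[OF hFe co eq]
  have sg: "(-1) ^ i * ((-1) ^ i * z) = z" for i and z :: complex
    by (simp add: mult.assoc[symmetric] flip: power_mult_distrib)
  have Gr: "Gt i p = (-1) ^ i * g i p" "Rt i p = (-1) ^ (i + 1) * of_nat i * r i p" if "p \<in> U" "i \<in> {1..k}" for p i
    using rel that by (auto simp: gv_francoise_relation_def)
  have g: "g i p = (-1) ^ i * Gt i p" if "p \<in> U" "i \<le> k" for p i
    using Gr(1)[OF that(1), of i] that g0 co sg[of i "g i p"] by (cases "i = 0") (auto simp: gv_coeffs_def)
  have Fer: "fps_nth (Fe p) i = (-1) ^ (i + 1) * r i p" if p: "p \<in> U" and i: "i \<in> {1..k}" for p i
  proof -
    have "of_nat i * fps_nth (Fe p) i = of_nat i * ((-1) ^ (i + 1) * r i p)"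
      using pc(3)[OF p i] Gr(2)[OF p i] by (simp add: mult_ac)
    moreover have "(of_nat i :: complex) \<noteq> 0" using i by auto
    ultimately show ?thesis by (metis mult_left_cancel)
  qed
  have r: "r i p = (-1) ^ (i + 1) * fps_nth (Fe p) i" if "p \<in> U" "i \<in> {1..k}" for p i
    using Fer[OF that] sg[of "i + 1" "r i p"] by simp
  show "francoise_sequence U F \<omega> k g r"
    unfolding francoise_sequence_def
  proof (intro conjI g0 ballI)
    fix i assume i: "i \<in> {1..k}"
    have hG: "holo2 (Gt i) U" using co i by (auto simp: gv_coeffs_def)
    show "holo2 (g i) U"
      by (rule holo2_cong[OF U(1) _ holo2_cmult[OF hG, of "(-1) ^ i"]]) (use g i in auto)
    note hc = holo2_cmult[OF holo_series_nth[OF hFe, of i], of "(-1) ^ (i + 1)"]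
    show "holo2 (r i) U"
      by (rule holo2_cong[OF U(1) _ hc]) (use r i in auto)
    fix p assume p: "p \<in> U"
    have D: "Dx (r i) p = (-1) ^ (i + 1) * Dx (\<lambda>q. fps_nth (Fe q) i) p"
      "Dy (r i) p = (-1) ^ (i + 1) * Dy (\<lambda>q. fps_nth (Fe q) i) p"
      using partials_cong[OF U(1) r[symmetric] hc p] i
        Dx_cmult[OF holo_series_nth[OF hFe] p] Dy_cmult[OF holo_series_nth[OF hFe] p] by metis+
    obtain j where j: "i = Suc j" using i by (cases i) auto
    have gi: "g i p = (-1) ^ i * Gt i p" and gj: "g (i - 1) p = (-1) ^ (i + 1) * Gt (i - 1) p"
      using g[OF p, of i] g[OF p, of j] i j by simp_all
    show "g (i - 1) p * fst (\<omega> p) = g i p * Dx F p + Dx (r i) p"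
      unfolding D pc(1)[OF p i] gi gj by (simp add: algebra_simps)
    show "g (i - 1) p * snd (\<omega> p) = g i p * Dy F p + Dy (r i) p"
      unfolding D pc(2)[OF p i] gi gj by (simp add: algebra_simps)
  qed
  obtain c where "\<forall>p\<in>U. fps_nth (Fe p) 0 = c + F p" using pc(4) by blast
  from potential_eq_F_series[OF this Fer]
  show "\<exists>c. fun_eq_mod (k + 1) U Fe (\<lambda>p. fps_const c + F_series F k r p)" by blast
qed

lemma factorization_imp_F_series:
  assumes co: "gv_coeffs U G R" and fac: "factorization_mod U k (gv_form F \<omega> G R) n Fe"
  shows "\<exists>c r. (\<forall>i\<in>{1..k}. holo2 (r i) U) \<and> fun_eq_mod (k + 1) U Fe (\<lambda>p. fps_const c + F_series F k r p)"
proof -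
  have hFe: "holo_series Fe U" using fac by (simp add: factorization_mod_def)
  obtain Gt Rt where t: "gv_coeffs U Gt Rt" "form1_eq_mod (k + 1) U (dt0 Fe) (gv_form F \<omega> Gt Rt)"
    by (rule factorization_potential[OF co fac])
  obtain c where c: "\<forall>p\<in>U. fps_nth (Fe p) 0 = c + F p" using potential_coefficients(4)[OF hFe t] by blast
  define r where "r i p = (-1) ^ (i + 1) * fps_nth (Fe p) i" for i p
  have "fps_nth (Fe p) i = (-1) ^ (i + 1) * r i p" for p i
    by (simp add: r_def mult.assoc[symmetric] flip: power_mult_distrib)
  from potential_eq_F_series[OF c this]
  have "fun_eq_mod (k + 1) U Fe (\<lambda>p. fps_const c + F_series F k r p)" .
  moreover have "\<forall>i\<in>{1..k}. holo2 (r i) U"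
    unfolding r_def by (intro ballI holo2_cmult holo_series_nth[OF hFe])
  ultimately show ?thesis by metis
qed

end


section \<open>Melnikov functions, Francoise sequences and Godbillon-Vey sequences\<close>

lemma tubular_cycles_imp_deformation:
  assumes tube: "tubular_cycles U F \<Sigma> \<gamma>" and omega: "holo_form \<omega> U"
    and melnikov: "melnikov_functions U F \<omega> \<Sigma> \<gamma> M"
  obtains \<Phi> \<Psi> \<Phi>' \<Psi>' where "deformation U F (F ` \<Sigma>) \<Phi> \<Psi> \<Phi>' \<Psi>' \<gamma> \<Sigma> \<omega> M"
proof -
  let ?T = "F ` \<Sigma>"
  obtain \<Phi> \<Psi> where C1: "C1_on \<Phi> (annulus \<times> ?T)" "C1_on \<Psi> U"
    and \<Phi>: "\<forall>q \<in> annulus \<times> ?T. \<Phi> q \<in> U \<and> \<Psi> (\<Phi> q) = q \<and> F (\<Phi> q) = snd q"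
    and \<Psi>: "\<forall>p\<in>U. \<Psi> p \<in> annulus \<times> ?T \<and> \<Phi> (\<Psi> p) = p"
    and \<gamma>: "\<forall>t \<in> ?T. \<forall>s\<in>{0..1}. \<gamma> t s = \<Phi> (cis (2 * pi * s), t)"
    and \<Sigma>: "\<Sigma> = (\<lambda>t. \<Phi> (1, t)) ` ?T"
    and sec: "(\<lambda>t. fst (\<Phi> (1, t))) holomorphic_on ?T" "(\<lambda>t. snd (\<Phi> (1, t))) holomorphic_on ?T"
    using tube unfolding tubular_cycles_def by (elim conjE exE) (rule that)
  obtain \<Phi>' where \<Phi>': "\<forall>q\<in>annulus \<times> ?T. (\<Phi> has_derivative blinfun_apply (\<Phi>' q)) (at q)"
    using C1(1) unfolding C1_on_def by blast
  obtain \<Psi>' where \<Psi>': "\<forall>q\<in>U. (\<Psi> has_derivative blinfun_apply (\<Psi>' q)) (at q)"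
    using C1(2) unfolding C1_on_def by blast
  have U: "open U" "holo2 F U" "open ?T" "simply_connected ?T" using tube by (auto simp: tubular_cycles_def)
  have "deformation U F ?T \<Phi> \<Psi> \<Phi>' \<Psi>' \<gamma> \<Sigma> \<omega> M"
    by unfold_locales (rule U sec \<Sigma> omega melnikov \<Phi>[THEN bspec] \<Psi>[THEN bspec]
        \<gamma>[THEN bspec, THEN bspec] \<Phi>'[THEN bspec] \<Psi>'[THEN bspec]; assumption)+
  then show thesis by (rule that)
qed

theorem theorem2p1:
  fixes U \<Sigma> :: "pt set" and F :: "pt \<Rightarrow> complex" and \<omega> :: oneform
    and \<gamma> :: "complex \<Rightarrow> real \<Rightarrow> pt" and t0 :: complex
    and M :: "nat \<Rightarrow> complex \<Rightarrow> complex" and k :: nat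
  assumes tube: "tubular_cycles U F \<Sigma> \<gamma>" and t0: "t0 \<in> F ` \<Sigma>"
    and omega: "holo_form \<omega> U"
    and melnikov: "melnikov_functions U F \<omega> \<Sigma> \<gamma> M"
    and k: "k \<ge> 1"
  shows
    "((\<forall>i\<in>{1..k}. \<forall>t \<in> F ` \<Sigma>. M i t = 0) \<longleftrightarrow> (\<exists>G R. gv_sequence U F \<omega> k G R))
     \<and>
     (\<forall>g r. francoise_sequence U F \<omega> k g r \<longrightarrow>
        (\<exists>G R. gv_sequence U F \<omega> k G R \<and> gv_francoise_relation U k g r G R))
     \<and>
     (\<forall>G R. gv_sequence U F \<omega> k G R \<longrightarrow>
        (\<exists>n r. (\<forall>i\<in>{1..k}. holo2 (r i) U) \<and>
           factorization_mod U k (gv_form F \<omega> G R) n (F_series F k r)) \<and>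
        (\<forall>n Fe. factorization_mod U k (gv_form F \<omega> G R) n Fe \<longrightarrow>
           (\<exists>c r. (\<forall>i\<in>{1..k}. holo2 (r i) U) \<and>
              fun_eq_mod (k + 1) U Fe (\<lambda>p. fps_const c + F_series F k r p)) \<and>
           (\<exists>Gt Rt. gv_coeffs U Gt Rt \<and>
              form1_eq_mod (k + 1) U (dt0 Fe) (gv_form F \<omega> Gt Rt)) \<and>
           (\<forall>Gt Rt g r. gv_coeffs U Gt Rt \<and>
              form1_eq_mod (k + 1) U (dt0 Fe) (gv_form F \<omega> Gt Rt) \<and>
              (\<forall>p\<in>U. g 0 p = 1) \<and> gv_francoise_relation U k g r Gt Rt \<longrightarrow>
              francoise_sequence U F \<omega> k g r \<and>
              (\<exists>c. fun_eq_mod (k + 1) U Fe (\<lambda>p. fps_const c + F_series F k r p)))))"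
proof -
  obtain \<Phi> \<Psi> \<Phi>' \<Psi>' where "deformation U F (F ` \<Sigma>) \<Phi> \<Psi> \<Phi>' \<Psi>' \<gamma> \<Sigma> \<omega> M"
    by (rule tubular_cycles_imp_deformation[OF tube omega melnikov])
  then interpret deformation U F "F ` \<Sigma>" \<Phi> \<Psi> \<Phi>' \<Psi>' \<gamma> \<Sigma> \<omega> M .
  interpret foliation U F \<omega>
    by unfold_locales (rule open_U connected_U F omega dF_nonzero; assumption?)+
  have i: "(\<forall>i\<in>{1..k}. \<forall>t \<in> F ` \<Sigma>. M i t = 0) \<longleftrightarrow> (\<exists>G R. gv_sequence U F \<omega> k G R)"
  proof
    assume "\<forall>i\<in>{1..k}. \<forall>t \<in> F ` \<Sigma>. M i t = 0"
    then obtain g r where "francoise_sequence U F \<omega> k g r" using melnikov_zero_imp_francoise[of k] by blast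
    then obtain G R where "gv_sequence U F \<omega> k G R" by (rule francoise_imp_godbillon_vey)
    then show "\<exists>G R. gv_sequence U F \<omega> k G R" by blast
  next
    assume "\<exists>G R. gv_sequence U F \<omega> k G R"
    then obtain G R where "gv_sequence U F \<omega> k G R" by blast
    then obtain n g r where "francoise_sequence U F \<omega> k g r" by (rule godbillon_vey_imp_francoise)
    then show "\<forall>i\<in>{1..k}. \<forall>t \<in> F ` \<Sigma>. M i t = 0" using francoise_imp_melnikov_zero by blast
  qed
  have ii: "\<exists>G R. gv_sequence U F \<omega> k G R \<and> gv_francoise_relation U k g r G R"
    if "francoise_sequence U F \<omega> k g r" for g r
    by (rule francoise_imp_godbillon_vey[OF that]) blast
  have iiia: "\<exists>n r. (\<forall>i\<in>{1..k}. holo2 (r i) U) \<and> factorization_mod U k (gv_form F \<omega> G R) n (F_series F k r)"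
    if gv: "gv_sequence U F \<omega> k G R" for G R
  proof -
    obtain n g r where "francoise_sequence U F \<omega> k g r" "factorization_mod U k (gv_form F \<omega> G R) n (F_series F k r)"
      by (rule godbillon_vey_imp_francoise[OF gv])
    then show ?thesis by (auto simp: francoise_sequence_def)
  qed
  show ?thesis
  proof (intro conjI allI impI i ii iiia; (elim conjE)?)
    fix G R n Fe assume gv: "gv_sequence U F \<omega> k G R"
      and fac: "factorization_mod U k (gv_form F \<omega> G R) n Fe"
    have co: "gv_coeffs U G R" using gv by (simp add: gv_sequence_def)
    have hFe: "holo_series Fe U" using fac by (simp add: factorization_mod_def)
    show "\<exists>c r. (\<forall>i\<in>{1..k}. holo2 (r i) U) \<and> fun_eq_mod (k + 1) U Fe (\<lambda>p. fps_const c + F_series F k r p)"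
      by (rule factorization_imp_F_series[OF co fac])
    show "\<exists>Gt Rt. gv_coeffs U Gt Rt \<and> form1_eq_mod (k + 1) U (dt0 Fe) (gv_form F \<omega> Gt Rt)"
      by (rule factorization_potential[OF co fac]) blast
    fix Gt Rt g r
    assume h: "gv_coeffs U Gt Rt" "form1_eq_mod (k + 1) U (dt0 Fe) (gv_form F \<omega> Gt Rt)"
      "\<forall>p\<in>U. g 0 p = 1" "gv_francoise_relation U k g r Gt Rt"
    show "francoise_sequence U F \<omega> k g r"
      "\<exists>c. fun_eq_mod (k + 1) U Fe (\<lambda>p. fps_const c + F_series F k r p)"
      by (rule potential_imp_francoise[OF hFe h])+
  qed
qed

end
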